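(* Let $Z$ be a compact metric space with at least two points, equipped with a doubling measure $\nu$, let $1\le p<\infty$ and $0<\theta<1$. Let $s_\nu>0$ be an exponent such that $$\frac{\nu(B_Z(\zeta,r'))}{\nu(B_Z(\zeta,r))}\ge c\Bigl(\frac{r'}{r}\Bigr)^{s_\nu}\quad\text{for all }\zeta\in Z,\ 0<r'\le r\le2\operatorname{diam}Z,$$ with some constant $c>0$. Then: (1) Lipschitz functions are dense in $B^\theta_{p,p}(Z)$, and every function in $B^\theta_{p,p}(Z)$ has a representative (i.e. coincides $\nu$-a.e. with a function) that is quasicontinuous with respect to the Besov capacity $\operatorname{Cap}_{B^\theta_{p,p}(Z)}$. (2) If $p>s_\nu/\theta$, then every function in $B^\theta_{p,p}(Z)$ has a Hölder continuous representative. (3) If $p\theta<s_\nu$ and $\nu$ is in addition reverse-doubling, i.e. there are $\eta>0$ and $C>0$ such that $$\frac{\nu(B_Z(\zeta,r'))}{\nu(B_Z(\zeta,r))}\le C\Bigl(\frac{r'}{r}\Bigr)^{\eta}\quad\text{for all }\zeta\in Z,\ 0<r'\le r\le2\operatorname{diam}Z,$$ then, with $q=s_\nu p/(s_\nu-p\theta)$, functions in $B^\theta_{p,p}(Z)$ belong to $L^q(Z)$ and have $L^q$-Lebesgue points outside a set of zero $B^\theta_{p,p}(Z)$-capacity; that is, every function in $B^\theta_{p,p}(Z)$ has a representative $u\in L^q(Z)$ such that $$\lim_{r\to0^+}\frac1{\nu(B_Z(\zeta,r))}\int_{B_Z(\zeta,r)}|u-u(\zeta)|^q\,d\nu=0$$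 for all $\zeta\in Z$ outside a set $F\subset Z$ with $\operatorname{Cap}_{B^\theta_{p,p}(Z)}(F)=0$.
   Context: Balls $B_Z(\zeta,r)=\{\xi\in Z:d_Z(\xi,\zeta)<r\}$ are open. A Borel regular measure $\nu$ is doubling if there is $C>0$ with $0<\nu(2B)\le C\nu(B)<\infty$ for all balls $B$, where $2B(x,r)=B(x,2r)$. $B^\theta_{p,p}(Z)$ consists of $u\in L^p(Z,\nu)$ with $$\|u\|_{\theta,p}^p=\int_Z\int_Z\frac{|u(\zeta)-u(\xi)|^p}{d_Z(\zeta,\xi)^{p\theta}}\frac{d\nu(\xi)\,d\nu(\zeta)}{\nu(B_Z(\zeta,d_Z(\zeta,\xi)))}<\infty$$ (the inner integral is over $\xi\ne\zeta$), with norm $\|u\|_{\theta,p}+\|u\|_{L^p(Z)}$. The Besov capacity of $E\subset Z$ is $\operatorname{Cap}_{B^\theta_{p,p}(Z)}(E)=\inf_u(\|u\|_{\theta,p}^p+\|u\|_{L^p(Z)}^p)$, infimum over all $u\in B^\theta_{p,p}(Z)$ with $u\ge1$ $\nu$-a.e. on a neighborhood of $E$. A function $f$ on $Z$ is quasicontinuous with respect to $\operatorname{Cap}_{B^\theta_{p,p}(Z)}$ if for each $\eta>0$ there is an open $G\subset Z$ with $\operatorname{Cap}_{B^\theta_{p,p}(Z)}(G)<\eta$ such that $f|_{Z\setminus G}$ is continuous. *)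

theory Defs
  imports "HOL-Analysis.Analysis"
begin

text \<open>
  A Borel regular measure is often taken to be an outer measure. Here it is a measure on a
  sigma-algebra that contains the Borel sets, in which every measurable set has a Borel hull of the
  same measure; this covers Borel measures as well as their completions.
\<close>

definition borel_regular :: "'a::metric_space measure \<Rightarrow> bool" where
  "borel_regular \<nu> \<longleftrightarrow>
     space \<nu> = UNIV \<and> sets borel \<subseteq> sets \<nu> \<and>
     (\<forall>A \<in> sets \<nu>. \<exists>B \<in> sets borel. A \<subseteq> B \<and> emeasure \<nu> B = emeasure \<nu> A)"

definition doubling_measure :: "'a::metric_space measure \<Rightarrow> bool" where
  "doubling_measure \<nu> \<longleftrightarrow>
     borel_regular \<nu> \<and>
     (\<exists>C>0. \<forall>x. \<forall>r>0.
        0 < emeasure \<nu> (ball x (2 * r)) \<and>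
        emeasure \<nu> (ball x (2 * r)) \<le> ennreal C * emeasure \<nu> (ball x r) \<and>
        emeasure \<nu> (ball x r) < \<infinity>)"

definition reverse_doubling_measure :: "'a::metric_space measure \<Rightarrow> bool" where
  "reverse_doubling_measure \<nu> \<longleftrightarrow>
     (\<exists>\<eta>>0. \<exists>C>0. \<forall>\<zeta> r r'. 0 < r' \<and> r' \<le> r \<and> r \<le> 2 * diameter (UNIV :: 'a set) \<longrightarrow>
        measure \<nu> (ball \<zeta> r') / measure \<nu> (ball \<zeta> r) \<le> C * (r' / r) powr \<eta>)"

definition Lp_space :: "'a measure \<Rightarrow> real \<Rightarrow> ('a \<Rightarrow> real) set" where
  "Lp_space \<nu> p = {u \<in> borel_measurable \<nu>. integrable \<nu> (\<lambda>x. \<bar>u x\<bar> powr p)}"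

definition Lp_norm :: "'a measure \<Rightarrow> real \<Rightarrow> ('a \<Rightarrow> real) \<Rightarrow> real" where
  "Lp_norm \<nu> p u = (\<integral>x. \<bar>u x\<bar> powr p \<partial>\<nu>) powr (1 / p)"

text \<open>The \<open>p\<close>-th power of the Besov seminorm, as an extended nonnegative real.\<close>

definition besov_energy :: "'a::metric_space measure \<Rightarrow> real \<Rightarrow> real \<Rightarrow> ('a \<Rightarrow> real) \<Rightarrow> ennreal" where
  "besov_energy \<nu> \<theta> p u =
     (\<integral>\<^sup>+ \<zeta>. (\<integral>\<^sup>+ \<xi> \<in> - {\<zeta>}.
        ennreal (\<bar>u \<zeta> - u \<xi>\<bar> powr p / dist \<zeta> \<xi> powr (p * \<theta>)) / emeasure \<nu> (ball \<zeta> (dist \<zeta> \<xi>))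
      \<partial>\<nu>) \<partial>\<nu>)"

definition besov_space :: "'a::metric_space measure \<Rightarrow> real \<Rightarrow> real \<Rightarrow> ('a \<Rightarrow> real) set" where
  "besov_space \<nu> \<theta> p = {u \<in> Lp_space \<nu> p. besov_energy \<nu> \<theta> p u < \<infinity>}"

text \<open>Meaningful on the Besov space only, where the energy is finite.\<close>

definition besov_norm :: "'a::metric_space measure \<Rightarrow> real \<Rightarrow> real \<Rightarrow> ('a \<Rightarrow> real) \<Rightarrow> real" where
  "besov_norm \<nu> \<theta> p u = enn2real (besov_energy \<nu> \<theta> p u) powr (1 / p) + Lp_norm \<nu> p u"

definition besov_cap :: "'a::metric_space measure \<Rightarrow> real \<Rightarrow> real \<Rightarrow> 'a set \<Rightarrow> ennreal" where
  "besov_cap \<nu> \<theta> p E =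
     (INF u \<in> {u \<in> besov_space \<nu> \<theta> p. \<exists>U. open U \<and> E \<subseteq> U \<and> (AE x in \<nu>. x \<in> U \<longrightarrow> u x \<ge> 1)}.
        besov_energy \<nu> \<theta> p u + (\<integral>\<^sup>+ x. ennreal (\<bar>u x\<bar> powr p) \<partial>\<nu>))"

definition besov_quasicontinuous ::
    "'a::metric_space measure \<Rightarrow> real \<Rightarrow> real \<Rightarrow> ('a \<Rightarrow> real) \<Rightarrow> bool" where
  "besov_quasicontinuous \<nu> \<theta> p f \<longleftrightarrow>
     (\<forall>\<eta>>0. \<exists>G. open G \<and> besov_cap \<nu> \<theta> p G < ennreal \<eta> \<and> continuous_on (- G) f)"

definition holder_continuous :: "('a::metric_space \<Rightarrow> real) \<Rightarrow> bool" where
  "holder_continuous f \<longleftrightarrow>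
     (\<exists>\<alpha> C. 0 < \<alpha> \<and> \<alpha> \<le> 1 \<and> 0 \<le> C \<and> (\<forall>x y. \<bar>f x - f y\<bar> \<le> C * dist x y powr \<alpha>))"

end

theory Submission
  imports Defs
begin

text \<open>
  Everything is derived from the Lipschitz averages \<open>smooth r u\<close> of a Besov function at the dyadic radii
  \<open>r\<^sub>j = 2 diam Z / 2 ^ j\<close>. With \<open>osc u r z\<close> the mean of \<open>\<bar>u z - u y\<bar> powr p\<close> over the ball of radius
  \<open>4 * r\<close> about \<open>z\<close>, the sum over \<open>j\<close> of \<open>r\<^sub>j powr (- p * \<theta>)\<close> times the integral of \<open>osc u r\<^sub>j\<close> is
  dominated by the energy, and the increments between consecutive averages are controlled at distance \<open>d\<close> by
  \<open>min 1 (d / r\<^sub>j)\<close> times ball means of \<open>osc u r\<^sub>j\<close>. Conversely, a weighted Jensen inequality bounds the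
  energy of any function whose differences are dominated by such a series. Applied to the tails of the
  telescoping series of increments this yields density, and, applied to the sum of the absolute values of the
  increments, a weak-type capacity estimate, which makes the averages converge uniformly off open sets of small
  capacity. If \<open>p * \<theta> > s\<close>, the series converges uniformly at a Hoelder rate.

  If \<open>p * \<theta> < s\<close>, the same telescoping series, cut at a radius that balances the two error terms (Hedberg's
  trick), gives a Sobolev-Poincare inequality on every ball, hence the embedding into \<open>L\<close> with exponent \<open>q\<close>. The
  right-hand sides of these inequalities tend to zero as the radius does, except on a set which is seen to have
  capacity zero by a Vitali covering argument and the estimate of the capacity of balls.
\<close>

section \<open>Jensen inequalities and dyadic sums\<close>

text \<open>The case \<open>p = 1\<close> is included, where the maximal operator is not bounded on
  \<open>L^p\<close>; so no maximal function occurs. Its place is taken by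
  \<open>tail_osc u n\<close>, an integrable function that bounds pointwise, up to the factor
  \<open>rad j powr (p * \<theta>)\<close>, the oscillations at all scales \<open>rad j\<close> with
  \<open>j \<ge> n\<close>. It yields almost everywhere convergence of the averages with a rate, in
  place of the differentiation theorem, and in Hedberg's argument it enters the final bound
  linearly, so that integrating it already gives the strong \<open>L^q\<close> estimate. Plain ball
  averages may be discontinuous in the centre. Averaging against a tent makes them Lipschitz, hence
  usable as approximants, and makes superlevel sets of sums of absolute increments open, so that
  truncated sums are admissible for the capacity of these sets as they stand. The hypothesis
  \<open>\<theta> < 1\<close> enters through the second exponent of
  \<open>scale_wt \<theta> (1 - \<theta>)\<close>: for radii \<open>r\<close> above the distance
  \<open>d\<close>, the Lipschitz gain \<open>d / r\<close> of an increment has to beat the factor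
  \<open>(r / d) powr \<theta>\<close> that comes from the energy.\<close>

lemma powr_tangent_le:
  fixes p m f :: real
  assumes "1 \<le> p" "0 < m" "0 \<le> f"
  shows "p * m powr (p - 1) * f \<le> f powr p + (p - 1) * m powr p"
proof (cases "p = 1")
  case True
  then show ?thesis using assms by simp
next
  case False
  then have p: "p > 1" using assms by simp
  define q where "q = p / (p - 1)"
  have q: "q > 1" "1 / p + 1 / q = 1" "(p - 1) * q = p" using p by (auto simp: q_def field_simps)
  \<comment> \<open>Young's inequality, rearranged, says that the graph of \<open>f powr p\<close>
    lies above its tangent at \<open>m\<close>. For \<open>p = 1\<close> there is no finite
    conjugate exponent, hence the case split.\<close>
  have "f * m powr (p - 1) \<le> f powr p / p + (m powr (p - 1)) powr q / q"
    using Youngs_inequality[of p q f "m powr (p - 1)"] p q assms by simp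
  also have "(m powr (p - 1)) powr q = m powr p" by (simp add: powr_powr q)
  finally have "p * (f * m powr (p - 1)) \<le> p * (f powr p / p + m powr p / q)"
    using p by (intro mult_left_mono) auto
  also have "\<dots> = f powr p + (p - 1) * m powr p" using p by (simp add: q_def field_simps)
  finally show ?thesis by (simp add: mult_ac)
qed

text \<open>Integrate the tangent inequality at \<open>m = t / k\<close> against \<open>K\<close>.
  Using a tangent instead of normalising \<open>K\<close> requires only an upper bound for the mass
  of \<open>K\<close> and allows an infinite right-hand side.\<close>

lemma nn_integral_powr_Jensen:
  fixes f :: "'a \<Rightarrow> real"
  assumes p: "1 \<le> p" and f[measurable]: "f \<in> borel_measurable M" and K[measurable]: "K \<in> borel_measurable M"
    and f0: "\<And>x. 0 \<le> f x" and k: "0 < k" and Kk: "(\<integral>\<^sup>+ x. K x \<partial>M) \<le> ennreal k" and t: "0 \<le> t"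
    and le: "ennreal t \<le> (\<integral>\<^sup>+ x. K x * ennreal (f x) \<partial>M)"
  shows "ennreal (t powr p) \<le> ennreal (k powr (p - 1)) * (\<integral>\<^sup>+ x. K x * ennreal (f x powr p) \<partial>M)"
proof (cases "t = 0")
  case False
  with t have t: "t > 0" by simp
  define m where "m = t / k"
  have m: "m > 0" using t k by (simp add: m_def)
  define I where "I = (\<integral>\<^sup>+ x. K x * ennreal (f x powr p) \<partial>M)"
  have "ennreal (p * m powr (p - 1) * t) = ennreal (p * m powr (p - 1)) * ennreal t"
    using p t by (simp add: ennreal_mult)
  also have "\<dots> \<le> ennreal (p * m powr (p - 1)) * (\<integral>\<^sup>+ x. K x * ennreal (f x) \<partial>M)"
    by (intro mult_left_mono le) simp
  also have "\<dots> = (\<integral>\<^sup>+ x. K x * ennreal (p * m powr (p - 1) * f x) \<partial>M)"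
    using p f0 by (subst nn_integral_cmult[symmetric]) (auto simp: ennreal_mult mult_ac)
  also have "\<dots> \<le> (\<integral>\<^sup>+ x. K x * ennreal (f x powr p) + K x * ennreal ((p - 1) * m powr p) \<partial>M)"
    using powr_tangent_le[OF p m f0] p
    by (intro nn_integral_mono) (auto simp flip: distrib_left ennreal_plus intro!: mult_left_mono ennreal_leI)
  also have "\<dots> = I + (\<integral>\<^sup>+ x. K x \<partial>M) * ennreal ((p - 1) * m powr p)"
    by (simp add: nn_integral_add I_def nn_integral_multc)
  also have "\<dots> \<le> I + ennreal k * ennreal ((p - 1) * m powr p)"
    by (intro add_left_mono mult_right_mono Kk) simp
  also have "\<dots> = I + ennreal ((p - 1) * m powr (p - 1) * t)"
  proof -
    have "m powr p = m powr (p - 1) * m" using m by (simp add: powr_mult_base[symmetric] powr_diff field_simps)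
    then have "k * ((p - 1) * m powr p) = (p - 1) * m powr (p - 1) * t"
      using k by (simp add: m_def)
    moreover have "ennreal k * ennreal ((p - 1) * m powr p) = ennreal (k * ((p - 1) * m powr p))"
      using k p by (intro ennreal_mult[symmetric]) auto
    ultimately show ?thesis by (simp only:)
  qed
  finally have *: "ennreal (p * m powr (p - 1) * t) \<le> I + ennreal ((p - 1) * m powr (p - 1) * t)" .
  \<comment> \<open>The term cancelled on both sides is finite; if \<open>I\<close> is infinite
    there is nothing to prove.\<close>
  have **: "ennreal (m powr (p - 1) * t) \<le> I"
  proof (cases I)
    case (real i)
    with * p t m have "p * m powr (p - 1) * t \<le> i + (p - 1) * m powr (p - 1) * t"
      by (simp flip: ennreal_plus)
    then show ?thesis using real by (simp add: algebra_simps ennreal_leI)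
  qed simp
  have "t powr p = k powr (p - 1) * (m powr (p - 1) * t)"
  proof -
    have "k powr (p - 1) * m powr (p - 1) = t powr (p - 1)"
      using k t by (simp add: m_def flip: powr_mult)
    moreover have "t powr p = t powr (p - 1) * t" using t by (simp add: powr_diff)
    ultimately show ?thesis by (metis mult.assoc)
  qed
  then have "ennreal (t powr p) = ennreal (k powr (p - 1)) * ennreal (m powr (p - 1) * t)"
    using t by (simp add: ennreal_mult)
  also have "\<dots> \<le> ennreal (k powr (p - 1)) * I" by (intro mult_left_mono **) simp
  finally show ?thesis by (simp add: I_def)
qed simp

text \<open>The previous inequality for the counting measure with weights \<open>g j\<close>,
  applied to \<open>T j / g j\<close>. The weights are free; each application picks those that make
  the remaining sum explicit.\<close>

lemma suminf_powr_Jensen: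
  fixes t :: real and g T :: "nat \<Rightarrow> real"
  assumes p: "1 \<le> p" and g: "\<And>j. 0 < g j" and T: "\<And>j. 0 \<le> T j" and k: "0 < k"
    and gk: "(\<Sum>j. ennreal (g j)) \<le> ennreal k" and t: "0 \<le> t" and le: "ennreal t \<le> (\<Sum>j. ennreal (T j))"
  shows "ennreal (t powr p) \<le> ennreal (k powr (p - 1)) * (\<Sum>j. ennreal (g j powr (1 - p) * T j powr p))"
proof -
  have 1: "g j * (T j / g j) = T j" for j using g[of j] by simp
  have 2: "g j * (T j / g j) powr p = g j powr (1 - p) * T j powr p" for j
    using g[of j] T[of j] by (simp add: powr_divide powr_diff)
  have "ennreal (t powr p) \<le> ennreal (k powr (p - 1)) *
      (\<integral>\<^sup>+ j. ennreal (g j) * ennreal ((T j / g j) powr p) \<partial>count_space UNIV)"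
  proof (rule nn_integral_powr_Jensen[OF p _ _ _ k _ t])
    show "ennreal t \<le> (\<integral>\<^sup>+ x. ennreal (g x) * ennreal (T x / g x) \<partial>count_space UNIV)"
      using g T le 1 by (simp add: nn_integral_count_space_nat less_imp_le flip: ennreal_mult)
  qed (use g T gk in \<open>auto simp: nn_integral_count_space_nat less_imp_le\<close>)
  also have "(\<integral>\<^sup>+ j. ennreal (g j) * ennreal ((T j / g j) powr p) \<partial>count_space UNIV)
      = (\<Sum>j. ennreal (g j powr (1 - p) * T j powr p))"
    using g T 2 by (simp add: nn_integral_count_space_nat less_imp_le flip: ennreal_mult)
  finally show ?thesis .
qed

section \<open>Sums over dyadic radii\<close>

definition geo_const :: "real \<Rightarrow> real" where
  "geo_const a = 1 / (1 - 2 powr - a)"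

lemma two_powr_neg: "0 < a \<Longrightarrow> 0 < (2::real) powr - a \<and> 2 powr - a < 1"
  by (simp add: powr_less_one)

lemma geo_const_ge_1: "0 < a \<Longrightarrow> 1 \<le> geo_const a"
  using two_powr_neg[of a] by (simp add: geo_const_def field_simps)

lemma geo_sum_le:
  assumes "0 < a"
  shows "(\<Sum>i<n. (2 powr - a) ^ i) \<le> geo_const a"
proof -
  have "(\<Sum>i<n. (2 powr - a) ^ i) \<le> (\<Sum>i. (2 powr - a) ^ i)"
    using two_powr_neg[OF assms] by (intro sum_le_suminf summable_geometric) auto
  also have "\<dots> = geo_const a"
    using two_powr_neg[OF assms] by (subst suminf_geometric) (auto simp: geo_const_def)
  finally show ?thesis .
qed

lemma two_power_powr: "(1 / 2 ^ i) powr a = ((2::real) powr - a) ^ i"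
  by (simp add: powr_divide powr_minus powr_powr powr_realpow[symmetric] mult.commute field_simps)

text \<open>From the first radius not exceeding \<open>d\<close> onwards the ratio halves at each
  step, so the bound depends neither on \<open>d\<close> nor on \<open>n\<close>.\<close>

lemma dyadic_small_sum:
  fixes R d a :: real
  assumes R: "0 < R" and d: "0 < d" and a: "0 < a"
  shows "(\<Sum>j<n. if R / 2 ^ j \<le> d then (R / 2 ^ j / d) powr a else 0) \<le> geo_const a"
proof (cases "\<exists>j<n. R / 2 ^ j \<le> d")
  case True
  define j0 where "j0 = (LEAST j. R / 2 ^ j \<le> d)"
  have j0: "R / 2 ^ j0 \<le> d" using True unfolding j0_def by (metis LeastI)
  have lt: "\<not> R / 2 ^ j \<le> d" if "j < j0" for j using that not_less_Least unfolding j0_def by blast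
  have "(\<Sum>j<n. if R / 2 ^ j \<le> d then (R / 2 ^ j / d) powr a else 0)
     \<le> (\<Sum>j<n. if j0 \<le> j then (2 powr - a) ^ (j - j0) else 0)"
  proof (intro sum_mono)
    fix j
    have "(R / 2 ^ j / d) powr a \<le> (2 powr - a) ^ (j - j0)" if "j0 \<le> j"
    proof -
      have "(2::real) ^ j = 2 ^ j0 * 2 ^ (j - j0)" using that by (simp flip: power_add)
      then have "R / 2 ^ j / d = R / 2 ^ j0 / d / 2 ^ (j - j0)" by simp
      also have "\<dots> \<le> 1 / 2 ^ (j - j0)" using j0 d by (intro divide_right_mono) (auto simp: divide_le_eq_1_pos simp del: divide_divide_eq_left)
      finally have "R / 2 ^ j / d \<le> 1 / 2 ^ (j - j0)" .
      then have "(R / 2 ^ j / d) powr a \<le> (1 / 2 ^ (j - j0)) powr a"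
        using R d a by (intro powr_mono2) auto
      then show ?thesis by (simp add: two_power_powr)
    qed
    then show "(if R / 2 ^ j \<le> d then (R / 2 ^ j / d) powr a else 0)
      \<le> (if j0 \<le> j then (2 powr - a) ^ (j - j0) else 0)" using lt[of j] by auto
  qed
  also have "\<dots> = (\<Sum>j\<in>{j0..<n}. (2 powr - a) ^ (j - j0))"
    by (intro sum.mono_neutral_cong_right) auto
  also have "\<dots> = (\<Sum>i<n - j0. (2 powr - a) ^ i)"
    by (intro sum.reindex_bij_witness[of _ "\<lambda>i. i + j0" "\<lambda>j. j - j0"]) auto
  also have "\<dots> \<le> geo_const a" by (rule geo_sum_le[OF a])
  finally show ?thesis .
next
  case False
  then have "(\<Sum>j<n. if R / 2 ^ j \<le> d then (R / 2 ^ j / d) powr a else 0) = 0" by (intro sum.neutral) auto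
  then show ?thesis using geo_const_ge_1[OF a] by simp
qed

text \<open>Read upwards from the smallest radius above \<open>d\<close>, the terms are again
  dominated by a geometric series; hence the reversed index \<open>j0 - Suc j\<close>.\<close>

lemma dyadic_large_sum:
  fixes R d a :: real
  assumes R: "0 < R" and d: "0 < d" and a: "0 < a"
  shows "(\<Sum>j<n. if d < R / 2 ^ j then (d / (R / 2 ^ j)) powr a else 0) \<le> geo_const a"
proof -
  have "\<exists>j. R / 2 ^ j \<le> d"
  proof -
    obtain j where "R / d < 2 ^ j" using real_arch_pow[of 2 "R / d"] by auto
    then show ?thesis using d by (intro exI[of _ j]) (simp add: field_simps)
  qed
  define j0 where "j0 = (LEAST j. R / 2 ^ j \<le> d)"
  have j0: "R / 2 ^ j0 \<le> d" using \<open>\<exists>j. _\<close> unfolding j0_def by (metis LeastI)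
  have lt: "\<not> R / 2 ^ j \<le> d" if "j < j0" for j using that not_less_Least unfolding j0_def by blast
  have ge: "j < j0" if "d < R / 2 ^ j" for j
  proof (rule ccontr)
    assume "\<not> j < j0"
    then have "R / 2 ^ j \<le> R / 2 ^ j0" using R by (intro divide_left_mono power_increasing) auto
    with j0 that show False by simp
  qed
  have "(\<Sum>j<n. if d < R / 2 ^ j then (d / (R / 2 ^ j)) powr a else 0)
     \<le> (\<Sum>j<j0. (2 powr - a) ^ (j0 - Suc j))"
  proof -
    have "(\<Sum>j<n. if d < R / 2 ^ j then (d / (R / 2 ^ j)) powr a else 0)
      = (\<Sum>j\<in>{j. j < n \<and> d < R / 2 ^ j}. (d / (R / 2 ^ j)) powr a)"
      by (intro sum.mono_neutral_cong_right) auto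
    also have "\<dots> \<le> (\<Sum>j\<in>{j. j < n \<and> d < R / 2 ^ j}. (2 powr - a) ^ (j0 - Suc j))"
    proof (intro sum_mono)
      fix j assume "j \<in> {j. j < n \<and> d < R / 2 ^ j}"
      then have j: "j < j0" using ge by simp
      have "d \<le> R / 2 ^ (j0 - 1)" using lt[of "j0 - 1"] j by simp
      also have "\<dots> = R / 2 ^ j / 2 ^ (j0 - Suc j)" using j by (simp flip: power_add)
      finally have "d / (R / 2 ^ j) \<le> 1 / 2 ^ (j0 - Suc j)" using R by (simp add: field_simps)
      then have "(d / (R / 2 ^ j)) powr a \<le> (1 / 2 ^ (j0 - Suc j)) powr a"
        using R d a by (intro powr_mono2) auto
      then show "(d / (R / 2 ^ j)) powr a \<le> (2 powr - a) ^ (j0 - Suc j)" by (simp add: two_power_powr)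
    qed
    also have "\<dots> \<le> (\<Sum>j<j0. (2 powr - a) ^ (j0 - Suc j))"
      using ge by (intro sum_mono2) auto
    finally show ?thesis .
  qed
  also have "\<dots> = (\<Sum>i<j0. (2 powr - a) ^ i)" by (rule sum.nat_diff_reindex)
  also have "\<dots> \<le> geo_const a" by (rule geo_sum_le[OF a])
  finally show ?thesis .
qed

text \<open>Equals 1 at \<open>r = d\<close> and decays like a power of the ratio when
  \<open>r\<close> leaves \<open>d\<close> in either direction. It is summed over dyadic
  \<open>r\<close> for a fixed distance and, through \<open>scale_wt_swap\<close>, over dyadic
  distances for a fixed radius.\<close>

definition scale_wt :: "real \<Rightarrow> real \<Rightarrow> real \<Rightarrow> real \<Rightarrow> real" where
  "scale_wt a b r d = min ((r / d) powr a) ((d / r) powr b)"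

lemma scale_wt_swap: "scale_wt a b r d = scale_wt b a d r"
  by (simp add: scale_wt_def min.commute)

lemma scale_wt_nonneg: "0 \<le> scale_wt a b r d"
  by (simp add: scale_wt_def)

lemma scale_wt_pos: "0 < r \<Longrightarrow> 0 < d \<Longrightarrow> 0 < scale_wt a b r d"
  by (simp add: scale_wt_def)

lemma scale_wt_sum:
  assumes R: "0 < R" and d: "0 < d" and a: "0 < a" and b: "0 < b"
  shows "(\<Sum>j. ennreal (scale_wt a b (R / 2 ^ j) d)) \<le> ennreal (geo_const a + geo_const b)"
proof (rule suminf_le_const)
  fix n
  have "(\<Sum>j<n. scale_wt a b (R / 2 ^ j) d) \<le> (\<Sum>j<n. (if R / 2 ^ j \<le> d then (R / 2 ^ j / d) powr a else 0)
     + (if d < R / 2 ^ j then (d / (R / 2 ^ j)) powr b else 0))"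
    by (intro sum_mono) (auto simp: scale_wt_def)
  also have "\<dots> \<le> geo_const a + geo_const b"
    unfolding sum.distrib by (intro add_mono dyadic_small_sum dyadic_large_sum assms)
  finally show "(\<Sum>j<n. ennreal (scale_wt a b (R / 2 ^ j) d)) \<le> ennreal (geo_const a + geo_const b)"
    by (simp add: scale_wt_nonneg ennreal_leI)
qed simp

section \<open>Averages on a compact doubling space\<close>

locale doubling_space =
  fixes \<nu> :: "'a::metric_space measure" and Cd :: real
  assumes compact_UNIV: "compact (UNIV :: 'a set)"
    and nontrivial: "\<exists>x y :: 'a. x \<noteq> y"
    and space_UNIV[simp]: "space \<nu> = UNIV"
    and borel_subset: "sets borel \<subseteq> sets \<nu>"
    and Cd_pos: "0 < Cd"
    and doubling: "\<And>x r. 0 < r \<Longrightarrow> 0 < emeasure \<nu> (ball x (2 * r)) \<and>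
       emeasure \<nu> (ball x (2 * r)) \<le> ennreal Cd * emeasure \<nu> (ball x r) \<and> emeasure \<nu> (ball x r) < \<infinity>"
begin

text \<open>Any radius larger than the diameter makes \<open>ball x R\<close> the whole space; this one is still admissible in the
  lower mass bound.\<close>

definition R :: real where "R = 2 * diameter (UNIV :: 'a set)"

lemma dist_le_diameter: "dist (x::'a) y \<le> diameter (UNIV :: 'a set)"
  by (rule diameter_bounded_bound[OF compact_imp_bounded[OF compact_UNIV]]) auto

lemma diameter_pos: "0 < diameter (UNIV :: 'a set)"
  using nontrivial dist_le_diameter by (metis zero_less_dist_iff less_le_trans)

lemma R_pos: "0 < R" using diameter_pos by (simp add: R_def)

lemma dist_less_R: "dist (x::'a) y < R"
  using dist_le_diameter[of x y] diameter_pos by (simp add: R_def)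

lemma ball_R[simp]: "ball (x::'a) R = UNIV"
  using dist_less_R by auto

lemma open_sets[measurable]: "open U \<Longrightarrow> U \<in> sets \<nu>"
  using borel_subset by (meson borel_open subsetD)

lemma borel_measurable_borelI: "f \<in> borel_measurable borel \<Longrightarrow> f \<in> borel_measurable \<nu>"
  using borel_subset unfolding measurable_def by auto

sublocale finite_measure \<nu>
proof
  have "emeasure \<nu> (ball undefined R) < \<infinity>" using doubling[OF R_pos] by blast
  then show "emeasure \<nu> (space \<nu>) \<noteq> \<infinity>" by simp
qed

definition V :: "'a \<Rightarrow> real \<Rightarrow> real" where "V x r = measure \<nu> (ball x r)"

lemma emeasure_ball: "emeasure \<nu> (ball x r) = ennreal (V x r)"
  by (simp add: V_def emeasure_eq_measure)

lemma V_nonneg[simp]: "0 \<le> V x r" by (simp add: V_def)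

lemma V_pos: "0 < r \<Longrightarrow> 0 < V x r"
  using doubling[of "r / 2" x] by (simp add: emeasure_ball)

lemma V_0: "r \<le> 0 \<Longrightarrow> V x r = 0" by (simp add: V_def ball_empty)

lemma V_mono: "ball x r \<subseteq> ball y r' \<Longrightarrow> V x r \<le> V y r'"
  unfolding V_def by (intro finite_measure_mono) auto

lemma V_double: "V x (2 * r) \<le> Cd * V x r"
proof (cases "0 < r")
  case True
  then have "ennreal (V x (2 * r)) \<le> ennreal (Cd * V x r)"
    using doubling[of r x] Cd_pos by (simp add: emeasure_ball ennreal_mult)
  then show ?thesis using Cd_pos by simp
qed (use Cd_pos in \<open>simp add: V_0\<close>)

lemma V_double_pow: "V x (2 ^ k * r) \<le> Cd ^ k * V x r"
proof (induction k)
  case (Suc k)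
  have "V x (2 ^ Suc k * r) \<le> Cd * V x (2 ^ k * r)" using V_double[of x "2 ^ k * r"] by (simp add: mult.assoc)
  also have "\<dots> \<le> Cd * (Cd ^ k * V x r)" using Suc Cd_pos by (intro mult_left_mono) auto
  finally show ?case by (simp add: mult.assoc)
qed simp

text \<open>The form in which doubling is used for balls with different centres: \<open>k\<close>
  counts the doublings after which the second ball contains the first.\<close>

lemma V_compare:
  assumes "dist x y + r \<le> 2 ^ k * r'"
  shows "V x r \<le> Cd ^ k * V y r'"
proof -
  have "V x r \<le> V y (2 ^ k * r')"
  proof (rule V_mono, rule subsetI)
    fix z assume "z \<in> ball x r"
    then show "z \<in> ball y (2 ^ k * r')" using assms dist_triangle[of y z x] by (simp add: dist_commute)
  qed
  also have "\<dots> \<le> Cd ^ k * V y r'" by (rule V_double_pow)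
  finally show ?thesis .
qed

lemma countable_dense: "\<exists>D :: 'a set. countable D \<and> (\<forall>x e. 0 < e \<longrightarrow> (\<exists>d\<in>D. dist x d < e))"
proof -
  have "\<exists>F :: 'a set. finite F \<and> (\<forall>x. \<exists>d\<in>F. dist d x < 1 / Suc n)" for n
  proof -
    have "\<exists>k. finite k \<and> k \<subseteq> (UNIV::'a set) \<and> UNIV \<subseteq> (\<Union>x\<in>k. ball x (1 / Suc n))"
      using compact_UNIV[unfolded compact_eq_totally_bounded] by simp
    then obtain k where k: "finite k" "UNIV \<subseteq> (\<Union>x\<in>k. ball (x::'a) (1 / Suc n))" by blast
    have "\<exists>d\<in>k. dist d x < 1 / Suc n" for x using subsetD[OF k(2) UNIV_I, of x] by auto
    then show ?thesis using k(1) by blast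
  qed
  then obtain F :: "nat \<Rightarrow> 'a set" where F: "finite (F n)" "\<exists>d\<in>F n. dist d x < 1 / Suc n" for n x by metis
  have "\<exists>d\<in>(\<Union>n. F n). dist x d < e" if "0 < e" for x e
  proof -
    obtain n where n: "1 / Suc n < e" using reals_Archimedean[OF \<open>0 < e\<close>] by (auto simp: inverse_eq_divide)
    obtain d where "d \<in> F n" "dist d x < 1 / Suc n" using F(2) by blast
    then show ?thesis using n by (intro bexI[of _ d]) (auto simp: dist_commute)
  qed
  moreover have "countable (\<Union>n. F n)" using F(1) by (intro countable_UN) (auto intro: countable_finite)
  ultimately show ?thesis by blast
qed

text \<open>The class \<open>metric_space\<close> does not provide a countable base, so that separability has to enter by hand.\<close>

lemma measurable_dist'[measurable]:
  assumes [measurable]: "f \<in> measurable M \<nu>" "g \<in> measurable M \<nu>"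
  shows "(\<lambda>x. dist (f x) (g x)) \<in> borel_measurable M"
proof (subst borel_measurable_iff_less, intro allI)
  fix r :: real
  obtain D :: "'a set" where D: "countable D" "\<And>x e. 0 < e \<Longrightarrow> \<exists>d\<in>D. dist x d < e" using countable_dense by blast
  have "{w \<in> space M. dist (f w) (g w) < r} =
     (\<Union>d\<in>D. \<Union>q\<in>\<rat>. {w \<in> space M. f w \<in> ball d q} \<inter> {w \<in> space M. g w \<in> ball d (r - q)})" (is "?L = ?R")
  proof (intro equalityI subsetI)
    fix w assume w: "w \<in> ?L"
    \<comment> \<open>A third of the slack: \<open>q\<close> stays below \<open>2 * e\<close>, while
      the distance from \<open>d\<close> to \<open>g w\<close> stays below
      \<open>r - 2 * e\<close>.\<close>
    define e where "e = (r - dist (f w) (g w)) / 3"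
    have e: "e > 0" using w by (simp add: e_def)
    obtain d where d: "d \<in> D" "dist (f w) d < e" using D(2)[OF e] by blast
    obtain q where q: "q \<in> \<rat>" "dist (f w) d < q" "q < dist (f w) d + e"
      using Rats_dense_in_real[of "dist (f w) d" "dist (f w) d + e"] e by auto
    have "dist d (g w) \<le> dist (f w) d + dist (f w) (g w)" by (metis dist_commute dist_triangle)
    also have "\<dots> < e + (r - 3 * e)"
    proof -
      have "r - 3 * e = dist (f w) (g w)" by (simp add: e_def field_simps)
      then show ?thesis using d by simp
    qed
    also have "\<dots> < r - q" using q d by simp
    finally have "g w \<in> ball d (r - q)" by simp
    moreover have "f w \<in> ball d q" using q by (simp add: dist_commute)
    ultimately show "w \<in> ?R" using d q w by blast
  next
    fix w assume "w \<in> ?R"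
    then obtain d q where "w \<in> space M" "dist d (f w) < q" "dist d (g w) < r - q" by auto
    then show "w \<in> ?L" using dist_triangle[of "f w" "g w" d] by (simp add: dist_commute)
  qed
  also have "\<dots> \<in> sets M"
  proof (intro sets.countable_UN'' D(1) countable_rat sets.Int)
    show "{w \<in> space M. f w \<in> ball d q} \<in> sets M" for d q
      using measurable_sets[OF assms(1) open_sets[OF open_ball], of d q] by (simp add: vimage_def Int_def conj_commute)
    show "{w \<in> space M. g w \<in> ball d q} \<in> sets M" for d q
      using measurable_sets[OF assms(2) open_sets[OF open_ball], of d q] by (simp add: vimage_def Int_def conj_commute)
  qed
  finally show "{w \<in> space M. dist (f w) (g w) < r} \<in> sets M" .
qed

text \<open>As an integral with parameters, the volume is jointly measurable in centre and radius as
  soon as the distance is measurable.\<close>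

lemma V_eq_nn_integral: "ennreal (V x r) = (\<integral>\<^sup>+ z. (if dist x z < r then 1 else 0) \<partial>\<nu>)"
proof -
  have "(\<integral>\<^sup>+ z. (if dist x z < r then 1 else 0) \<partial>\<nu>) = (\<integral>\<^sup>+ z. indicator (ball x r) z \<partial>\<nu>)"
    by (intro nn_integral_cong) (auto simp: indicator_def)
  then show ?thesis by (simp add: emeasure_ball)
qed

lemma measurable_V[measurable]:
  assumes [measurable]: "f \<in> measurable M \<nu>" "r \<in> borel_measurable M"
  shows "(\<lambda>x. V (f x) (r x)) \<in> borel_measurable M"
proof -
  have "(\<lambda>x. ennreal (V (f x) (r x))) \<in> borel_measurable M"
    unfolding V_eq_nn_integral by measurable
  then have "(\<lambda>x. enn2real (ennreal (V (f x) (r x)))) \<in> borel_measurable M" by measurable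
  then show ?thesis by simp
qed

lemma nn_integral_swap:
  assumes "(\<lambda>z. f (fst z) (snd z)) \<in> borel_measurable (\<nu> \<Otimes>\<^sub>M \<nu>)"
  shows "(\<integral>\<^sup>+ x. \<integral>\<^sup>+ y. f x y \<partial>\<nu> \<partial>\<nu>) = (\<integral>\<^sup>+ y. \<integral>\<^sup>+ x. f x y \<partial>\<nu> \<partial>\<nu>)"
proof -
  interpret P: pair_sigma_finite \<nu> \<nu> ..
  show ?thesis using P.Fubini'[of f] assms by (simp add: case_prod_beta')
qed

section \<open>Ball means as integral kernels\<close>

definition avg_ker :: "real \<Rightarrow> 'a \<Rightarrow> 'a \<Rightarrow> real" where
  "avg_ker r x y = (if dist x y < r then 1 / V x r else 0)"

lemma avg_ker_nonneg[simp]: "0 \<le> avg_ker r x y" by (simp add: avg_ker_def)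

lemma measurable_avg_ker[measurable]:
  assumes [measurable]: "f \<in> measurable M \<nu>" "g \<in> measurable M \<nu>"
  shows "(\<lambda>x. avg_ker r (f x) (g x)) \<in> borel_measurable M"
  unfolding avg_ker_def by measurable

text \<open>Balls of equal radius whose centres are closer than that radius have comparable volumes.
  This near symmetry is what bounds averaging on \<open>L^1\<close> in
  \<open>nn_integral_avg_le\<close>.\<close>

lemma avg_ker_flip: "avg_ker r x y \<le> Cd * avg_ker r y x"
proof (cases "dist x y < r")
  case True
  then have r: "0 < r" using zero_le_dist[of x y] by linarith
  have "V y r \<le> Cd ^ 1 * V x r" using True by (intro V_compare) (simp add: dist_commute)
  then have "1 / V x r \<le> Cd / V y r" using V_pos[OF r, of x] V_pos[OF r, of y] by (simp add: field_simps)
  then show ?thesis using True by (simp add: avg_ker_def dist_commute)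
qed (use Cd_pos in \<open>simp add: avg_ker_def dist_commute\<close>)

text \<open>The first inequality in \<open>le\<close> compares the volumes, the second puts
  \<open>ball x r\<close> inside \<open>ball y r'\<close>.\<close>

lemma avg_ker_le:
  assumes r: "0 < r" and le: "dist x y + r' \<le> 2 ^ k * r" "dist x y + r \<le> r'"
  shows "avg_ker r x z \<le> Cd ^ k * avg_ker r' y z"
proof (cases "dist x z < r")
  case True
  have r': "0 < r'" using r le zero_le_dist[of x y] by linarith
  have "dist y z < r'" using True le dist_triangle[of y z x] by (simp add: dist_commute)
  moreover have "V y r' \<le> Cd ^ k * V x r" using le by (intro V_compare) (simp add: dist_commute)
  then have "1 / V x r \<le> Cd ^ k / V y r'" using V_pos[OF r, of x] V_pos[OF r', of y] by (simp add: field_simps)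
  ultimately show ?thesis using True by (simp add: avg_ker_def)
qed (use Cd_pos in \<open>simp add: avg_ker_def\<close>)

lemma avg_ker_integral: "0 < r \<Longrightarrow> (\<integral>\<^sup>+ y. ennreal (avg_ker r x y) \<partial>\<nu>) = 1"
proof -
  assume r: "0 < r"
  have "(\<integral>\<^sup>+ y. ennreal (avg_ker r x y) \<partial>\<nu>) = (\<integral>\<^sup>+ y. ennreal (1 / V x r) * indicator (ball x r) y \<partial>\<nu>)"
    by (intro nn_integral_cong) (auto simp: avg_ker_def indicator_def)
  also have "\<dots> = ennreal (1 / V x r) * ennreal (V x r)" by (subst nn_integral_cmult) (auto simp: emeasure_ball)
  also have "\<dots> = 1" using V_pos[OF r, of x] by (simp flip: ennreal_mult)
  finally show ?thesis .
qed

definition avg :: "('a \<Rightarrow> ennreal) \<Rightarrow> 'a \<Rightarrow> real \<Rightarrow> ennreal" where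
  "avg g x r = (\<integral>\<^sup>+ y. ennreal (avg_ker r x y) * g y \<partial>\<nu>)"

lemma measurable_avg[measurable]:
  assumes [measurable]: "g \<in> borel_measurable \<nu>"
  shows "(\<lambda>x. avg g x r) \<in> borel_measurable \<nu>"
  unfolding avg_def by measurable

lemma avg_mono: "(\<And>y. dist x y < r \<Longrightarrow> f y \<le> g y) \<Longrightarrow> avg f x r \<le> avg g x r"
  unfolding avg_def by (intro nn_integral_mono) (auto simp: avg_ker_def intro: mult_left_mono)

lemma avg_cmult: "g \<in> borel_measurable \<nu> \<Longrightarrow> avg (\<lambda>y. c * g y) x r = c * avg g x r"
  unfolding avg_def by (subst nn_integral_cmult[symmetric]) (auto simp: mult_ac)

lemma nn_integral_avg_le:
  assumes [measurable]: "g \<in> borel_measurable \<nu>" and r: "0 < r"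
  shows "(\<integral>\<^sup>+ x. avg g x r \<partial>\<nu>) \<le> ennreal Cd * (\<integral>\<^sup>+ x. g x \<partial>\<nu>)"
proof -
  have "(\<integral>\<^sup>+ x. avg g x r \<partial>\<nu>) = (\<integral>\<^sup>+ y. \<integral>\<^sup>+ x. ennreal (avg_ker r x y) * g y \<partial>\<nu> \<partial>\<nu>)"
    unfolding avg_def by (rule nn_integral_swap) measurable
  also have "\<dots> \<le> (\<integral>\<^sup>+ y. \<integral>\<^sup>+ x. ennreal (avg_ker r y x) * (ennreal Cd * g y) \<partial>\<nu> \<partial>\<nu>)"
  proof (intro nn_integral_mono)
    fix x y
    have "ennreal (avg_ker r x y) \<le> ennreal (avg_ker r y x) * ennreal Cd"
      using avg_ker_flip[of r x y] Cd_pos by (simp add: mult.commute ennreal_leI flip: ennreal_mult)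
    then show "ennreal (avg_ker r x y) * g y \<le> ennreal (avg_ker r y x) * (ennreal Cd * g y)"
      unfolding mult.assoc[symmetric] by (rule mult_right_mono) simp
  qed
  also have "\<dots> = ennreal Cd * (\<integral>\<^sup>+ x. g x \<partial>\<nu>)"
    using r by (simp add: nn_integral_multc avg_ker_integral nn_integral_cmult)
  finally show ?thesis .
qed

text \<open>Jensen for the kernel \<open>K * avg_ker r x\<close>, whose total mass is exactly
  \<open>K\<close>.\<close>

lemma avg_powr_Jensen:
  assumes p: "1 \<le> p" and f[measurable]: "f \<in> borel_measurable \<nu>" and f0: "\<And>x. 0 \<le> f x" and r: "0 < r"
    and K: "0 < K" and t: "0 \<le> t" and le: "ennreal t \<le> ennreal K * avg (\<lambda>y. ennreal (f y)) x r"
  shows "ennreal (t powr p) \<le> ennreal (K powr p) * avg (\<lambda>y. ennreal (f y powr p)) x r"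
proof -
  have "ennreal (t powr p) \<le> ennreal (K powr (p - 1)) *
      (\<integral>\<^sup>+ y. (ennreal K * ennreal (avg_ker r x y)) * ennreal (f y powr p) \<partial>\<nu>)"
  proof (rule nn_integral_powr_Jensen[OF p f _ f0 K _ t])
    show "ennreal t \<le> (\<integral>\<^sup>+ y. ennreal K * ennreal (avg_ker r x y) * ennreal (f y) \<partial>\<nu>)"
      using le unfolding avg_def by (subst (asm) nn_integral_cmult[symmetric]) (auto simp: mult_ac)
  qed (use K r in \<open>auto simp: nn_integral_cmult avg_ker_integral\<close>)
  also have "\<dots> = ennreal (K powr (p - 1)) * (ennreal K * avg (\<lambda>y. ennreal (f y powr p)) x r)"
    unfolding avg_def by (subst nn_integral_cmult[symmetric]) (auto simp: mult_ac)
  also have "\<dots> = ennreal (K powr p) * avg (\<lambda>y. ennreal (f y powr p)) x r"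
  proof -
    have "K powr p = K powr (p - 1) * K" using K by (simp add: powr_diff)
    then show ?thesis using K by (simp add: ennreal_mult mult.assoc)
  qed
  finally show ?thesis .
qed

lemma dyadic_scale:
  assumes "0 < d" "d < R"
  obtains i where "R / 2 ^ Suc i \<le> d" "d < R / 2 ^ i"
proof -
  define j0 where "j0 = (LEAST j. R / 2 ^ j \<le> d)"
  obtain j where "R / d < 2 ^ j" using real_arch_pow[of 2 "R / d"] by auto
  then have "R / 2 ^ j \<le> d" using assms by (simp add: field_simps)
  then have j0: "R / 2 ^ j0 \<le> d" unfolding j0_def by (rule LeastI)
  have lt: "\<not> R / 2 ^ j \<le> d" if "j < j0" for j using that not_less_Least unfolding j0_def by blast
  have "j0 \<noteq> 0" using j0 assms by (intro notI) simp
  then obtain i where "j0 = Suc i" using not0_implies_Suc by blast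
  then show ?thesis using that[of i] j0 lt[of i] by simp
qed

text \<open>The factor 2 bounds \<open>2 powr a\<close> for \<open>a \<le> 1\<close> and comes from
  replacing a distance by the outer radius of its dyadic ring; \<open>Cd\<close> comes from the same
  replacement in the volume.\<close>

definition ring_const :: "real \<Rightarrow> real \<Rightarrow> real" where
  "ring_const a b = 2 * Cd * (geo_const a + geo_const b)"

text \<open>On the ring with outer radius \<open>R / 2 ^ i\<close> the integrand is at most a
  multiple of the weight times an averaging kernel of mass 1, so the integral is bounded by a sum of
  weights over dyadic distances.\<close>

lemma scale_wt_integral_le:
  assumes r: "0 < r" and a: "0 < a" "a \<le> 1" and b: "0 < b"
  shows "(\<integral>\<^sup>+ y. ennreal (scale_wt a b r (dist x y) / V x (dist x y)) \<partial>\<nu>) \<le> ennreal (ring_const a b)"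
proof -
  define w where "w i = 2 * Cd * scale_wt a b r (R / 2 ^ i)" for i
  have w0: "0 \<le> w i" for i using Cd_pos by (simp add: w_def scale_wt_nonneg)
  have pw: "ennreal (scale_wt a b r (dist x y) / V x (dist x y))
      \<le> (\<Sum>i. ennreal (w i) * ennreal (avg_ker (R / 2 ^ i) x y))" for y
  proof (cases "dist x y = 0")
    case False
    define d where "d = dist x y"
    have d: "0 < d" "d < R" using False by (auto simp: d_def dist_less_R)
    obtain i where i: "R / 2 ^ Suc i \<le> d" "d < R / 2 ^ i" using dyadic_scale[OF d] .
    define q where "q = R / 2 ^ i"
    have q: "0 < q" "q \<le> 2 * d" "d < q" using i R_pos by (auto simp: q_def)
    have "(r / d) powr a \<le> 2 * (r / q) powr a"
    proof -
      have "(r / d) powr a \<le> (2 * (r / q)) powr a" using q d r a by (intro powr_mono2) (auto simp: field_simps)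
      also have "\<dots> = 2 powr a * (r / q) powr a" using r q by (subst powr_mult) auto
      also have "\<dots> \<le> 2 * (r / q) powr a" using a powr_mono[of a 1 "2::real"] by (intro mult_right_mono) auto
      finally show ?thesis .
    qed
    moreover have "(d / r) powr b \<le> 2 * (q / r) powr b"
      using powr_mono2[of b "d / r" "q / r"] q d r b by (auto simp: divide_right_mono intro: order_trans)
    ultimately have 1: "scale_wt a b r d \<le> 2 * scale_wt a b r q" by (auto simp: scale_wt_def min_def)
    have 2: "V x q \<le> Cd * V x d"
      using order_trans[OF V_mono V_double[of x d], of x q] q by (auto simp: subset_ball)
    have "scale_wt a b r d / V x d \<le> 2 * scale_wt a b r q / V x d" using 1 by (intro divide_right_mono) auto
    also have "\<dots> \<le> 2 * scale_wt a b r q * (Cd / V x q)"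
      using 2 V_pos[OF d(1), of x] V_pos[OF q(1), of x] scale_wt_nonneg[of a b r q]
      by (simp add: divide_simps) (metis mult.commute mult.left_commute mult_left_mono)
    also have "\<dots> = w i * avg_ker q x y" using q by (simp add: w_def avg_ker_def q_def d_def)
    finally have "ennreal (scale_wt a b r d / V x d) \<le> ennreal (w i) * ennreal (avg_ker q x y)"
      using w0 by (simp add: ennreal_leI flip: ennreal_mult)
    also have "\<dots> \<le> (\<Sum>i. ennreal (w i) * ennreal (avg_ker (R / 2 ^ i) x y))"
      using sum_le_suminf[of "\<lambda>i. ennreal (w i) * ennreal (avg_ker (R / 2 ^ i) x y)" "{i}"] by (simp add: q_def)
    finally show ?thesis by (simp add: d_def)
  \<comment> \<open>On the diagonal the volume is 0, and division by zero gives 0.\<close>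
  qed (simp add: V_0)
  have "(\<integral>\<^sup>+ y. ennreal (scale_wt a b r (dist x y) / V x (dist x y)) \<partial>\<nu>)
    \<le> (\<integral>\<^sup>+ y. (\<Sum>i. ennreal (w i) * ennreal (avg_ker (R / 2 ^ i) x y)) \<partial>\<nu>)"
    by (intro nn_integral_mono pw)
  also have "\<dots> = (\<Sum>i. ennreal (w i))"
    using R_pos by (subst nn_integral_suminf) (auto simp: nn_integral_cmult avg_ker_integral)
  also have "\<dots> = ennreal (2 * Cd) * (\<Sum>i. ennreal (scale_wt a b r (R / 2 ^ i)))"
    using Cd_pos by (simp add: w_def ennreal_mult' scale_wt_nonneg)
  also have "\<dots> \<le> ennreal (2 * Cd) * ennreal (geo_const b + geo_const a)"
    using scale_wt_sum[OF R_pos r b a(1)] by (intro mult_left_mono) (auto simp: scale_wt_swap[of a b])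
  also have "\<dots> = ennreal (ring_const a b)"
    using Cd_pos geo_const_ge_1[OF a(1)] geo_const_ge_1[OF b]
    by (subst ennreal_mult[symmetric]) (auto simp: ring_const_def add.commute)
  finally show ?thesis .
qed

lemma ring_const_pos: "0 < a \<Longrightarrow> 0 < b \<Longrightarrow> 0 < ring_const a b"
  using Cd_pos geo_const_ge_1[of a] geo_const_ge_1[of b] by (simp add: ring_const_def)

text \<open>The kernel is symmetric up to \<open>Cd\<close>, so the term with \<open>H y\<close>
  reduces to the one with \<open>H x\<close> once the integrals are exchanged; hence the factor
  \<open>1 + Cd\<close>.\<close>

lemma scale_energy_le:
  assumes r: "0 < r" and a: "0 < a" "a \<le> 1" and b: "0 < b" and H[measurable]: "H \<in> borel_measurable \<nu>"
  shows "(\<integral>\<^sup>+ x. \<integral>\<^sup>+ y. ennreal (scale_wt a b r (dist x y) / V x (dist x y)) * (H x + H y) \<partial>\<nu> \<partial>\<nu>)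
    \<le> ennreal ((1 + Cd) * ring_const a b) * (\<integral>\<^sup>+ x. H x \<partial>\<nu>)"
proof -
  define k where "k x y = ennreal (scale_wt a b r (dist x y) / V x (dist x y))" for x y :: 'a
  have k_meas[measurable]: "(\<lambda>z. k (f z) (g z)) \<in> borel_measurable M"
    if [measurable]: "f \<in> measurable M \<nu>" "g \<in> measurable M \<nu>" for f g and M :: "'z measure"
    unfolding k_def scale_wt_def by measurable
  have k_flip: "k x y \<le> ennreal Cd * k y x" for x y
  proof (cases "x = y")
    case False
    then have d: "0 < dist x y" by simp
    have "V y (dist x y) \<le> Cd ^ 1 * V x (dist x y)" by (intro V_compare) (simp add: dist_commute)
    then have "scale_wt a b r (dist x y) / V x (dist x y) \<le> Cd * (scale_wt a b r (dist x y) / V y (dist x y))"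
      using V_pos[OF d, of x] V_pos[OF d, of y] scale_wt_nonneg[of a b r "dist x y"]
      by (simp add: divide_simps) (metis mult.commute mult.left_commute mult_left_mono)
    then show ?thesis using Cd_pos scale_wt_nonneg[of a b r "dist x y"]
      by (simp add: k_def dist_commute ennreal_leI flip: ennreal_mult)
  qed (simp add: k_def V_0)
  have k_int: "(\<integral>\<^sup>+ y. k x y \<partial>\<nu>) \<le> ennreal (ring_const a b)" for x
    unfolding k_def using r a b by (rule scale_wt_integral_le)
  have rc: "0 < ring_const a b" using a b by (simp add: ring_const_pos)
  have "(\<integral>\<^sup>+ x. \<integral>\<^sup>+ y. k x y * (H x + H y) \<partial>\<nu> \<partial>\<nu>)
     = (\<integral>\<^sup>+ x. \<integral>\<^sup>+ y. k x y * H x \<partial>\<nu> \<partial>\<nu>) + (\<integral>\<^sup>+ x. \<integral>\<^sup>+ y. k x y * H y \<partial>\<nu> \<partial>\<nu>)"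
    by (simp add: distrib_left nn_integral_add)
  also have "(\<integral>\<^sup>+ x. \<integral>\<^sup>+ y. k x y * H x \<partial>\<nu> \<partial>\<nu>) \<le> ennreal (ring_const a b) * (\<integral>\<^sup>+ x. H x \<partial>\<nu>)"
    by (subst nn_integral_cmult[symmetric]) (auto simp: nn_integral_multc intro!: nn_integral_mono mult_right_mono k_int)
  also have "(\<integral>\<^sup>+ x. \<integral>\<^sup>+ y. k x y * H y \<partial>\<nu> \<partial>\<nu>) = (\<integral>\<^sup>+ y. \<integral>\<^sup>+ x. k x y * H y \<partial>\<nu> \<partial>\<nu>)"
    by (rule nn_integral_swap) measurable
  also have "\<dots> \<le> (\<integral>\<^sup>+ y. \<integral>\<^sup>+ x. (ennreal Cd * k y x) * H y \<partial>\<nu> \<partial>\<nu>)"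
    by (intro nn_integral_mono mult_right_mono k_flip) simp
  also have "\<dots> \<le> (\<integral>\<^sup>+ y. (ennreal Cd * ennreal (ring_const a b)) * H y \<partial>\<nu>)"
    by (intro nn_integral_mono) (auto simp: nn_integral_multc nn_integral_cmult intro!: mult_right_mono mult_left_mono k_int)
  also have "\<dots> = (ennreal Cd * ennreal (ring_const a b)) * (\<integral>\<^sup>+ x. H x \<partial>\<nu>)"
    by (simp add: nn_integral_cmult)
  finally have "(\<integral>\<^sup>+ x. \<integral>\<^sup>+ y. k x y * (H x + H y) \<partial>\<nu> \<partial>\<nu>) \<le>
     (ennreal (ring_const a b) + ennreal Cd * ennreal (ring_const a b)) * (\<integral>\<^sup>+ x. H x \<partial>\<nu>)"
    by (simp add: distrib_right add_mono)
  also have "ennreal (ring_const a b) + ennreal Cd * ennreal (ring_const a b) = ennreal ((1 + Cd) * ring_const a b)"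
    using Cd_pos rc by (simp add: distrib_right flip: ennreal_mult ennreal_plus)
  finally show ?thesis by (simp add: k_def)
qed

end

section \<open>Energy estimates\<close>

text \<open>This identity is what singles out the weights for the Jensen inequality in \<open>energy_series_le\<close>.\<close>

lemma scale_wt_powr:
  assumes "0 < r" "0 < d" "1 \<le> p" "0 < a" "a < 1"
  shows "scale_wt a (1 - a) r d powr p = min 1 ((d / r) powr p) * (r / d) powr (p * a)"
proof -
  define x where "x = d / r"
  have x: "0 < x" "r / d = 1 / x" using assms by (auto simp: x_def)
  show ?thesis
  proof (cases "x \<le> 1")
    case True
    have "x powr (1 - a) \<le> 1" using True x assms by (simp add: powr_le1)
    moreover have "1 \<le> (1 / x) powr a" using True x assms by (intro ge_one_powr_ge_zero) auto
    ultimately have "scale_wt a (1 - a) r d = x powr (1 - a)"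
      by (simp add: scale_wt_def x flip: x_def)
    moreover have "x powr p \<le> 1" using True x assms by (simp add: powr_le1)
    moreover have "x powr ((1 - a) * p) = x powr p * (1 / x) powr (p * a)"
      using x by (simp add: powr_divide algebra_simps powr_diff)
    ultimately show ?thesis by (simp add: powr_powr x flip: x_def)
  next
    case False
    have "1 \<le> x powr (1 - a)" using False x assms by (intro ge_one_powr_ge_zero) auto
    moreover have "(1 / x) powr a \<le> 1" using False x assms by (intro powr_le1) auto
    ultimately have "scale_wt a (1 - a) r d = (1 / x) powr a"
      by (simp add: scale_wt_def x flip: x_def)
    moreover have "1 \<le> x powr p" using False x assms by (intro ge_one_powr_ge_zero) auto
    ultimately show ?thesis by (simp add: powr_powr x mult.commute flip: x_def)
  qed
qed

lemma ennreal_powr_add_le: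
  fixes a b p :: real
  assumes "0 \<le> a" "0 \<le> b" "0 \<le> p"
  shows "ennreal ((a + b) powr p) \<le> ennreal (2 powr p) * (ennreal (a powr p) + ennreal (b powr p))"
proof -
  have "(a + b) powr p \<le> (2 * max a b) powr p" using assms by (intro powr_mono2) auto
  also have "\<dots> = 2 powr p * (max a b) powr p" using assms by (subst powr_mult) auto
  also have "\<dots> \<le> 2 powr p * (a powr p + b powr p)" by (intro mult_left_mono) (auto simp: max_def)
  finally show ?thesis by (simp add: ennreal_leI flip: ennreal_mult ennreal_plus)
qed

lemma ennreal_mult_assoc: "0 \<le> a \<Longrightarrow> 0 \<le> b \<Longrightarrow> ennreal a * (ennreal b * c) = ennreal (a * b) * c"
  by (simp add: ennreal_mult mult.assoc)

locale besov_setting = doubling_space \<nu> Cd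
  for \<nu> :: "'a::metric_space measure" and Cd +
  fixes p \<theta> :: real
  assumes p_ge_1: "1 \<le> p" and theta: "0 < \<theta>" "\<theta> < 1"
begin

abbreviation energy where "energy \<equiv> besov_energy \<nu> \<theta> p"
abbreviation cap where "cap \<equiv> besov_cap \<nu> \<theta> p"

text \<open>Isolated points carry mass, so the diagonal need not be a null set; excluding it makes
  no difference because the quotient is 0 there.\<close>

lemma energy_eq:
  "energy u = (\<integral>\<^sup>+ x. \<integral>\<^sup>+ y.
     ennreal (\<bar>u x - u y\<bar> powr p / (dist x y powr (p * \<theta>) * V x (dist x y))) \<partial>\<nu> \<partial>\<nu>)"
proof -
  have "ennreal (\<bar>u x - u y\<bar> powr p / dist x y powr (p * \<theta>)) / emeasure \<nu> (ball x (dist x y)) * indicator (- {x}) y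
    = ennreal (\<bar>u x - u y\<bar> powr p / (dist x y powr (p * \<theta>) * V x (dist x y)))" for x y
  proof (cases "x = y")
    case False
    then have "0 < V x (dist x y)" by (simp add: V_pos)
    then show ?thesis using False by (simp add: emeasure_ball divide_ennreal)
  qed simp
  then show ?thesis unfolding besov_energy_def by simp
qed

definition scale_const :: real where
  "scale_const = (1 + Cd) * ring_const \<theta> (1 - \<theta>)"

lemma scale_const_pos: "0 < scale_const"
  using ring_const_pos[of \<theta> "1 - \<theta>"] theta Cd_pos by (simp add: scale_const_def)

lemma scaled_energy_le:
  assumes r: "0 < r" and H[measurable]: "H \<in> borel_measurable \<nu>"
  shows "(\<integral>\<^sup>+ x. \<integral>\<^sup>+ y. ennreal (scale_wt \<theta> (1 - \<theta>) r (dist x y) / V x (dist x y)) * (H x + H y) \<partial>\<nu> \<partial>\<nu>)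
    \<le> ennreal scale_const * (\<integral>\<^sup>+ x. H x \<partial>\<nu>)"
  unfolding scale_const_def using theta by (intro scale_energy_le r H) auto

definition series_const :: real where
  "series_const = (geo_const \<theta> + geo_const (1 - \<theta>)) powr (p - 1) * scale_const"

lemma series_const_pos: "0 < series_const"
  using scale_const_pos geo_const_ge_1[of \<theta>] geo_const_ge_1[of "1 - \<theta>"] theta by (simp add: series_const_def)

text \<open>Jensen over the scales uses the weights \<open>g j\<close>, whose sum is bounded
  uniformly in the distance \<open>d\<close>. By \<open>scale_wt_powr\<close>, dividing the bound
  for \<open>T j x y powr p\<close> by \<open>d powr (p * \<theta>)\<close> produces
  \<open>g j powr p\<close> up to a power of the radius. Together with the Jensen factor
  \<open>g j powr (1 - p)\<close> exactly one \<open>g j\<close> survives, and that is the kernel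
  integrated in \<open>scaled_energy_le\<close>. The hypothesis on \<open>f\<close> holds only
  almost everywhere because the averages of a Besov function are known to converge to it only
  there.\<close>

lemma energy_series_le:
  fixes T :: "nat \<Rightarrow> 'a \<Rightarrow> 'a \<Rightarrow> real" and H :: "nat \<Rightarrow> 'a \<Rightarrow> ennreal"
  assumes \<rho>: "0 < \<rho>" and H[measurable]: "\<And>j. H j \<in> borel_measurable \<nu>" and T0: "\<And>j x y. 0 \<le> T j x y"
    and f: "AE x in \<nu>. AE y in \<nu>. x \<noteq> y \<longrightarrow> ennreal \<bar>f x - f y\<bar> \<le> (\<Sum>j. ennreal (T j x y))"
    and T: "\<And>j x y. x \<noteq> y \<Longrightarrow>
      ennreal (T j x y powr p) \<le> ennreal (min 1 ((dist x y / (\<rho> / 2 ^ j)) powr p)) * (H j x + H j y)"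
  shows "energy f \<le> ennreal series_const *
      (\<Sum>j. ennreal ((\<rho> / 2 ^ j) powr (- (p * \<theta>))) * (\<integral>\<^sup>+ x. H j x \<partial>\<nu>))"
proof -
  define g where "g j x y = scale_wt \<theta> (1 - \<theta>) (\<rho> / 2 ^ j) (dist x y)" for j and x y :: 'a
  define c where "c j = (\<rho> / 2 ^ j) powr (- (p * \<theta>))" for j :: nat
  define G where "G = geo_const \<theta> + geo_const (1 - \<theta>)"
  have G: "0 < G" using geo_const_ge_1[of \<theta>] geo_const_ge_1[of "1 - \<theta>"] theta by (simp add: G_def)
  have g0: "0 \<le> g j x y" for j x y by (simp add: g_def scale_wt_nonneg)
  have [measurable]: "(\<lambda>y. g j x y) \<in> borel_measurable \<nu>" for j x unfolding g_def scale_wt_def by measurable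
  have [measurable]: "(\<lambda>z. g j (fst z) (snd z)) \<in> borel_measurable (\<nu> \<Otimes>\<^sub>M \<nu>)" for j unfolding g_def scale_wt_def by measurable
  have pw: "ennreal (\<bar>f x - f y\<bar> powr p / (dist x y powr (p * \<theta>) * V x (dist x y)))
      \<le> ennreal (G powr (p - 1)) * (\<Sum>j. ennreal (c j) * (ennreal (g j x y / V x (dist x y)) * (H j x + H j y)))"
    if le: "x \<noteq> y \<longrightarrow> ennreal \<bar>f x - f y\<bar> \<le> (\<Sum>j. ennreal (T j x y))" for x y
  proof (cases "x = y")
    case False
    define d where "d = dist x y"
    have d: "0 < d" using False by (simp add: d_def)
    have V: "0 < V x d" using d by (rule V_pos)
    define k where "k = 1 / (d powr (p * \<theta>) * V x d)"
    have k0: "0 \<le> k" by (simp add: k_def)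
    have gp: "0 < g j x y" for j using d \<rho> by (simp add: g_def d_def scale_wt_pos)
    have Jen: "ennreal (\<bar>f x - f y\<bar> powr p) \<le> ennreal (G powr (p - 1)) *
        (\<Sum>j. ennreal (g j x y powr (1 - p) * T j x y powr p))"
      by (rule suminf_powr_Jensen[OF p_ge_1 gp T0 G])
        (use scale_wt_sum[OF \<rho> d, of \<theta> "1 - \<theta>"] theta le False in \<open>auto simp: g_def d_def G_def\<close>)
    \<comment> \<open>Here the weight collapses to a single factor \<open>g j\<close>;
      \<open>c j\<close> is the leftover power of the radius.\<close>
    have tm: "ennreal k * ennreal (g j x y powr (1 - p) * T j x y powr p)
        \<le> ennreal (c j) * (ennreal (g j x y / V x d) * (H j x + H j y))" for j
    proof -
      have r: "0 < \<rho> / 2 ^ j" using \<rho> by simp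
      define m where "m = min 1 ((d / (\<rho> / 2 ^ j)) powr p)"
      have m0: "0 \<le> m" by (simp add: m_def)
      have "m * (\<rho> / 2 ^ j / d) powr (p * \<theta>) = g j x y powr p"
        unfolding m_def using scale_wt_powr[OF r d p_ge_1 theta] by (simp add: g_def d_def)
      then have mg: "m * (\<rho> / 2 ^ j) powr (p * \<theta>) / d powr (p * \<theta>) = g j x y powr p"
        using r d by (simp add: powr_divide powr_mult)
      have "g j x y powr (1 - p) * (m / d powr (p * \<theta>)) * (\<rho> / 2 ^ j) powr (p * \<theta>)
          = g j x y powr (1 - p) * (m * (\<rho> / 2 ^ j) powr (p * \<theta>) / d powr (p * \<theta>))" by (simp add: ac_simps)
      also have "\<dots> = g j x y powr (1 - p) * g j x y powr p" unfolding mg ..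
      also have "\<dots> = g j x y" using gp[of j] by (simp flip: powr_add)
      finally have "c j * g j x y = g j x y powr (1 - p) * (m / d powr (p * \<theta>)) * ((\<rho> / 2 ^ j) powr (p * \<theta>) * c j)"
        by (metis mult.assoc mult.commute)
      also have "(\<rho> / 2 ^ j) powr (p * \<theta>) * c j = 1" using r unfolding c_def by (simp only: flip: powr_add) auto
      finally have *: "k * (g j x y powr (1 - p) * m) = c j * (g j x y / V x d)"
        by (simp add: k_def)
      have "ennreal k * ennreal (g j x y powr (1 - p) * T j x y powr p)
         = ennreal (k * g j x y powr (1 - p)) * ennreal (T j x y powr p)"
        using k0 by (simp add: mult.assoc flip: ennreal_mult)
      also have "\<dots> \<le> ennreal (k * g j x y powr (1 - p)) * (ennreal m * (H j x + H j y))"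
        using T[OF False, of j] by (intro mult_left_mono) (auto simp: m_def d_def)
      also have "\<dots> = ennreal (k * (g j x y powr (1 - p) * m)) * (H j x + H j y)"
        using k0 m0 by (subst ennreal_mult_assoc) (auto simp: mult.assoc)
      also have "\<dots> = ennreal (c j) * (ennreal (g j x y / V x d) * (H j x + H j y))"
        unfolding * using g0[of j x y] by (subst ennreal_mult) (auto simp: c_def mult.assoc)
      finally show ?thesis .
    qed
    have "ennreal (\<bar>f x - f y\<bar> powr p / (d powr (p * \<theta>) * V x d)) = ennreal k * ennreal (\<bar>f x - f y\<bar> powr p)"
      by (simp add: k_def flip: ennreal_mult)
    also have "\<dots> \<le> ennreal k * (ennreal (G powr (p - 1)) * (\<Sum>j. ennreal (g j x y powr (1 - p) * T j x y powr p)))"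
      by (intro mult_left_mono Jen) simp
    also have "\<dots> = ennreal (G powr (p - 1)) * (\<Sum>j. ennreal k * ennreal (g j x y powr (1 - p) * T j x y powr p))"
      by (simp add: mult.left_commute)
    also have "\<dots> \<le> ennreal (G powr (p - 1)) * (\<Sum>j. ennreal (c j) * (ennreal (g j x y / V x d) * (H j x + H j y)))"
      by (intro mult_left_mono suminf_le tm) auto
    finally show ?thesis by (simp add: d_def)
  qed simp
  have "energy f \<le> (\<integral>\<^sup>+ x. \<integral>\<^sup>+ y. ennreal (G powr (p - 1)) *
     (\<Sum>j. ennreal (c j) * (ennreal (g j x y / V x (dist x y)) * (H j x + H j y))) \<partial>\<nu> \<partial>\<nu>)"
    unfolding energy_eq
  proof (rule nn_integral_mono_AE)
    show "AE x in \<nu>. (\<integral>\<^sup>+ y. ennreal (\<bar>f x - f y\<bar> powr p / (dist x y powr (p * \<theta>) * V x (dist x y))) \<partial>\<nu>)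
      \<le> (\<integral>\<^sup>+ y. ennreal (G powr (p - 1)) *
     (\<Sum>j. ennreal (c j) * (ennreal (g j x y / V x (dist x y)) * (H j x + H j y))) \<partial>\<nu>)"
      using f
    proof (rule eventually_mono)
      fix x assume "AE y in \<nu>. x \<noteq> y \<longrightarrow> ennreal \<bar>f x - f y\<bar> \<le> (\<Sum>j. ennreal (T j x y))"
      then show "(\<integral>\<^sup>+ y. ennreal (\<bar>f x - f y\<bar> powr p / (dist x y powr (p * \<theta>) * V x (dist x y))) \<partial>\<nu>)
      \<le> (\<integral>\<^sup>+ y. ennreal (G powr (p - 1)) *
     (\<Sum>j. ennreal (c j) * (ennreal (g j x y / V x (dist x y)) * (H j x + H j y))) \<partial>\<nu>)"
        by (intro nn_integral_mono_AE) (auto elim!: eventually_mono intro!: pw)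
    qed
  qed
  also have "\<dots> = ennreal (G powr (p - 1)) * (\<Sum>j. ennreal (c j) *
      (\<integral>\<^sup>+ x. \<integral>\<^sup>+ y. ennreal (g j x y / V x (dist x y)) * (H j x + H j y) \<partial>\<nu> \<partial>\<nu>))"
    by (simp add: nn_integral_cmult nn_integral_suminf)
  also have "\<dots> \<le> ennreal (G powr (p - 1)) * (\<Sum>j. ennreal (c j) * (ennreal scale_const * (\<integral>\<^sup>+ x. H j x \<partial>\<nu>)))"
    using scaled_energy_le[OF _ H] \<rho> by (intro mult_left_mono suminf_le) (auto simp: g_def)
  also have "\<dots> = ennreal series_const * (\<Sum>j. ennreal (c j) * (\<integral>\<^sup>+ x. H j x \<partial>\<nu>))"
    using scale_const_pos unfolding mult.left_commute[of _ "ennreal scale_const"] ennreal_suminf_cmult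
    by (subst ennreal_mult_assoc) (auto simp: series_const_def G_def mult.commute)
  finally show ?thesis by (simp add: c_def)
qed

text \<open>A series whose only nonzero term is \<open>j = 0\<close>, meant for functions that live
  at one scale, such as cutoffs.\<close>

lemma energy_single_scale_le:
  assumes r: "0 < r" and H[measurable]: "H \<in> borel_measurable \<nu>"
    and f: "\<And>x y. x \<noteq> y \<Longrightarrow> ennreal (\<bar>f x - f y\<bar> powr p) \<le> ennreal (min 1 ((dist x y / r) powr p)) * (H x + H y)"
  shows "energy f \<le> ennreal (series_const * r powr (- (p * \<theta>))) * (\<integral>\<^sup>+ x. H x \<partial>\<nu>)"
proof -
  define T where "T j x y = (if j = 0 then \<bar>f x - f y\<bar> else 0)" for j :: nat and x y
  define G where "G j x = (if j = 0 then H x else 0)" for j :: nat and x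
  have "energy f \<le> ennreal series_const *
      (\<Sum>j. ennreal ((r / 2 ^ j) powr (- (p * \<theta>))) * (\<integral>\<^sup>+ x. G j x \<partial>\<nu>))"
  proof (rule energy_series_le[OF r])
    show "AE x in \<nu>. AE y in \<nu>. x \<noteq> y \<longrightarrow> ennreal \<bar>f x - f y\<bar> \<le> (\<Sum>j. ennreal (T j x y))"
    proof (intro AE_I2 impI)
      fix x y
      have "ennreal \<bar>f x - f y\<bar> = (\<Sum>j\<in>{0}. ennreal (T j x y))" by (simp add: T_def)
      also have "\<dots> \<le> (\<Sum>j. ennreal (T j x y))" by (rule sum_le_suminf) auto
      finally show "ennreal \<bar>f x - f y\<bar> \<le> (\<Sum>j. ennreal (T j x y))" .
    qed
  qed (use f in \<open>auto simp: T_def G_def\<close>)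
  also have "(\<Sum>j. ennreal ((r / 2 ^ j) powr (- (p * \<theta>))) * (\<integral>\<^sup>+ x. G j x \<partial>\<nu>))
      = (\<Sum>j\<in>{0}. ennreal ((r / 2 ^ j) powr (- (p * \<theta>))) * (\<integral>\<^sup>+ x. G j x \<partial>\<nu>))"
    by (rule suminf_finite) (auto simp: G_def)
  also have "\<dots> = ennreal (r powr (- (p * \<theta>))) * (\<integral>\<^sup>+ x. H x \<partial>\<nu>)" by (simp add: G_def)
  finally show ?thesis using series_const_pos by (simp add: ennreal_mult_assoc)
qed

end

section \<open>Lipschitz averages\<close>

context doubling_space
begin

text \<open>A tent instead of the indicator of a ball: its Lipschitz dependence on the centre is
  inherited by \<open>smooth\<close>.\<close>

definition bump :: "real \<Rightarrow> 'a \<Rightarrow> 'a \<Rightarrow> real" where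
  "bump r x y = max 0 (1 - dist x y / r)"

definition bump_mass :: "real \<Rightarrow> 'a \<Rightarrow> real" where
  "bump_mass r x = (\<integral>y. bump r x y \<partial>\<nu>)"

definition bump_ker :: "real \<Rightarrow> 'a \<Rightarrow> 'a \<Rightarrow> real" where
  "bump_ker r x y = bump r x y / bump_mass r x"

definition smooth :: "real \<Rightarrow> ('a \<Rightarrow> real) \<Rightarrow> 'a \<Rightarrow> real" where
  "smooth r u x = (\<integral>y. bump_ker r x y * u y \<partial>\<nu>)"

lemma bump_bounds: "0 < r \<Longrightarrow> 0 \<le> bump r x y" "0 < r \<Longrightarrow> bump r x y \<le> 1"
  by (auto simp: bump_def)

lemma bump_eq_0: "0 < r \<Longrightarrow> r \<le> dist x y \<Longrightarrow> bump r x y = 0"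
  by (simp add: bump_def)

lemma bump_lipschitz: "0 < r \<Longrightarrow> \<bar>bump r x z - bump r y z\<bar> \<le> dist x y / r"
proof -
  assume r: "0 < r"
  have "\<bar>bump r x z - bump r y z\<bar> \<le> \<bar>dist x z / r - dist y z / r\<bar>" by (auto simp: bump_def)
  also have "\<dots> = \<bar>dist x z - dist y z\<bar> / r" using r by (simp add: diff_divide_distrib[symmetric])
  also have "\<dots> \<le> dist x y / r" using r dist_triangle[of x z y] dist_triangle[of y z x]
    by (intro divide_right_mono) (auto simp: dist_commute abs_le_iff)
  finally show ?thesis .
qed

lemma measurable_bump[measurable]:
  assumes [measurable]: "f \<in> measurable M \<nu>" "g \<in> measurable M \<nu>"
  shows "(\<lambda>x. bump r (f x) (g x)) \<in> borel_measurable M"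
  unfolding bump_def by measurable

lemma integrable_bump: "0 < r \<Longrightarrow> integrable \<nu> (bump r x)"
  by (intro integrable_const_bound[where B = 1]) (auto simp: bump_bounds)

text \<open>The tent is at least \<open>1 / 2\<close> on the ball of half the radius, and doubling
  compares that ball with the full one.\<close>

lemma bump_mass_ge: "0 < r \<Longrightarrow> V x r \<le> 2 * Cd * bump_mass r x"
proof -
  assume r: "0 < r"
  have "V x (r / 2) = (\<integral>y. indicator (ball x (r / 2)) y \<partial>\<nu>)" by (simp add: V_def)
  also have "\<dots> \<le> (\<integral>y. 2 * bump r x y \<partial>\<nu>)"
    using r by (intro integral_mono integrable_real_indicator integrable_mult_right integrable_bump)
      (auto simp: indicator_def bump_def field_simps emeasure_eq_measure)
  finally have "V x (r / 2) \<le> 2 * bump_mass r x" using r by (simp add: bump_mass_def)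
  then have "Cd * V x (r / 2) \<le> Cd * (2 * bump_mass r x)" using Cd_pos by (intro mult_left_mono) auto
  then show ?thesis using V_double[of x "r / 2"] by simp
qed

lemma bump_mass_pos: "0 < r \<Longrightarrow> 0 < bump_mass r x"
  using bump_mass_ge[of r x] V_pos[of r x] Cd_pos by (smt (verit) mult_nonneg_nonpos)

text \<open>Both tents vanish outside \<open>S\<close>. Admitting a small \<open>S\<close> instead
  of the whole space keeps the constants in \<open>smooth_near_bound\<close> independent of the
  scale.\<close>

lemma bump_mass_lipschitz:
  assumes r: "0 < r" and S: "S \<in> sets \<nu>" "ball x r \<union> ball y r \<subseteq> S"
  shows "\<bar>bump_mass r x - bump_mass r y\<bar> \<le> dist x y / r * measure \<nu> S"
proof -
  have "\<bar>bump_mass r x - bump_mass r y\<bar> = \<bar>\<integral>z. bump r x z - bump r y z \<partial>\<nu>\<bar>"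
    using r by (simp add: bump_mass_def integrable_bump)
  also have "\<dots> \<le> (\<integral>z. \<bar>bump r x z - bump r y z\<bar> \<partial>\<nu>)" by (rule integral_abs_bound)
  also have "\<dots> \<le> (\<integral>z. dist x y / r * indicator S z \<partial>\<nu>)"
  proof (intro integral_mono integrable_abs integrable_mult_right integrable_real_indicator Bochner_Integration.integrable_diff integrable_bump r)
    fix z
    show "\<bar>bump r x z - bump r y z\<bar> \<le> dist x y / r * indicator S z"
    proof (cases "z \<in> S")
      case False
      then have "z \<notin> ball x r" "z \<notin> ball y r" using S by auto
      then have "r \<le> dist x z" "r \<le> dist y z" by auto
      then show ?thesis using r False by (simp add: bump_eq_0)
    qed (simp add: bump_lipschitz r)
  qed (use S in \<open>auto simp: emeasure_eq_measure\<close>)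
  finally show ?thesis using S by simp
qed

lemma measurable_bump_ker[measurable]:
  assumes [measurable]: "f \<in> measurable M \<nu>" "g \<in> measurable M \<nu>"
  shows "(\<lambda>x. bump_ker r (f x) (g x)) \<in> borel_measurable M"
  unfolding bump_ker_def bump_mass_def by measurable

lemma bump_ker_nonneg: "0 < r \<Longrightarrow> 0 \<le> bump_ker r x y"
  using bump_mass_pos[of r x] by (simp add: bump_ker_def bump_bounds)

lemma bump_ker_le:
  assumes r: "0 < r"
  shows "bump_ker r x y \<le> 2 * Cd * avg_ker r x y"
proof (cases "dist x y < r")
  case True
  have "bump_ker r x y \<le> 1 / bump_mass r x"
    using bump_mass_pos[OF r, of x] bump_bounds[OF r, of x y] by (simp add: bump_ker_def divide_right_mono)
  also have "\<dots> \<le> 2 * Cd * (1 / V x r)"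
    using bump_mass_ge[OF r, of x] bump_mass_pos[OF r, of x] V_pos[OF r, of x] by (simp add: field_simps)
  finally show ?thesis using True by (simp add: avg_ker_def)
qed (simp add: bump_ker_def avg_ker_def bump_eq_0 r)

text \<open>Quotient rule: the difference splits into a change of the tent at fixed mass and a
  change of the reciprocal mass.\<close>

lemma bump_ker_diff_le:
  assumes r: "0 < r" and S: "S \<in> sets \<nu>" "ball x r \<union> ball y r \<subseteq> S"
  shows "\<bar>bump_ker r x z - bump_ker r y z\<bar>
    \<le> dist x y / r * (1 / bump_mass r x + measure \<nu> S / (bump_mass r x * bump_mass r y)) * indicator S z"
proof (cases "z \<in> S")
  case True
  define a b where "a = bump_mass r x" and "b = bump_mass r y"
  have ab: "0 < a" "0 < b" using bump_mass_pos[OF r] by (auto simp: a_def b_def)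
  have "bump_ker r x z - bump_ker r y z = (bump r x z - bump r y z) / a + bump r y z * ((b - a) / (a * b))"
    using ab by (simp add: bump_ker_def a_def[symmetric] b_def[symmetric] field_simps)
  also have "\<bar>\<dots>\<bar> \<le> \<bar>bump r x z - bump r y z\<bar> / a + bump r y z * (\<bar>b - a\<bar> / (a * b))"
    using ab bump_bounds[OF r, of y z] by (intro order_trans[OF abs_triangle_ineq]) (simp add: abs_mult)
  also have "\<dots> \<le> (dist x y / r) / a + 1 * ((dist x y / r * measure \<nu> S) / (a * b))"
    using ab bump_bounds[OF r, of y z] bump_lipschitz[OF r] bump_mass_lipschitz[OF r S]
    by (intro add_mono mult_mono divide_right_mono) (auto simp: a_def b_def abs_minus_commute)
  also have "\<dots> = dist x y / r * (1 / a + measure \<nu> S / (a * b))" by (simp add: distrib_left)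
  finally show ?thesis using True by (simp add: a_def b_def)
next
  case False
  then have "z \<notin> ball x r" "z \<notin> ball y r" using S by auto
  then have "r \<le> dist x z" "r \<le> dist y z" by auto
  then show ?thesis using r False by (simp add: bump_ker_def bump_eq_0)
qed

lemma bump_ker_bounded: "0 < r \<Longrightarrow> \<bar>bump_ker r x y\<bar> \<le> 1 / bump_mass r x"
  using bump_mass_pos[of r x] bump_bounds[of r x y] by (simp add: bump_ker_def divide_right_mono)

lemma integrable_bounded_mult:
  fixes Q u :: "'a \<Rightarrow> real"
  assumes [measurable]: "Q \<in> borel_measurable \<nu>" and "\<And>y. \<bar>Q y\<bar> \<le> K" and u: "integrable \<nu> u"
  shows "integrable \<nu> (\<lambda>y. Q y * u y)"
proof (rule Bochner_Integration.integrable_bound[of _ "\<lambda>y. K * u y"])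
  show "AE y in \<nu>. norm (Q y * u y) \<le> norm (K * u y)"
    using assms(2) by (intro AE_I2) (auto simp: abs_mult intro!: mult_right_mono intro: order_trans[OF _ abs_ge_self])
qed (use u in auto)

lemma integrable_bump_ker_mult: "0 < r \<Longrightarrow> integrable \<nu> u \<Longrightarrow> integrable \<nu> (\<lambda>y. bump_ker r x y * u y)"
  by (rule integrable_bounded_mult[where K = "1 / bump_mass r x"]) (auto simp: bump_ker_bounded)

lemma integrable_bump_ker: "0 < r \<Longrightarrow> integrable \<nu> (bump_ker r x)"
  using integrable_bump_ker_mult[of r "\<lambda>_. 1" x] by simp

lemma bump_ker_integral: "0 < r \<Longrightarrow> (\<integral>y. bump_ker r x y \<partial>\<nu>) = 1"
  using bump_mass_pos[of r x] by (simp add: bump_ker_def) (simp add: bump_mass_def)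

lemma smooth_minus_const:
  assumes "0 < r" "integrable \<nu> u"
  shows "smooth r u x - c = (\<integral>y. bump_ker r x y * (u y - c) \<partial>\<nu>)"
  using assms by (simp add: smooth_def right_diff_distrib integrable_bump_ker_mult integrable_bump_ker bump_ker_integral)

text \<open>The difference of two kernels has integral 0, so any constant may be subtracted from
  \<open>u\<close>; the choice \<open>c = smooth r u x\<close> later turns values into
  oscillations.\<close>

lemma smooth_diff:
  assumes "0 < r" "integrable \<nu> u"
  shows "smooth r u x - smooth r u y = (\<integral>z. (bump_ker r x z - bump_ker r y z) * (u z - c) \<partial>\<nu>)"
  using smooth_minus_const[OF assms, of x c] smooth_minus_const[OF assms, of y c]
    integrable_bump_ker_mult[of r "\<lambda>z. u z - c"] assms
  by (simp add: left_diff_distrib)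

text \<open>Kernels of varying sign enter only through their absolute value, compared with an
  averaging kernel. A non-integrable product has integral 0 by convention.\<close>

lemma kernel_integral_le:
  fixes Q u :: "'a \<Rightarrow> real"
  assumes Q: "\<And>z. \<bar>Q z\<bar> \<le> K * avg_ker s w z" and u[measurable]: "u \<in> borel_measurable \<nu>" and K: "0 \<le> K"
  shows "ennreal \<bar>\<integral>z. Q z * u z \<partial>\<nu>\<bar> \<le> ennreal K * avg (\<lambda>z. ennreal \<bar>u z\<bar>) w s"
proof (cases "integrable \<nu> (\<lambda>z. Q z * u z)")
  case True
  then have "ennreal \<bar>\<integral>z. Q z * u z \<partial>\<nu>\<bar> \<le> (\<integral>\<^sup>+ z. ennreal (norm (Q z * u z)) \<partial>\<nu>)"
    using integral_norm_bound_ennreal[OF True] by simp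
  also have "\<dots> \<le> (\<integral>\<^sup>+ z. ennreal K * (ennreal (avg_ker s w z) * ennreal \<bar>u z\<bar>) \<partial>\<nu>)"
    using Q K by (intro nn_integral_mono) (simp add: abs_mult mult_right_mono ennreal_leI flip: ennreal_mult mult.assoc)
  also have "\<dots> = ennreal K * avg (\<lambda>z. ennreal \<bar>u z\<bar>) w s" unfolding avg_def by (rule nn_integral_cmult) measurable
  finally show ?thesis .
qed (simp add: not_integrable_integral_eq)

text \<open>The space is bounded, so a fixed number of doublings bounds the masses of all tents of
  radius \<open>r\<close> from below. The constant may blow up as \<open>r\<close> shrinks.\<close>

lemma lipschitz_smooth:
  assumes r: "0 < r" and u: "integrable \<nu> u"
  shows "\<exists>L. L-lipschitz_on UNIV (smooth r u)"
proof -
  define M where "M = measure \<nu> UNIV"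
  obtain k where k: "R / r < 2 ^ k" using real_arch_pow[of 2 "R / r"] by auto
  define n where "n = M / (2 * Cd * Cd ^ k)"
  have M: "M = V x R" for x by (simp add: M_def V_def)
  then have M0: "0 < M" using V_pos[OF R_pos] by simp
  have n: "0 < n" using M0 Cd_pos by (simp add: n_def)
  have mass: "n \<le> bump_mass r x" for x
  proof -
    have "M \<le> Cd ^ k * V x r" unfolding M[of x] using k r by (intro V_compare) (simp add: field_simps)
    also have "\<dots> \<le> Cd ^ k * (2 * Cd * bump_mass r x)" using Cd_pos bump_mass_ge[OF r, of x] by (intro mult_left_mono) auto
    finally show ?thesis using Cd_pos by (simp add: n_def field_simps)
  qed
  define K where "K = 1 / r * (1 / n + M / (n * n))"
  have K0: "0 \<le> K" using r n M0 by (simp add: K_def)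
  have "\<bar>smooth r u x - smooth r u y\<bar> \<le> K * (\<integral>z. \<bar>u z\<bar> \<partial>\<nu>) * dist x y" for x y
  proof -
    have Q: "\<bar>bump_ker r x z - bump_ker r y z\<bar> \<le> dist x y * K" for z
    proof -
      have "\<bar>bump_ker r x z - bump_ker r y z\<bar>
        \<le> dist x y / r * (1 / bump_mass r x + M / (bump_mass r x * bump_mass r y)) * indicator UNIV z"
        unfolding M_def using sets.top[of \<nu>] by (intro bump_ker_diff_le r) auto
      also have "\<dots> \<le> dist x y / r * (1 / n + M / (n * n)) * 1"
        using mass[of x] mass[of y] n M0 r bump_mass_pos[OF r]
        by (intro mult_mono mult_left_mono add_mono divide_left_mono) (auto intro!: add_nonneg_nonneg mult_pos_pos less_imp_le divide_nonneg_nonneg)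
      finally show ?thesis by (simp add: K_def)
    qed
    have "smooth r u x - smooth r u y = (\<integral>z. (bump_ker r x z - bump_ker r y z) * u z \<partial>\<nu>)"
      using smooth_diff[OF r u, of x y 0] by simp
    also have "\<bar>\<dots>\<bar> \<le> (\<integral>z. \<bar>(bump_ker r x z - bump_ker r y z) * u z\<bar> \<partial>\<nu>)" by (rule integral_abs_bound)
    also have "\<dots> \<le> (\<integral>z. (dist x y * K) * \<bar>u z\<bar> \<partial>\<nu>)"
      using Q u r by (intro integral_mono integrable_abs integrable_mult_right integrable_bounded_mult[where K = "dist x y * K"])
        (auto simp: abs_mult intro!: mult_right_mono)
    also have "\<dots> = K * (\<integral>z. \<bar>u z\<bar> \<partial>\<nu>) * dist x y" by simp
    finally show ?thesis .
  qed
  then show ?thesis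
    by (intro exI[of _ "K * (\<integral>z. \<bar>u z\<bar> \<partial>\<nu>)"] lipschitz_onI) (auto simp: dist_real_def K0 intro!: mult_nonneg_nonneg integral_nonneg)
qed

lemma continuous_smooth: "0 < r \<Longrightarrow> integrable \<nu> u \<Longrightarrow> continuous_on UNIV (smooth r u)"
  using lipschitz_smooth lipschitz_on_continuous_on by blast

lemma measurable_smooth: "0 < r \<Longrightarrow> integrable \<nu> u \<Longrightarrow> smooth r u \<in> borel_measurable \<nu>"
  by (intro borel_measurable_borelI borel_measurable_continuous_onI continuous_smooth)

end

section \<open>Oscillations and the increments between averages\<close>

context besov_setting
begin

text \<open>The radius \<open>4 * r\<close> leaves room: whenever \<open>dist x z < 2 * r\<close>,
  the ball about \<open>z\<close> contains the support of \<open>bump_ker r x\<close>, so that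
  \<open>osc u r z\<close> controls \<open>u z - smooth r u x\<close> for all such
  \<open>x\<close>.\<close>

definition osc :: "('a \<Rightarrow> real) \<Rightarrow> real \<Rightarrow> 'a \<Rightarrow> ennreal" where
  "osc u r z = avg (\<lambda>y. ennreal (\<bar>u z - u y\<bar> powr p)) z (4 * r)"

text \<open>The radius \<open>2 * r\<close> collects exactly the points \<open>z\<close> to which
  \<open>osc_bound\<close> applies.\<close>

definition mean_osc :: "('a \<Rightarrow> real) \<Rightarrow> real \<Rightarrow> 'a \<Rightarrow> ennreal" where
  "mean_osc u r x = avg (osc u r) x (2 * r)"

lemma measurable_osc[measurable]:
  assumes [measurable]: "u \<in> borel_measurable \<nu>"
  shows "osc u r \<in> borel_measurable \<nu>"
  unfolding osc_def avg_def by measurable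

lemma measurable_mean_osc[measurable]: "u \<in> borel_measurable \<nu> \<Longrightarrow> mean_osc u r \<in> borel_measurable \<nu>"
  unfolding mean_osc_def by measurable

definition osc_const :: real where "osc_const = 2 * Cd ^ 4"

lemma osc_const_pos: "0 < osc_const" using Cd_pos by (simp add: osc_const_def)

lemma osc_bound:
  assumes r: "0 < r" and u: "integrable \<nu> u" and xz: "dist x z < 2 * r"
  shows "ennreal (\<bar>u z - smooth r u x\<bar> powr p) \<le> ennreal (osc_const powr p) * osc u r z"
proof -
  have [measurable]: "u \<in> borel_measurable \<nu>" using u by simp
  have "ennreal \<bar>smooth r u x - u z\<bar> \<le> ennreal osc_const * avg (\<lambda>y. ennreal \<bar>u y - u z\<bar>) z (4 * r)"
    unfolding smooth_minus_const[OF r u]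
  proof (rule kernel_integral_le)
    fix y
    have "\<bar>bump_ker r x y\<bar> \<le> 2 * Cd * avg_ker r x y" using bump_ker_le[OF r] bump_ker_nonneg[OF r] by simp
    also have "\<dots> \<le> 2 * Cd * (Cd ^ 3 * avg_ker (4 * r) z y)"
      using xz r Cd_pos by (intro mult_left_mono avg_ker_le r) auto
    also have "\<dots> = osc_const * avg_ker (4 * r) z y" by (simp add: osc_const_def eval_nat_numeral)
    finally show "\<bar>bump_ker r x y\<bar> \<le> osc_const * avg_ker (4 * r) z y" .
  qed (use osc_const_pos in auto)
  then have "ennreal (\<bar>smooth r u x - u z\<bar> powr p) \<le> ennreal (osc_const powr p) * avg (\<lambda>y. ennreal (\<bar>u y - u z\<bar> powr p)) z (4 * r)"
    using r osc_const_pos by (intro avg_powr_Jensen p_ge_1) auto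
  then show ?thesis by (simp add: osc_def abs_minus_commute)
qed

text \<open>Used with \<open>Q\<close> the kernel of the average at half the radius, and with
  \<open>Q\<close> a difference of kernels at nearby centres. Jensen acts on the integral over
  \<open>z\<close> here and, inside \<open>osc_bound\<close>, on the average that defines
  \<open>smooth r u x\<close>.\<close>

lemma mean_osc_bound:
  assumes r: "0 < r" and u: "integrable \<nu> u" and K: "0 < K" and Q: "\<And>z. \<bar>Q z\<bar> \<le> K * avg_ker (2 * r) x z"
  shows "ennreal (\<bar>\<integral>z. Q z * (u z - smooth r u x) \<partial>\<nu>\<bar> powr p) \<le> ennreal ((K * osc_const) powr p) * mean_osc u r x"
proof -
  have [measurable]: "u \<in> borel_measurable \<nu>" using u by simp
  have "ennreal \<bar>\<integral>z. Q z * (u z - smooth r u x) \<partial>\<nu>\<bar> \<le> ennreal K * avg (\<lambda>z. ennreal \<bar>u z - smooth r u x\<bar>) x (2 * r)"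
    using K Q by (intro kernel_integral_le) auto
  then have "ennreal (\<bar>\<integral>z. Q z * (u z - smooth r u x) \<partial>\<nu>\<bar> powr p)
      \<le> ennreal (K powr p) * avg (\<lambda>z. ennreal (\<bar>u z - smooth r u x\<bar> powr p)) x (2 * r)"
    using r K by (intro avg_powr_Jensen p_ge_1) auto
  also have "\<dots> \<le> ennreal (K powr p) * avg (\<lambda>z. ennreal (osc_const powr p) * osc u r z) x (2 * r)"
    by (intro mult_left_mono avg_mono osc_bound r u) auto
  also have "\<dots> = ennreal ((K * osc_const) powr p) * mean_osc u r x"
    using K osc_const_pos by (simp add: avg_cmult mean_osc_def powr_mult ennreal_mult mult.assoc)
  finally show ?thesis .
qed

definition half_const :: real where "half_const = 2 * Cd ^ 3"
text \<open>From the left: 2 from \<open>r / 2 \<le> s\<close>, \<open>Cd\<close> from passing to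
  the ball of radius \<open>2 * r\<close>, \<open>2 * Cd ^ 2\<close> from the reciprocal mass at
  \<open>x\<close>, and the last factor from the variation of the mass.\<close>

definition near_const :: real where "near_const = 2 * Cd * (2 * Cd ^ 2 * (1 + 2 * Cd ^ 3))"

lemma half_const_pos: "0 < half_const" and near_const_pos: "0 < near_const"
  using Cd_pos by (auto simp: half_const_def near_const_def intro!: mult_pos_pos add_pos_pos)

lemma smooth_half_bound:
  assumes r: "0 < r" and u: "integrable \<nu> u"
  shows "ennreal (\<bar>smooth (r / 2) u x - smooth r u x\<bar> powr p) \<le> ennreal ((half_const * osc_const) powr p) * mean_osc u r x"
proof -
  have r2: "0 < r / 2" using r by simp
  have "\<bar>bump_ker (r / 2) x z\<bar> \<le> half_const * avg_ker (2 * r) x z" for z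
  proof -
    have "\<bar>bump_ker (r / 2) x z\<bar> \<le> 2 * Cd * avg_ker (r / 2) x z"
      using bump_ker_le[OF r2] bump_ker_nonneg[OF r2] by simp
    also have "\<dots> \<le> 2 * Cd * (Cd ^ 2 * avg_ker (2 * r) x z)"
      using Cd_pos r by (intro mult_left_mono avg_ker_le r2) auto
    finally show ?thesis by (simp add: half_const_def eval_nat_numeral)
  qed
  then show ?thesis unfolding smooth_minus_const[OF r2 u]
    by (intro mean_osc_bound r u half_const_pos)
qed

text \<open>The range of \<open>s\<close> covers both averages in a \<open>step\<close>, measured by
  one and the same \<open>mean_osc u r x\<close>. The gain over \<open>smooth_half_bound\<close> is
  the factor \<open>dist x y / r\<close>.\<close>

lemma smooth_near_bound:
  assumes r: "0 < r" and u: "integrable \<nu> u" and s: "r / 2 \<le> s" "s \<le> r" and xy: "x \<noteq> y" "dist x y < s"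
  shows "ennreal (\<bar>smooth s u x - smooth s u y\<bar> powr p)
    \<le> ennreal ((dist x y / r * near_const * osc_const) powr p) * mean_osc u r x"
proof -
  have s0: "0 < s" using r s by simp
  have "\<bar>bump_ker s x z - bump_ker s y z\<bar> \<le> (dist x y / r * near_const) * avg_ker (2 * r) x z" for z
  proof -
    define W where "W = V x (2 * s)"
    define a b where "a = bump_mass s x" and "b = bump_mass s y"
    have ab: "0 < a" "0 < b" using bump_mass_pos[OF s0] by (auto simp: a_def b_def)
    have W: "0 < W" using s0 by (simp add: W_def V_pos)
    have Wa: "W \<le> 2 * Cd ^ 2 * a"
    proof -
      have "W \<le> Cd * V x s" by (simp add: W_def V_double)
      also have "\<dots> \<le> Cd * (2 * Cd * a)" using bump_mass_ge[OF s0, of x] Cd_pos by (intro mult_left_mono) (auto simp: a_def)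
      finally show ?thesis by (simp add: power2_eq_square)
    qed
    have Wb: "W \<le> 2 * Cd ^ 3 * b"
    proof -
      have "W \<le> Cd ^ 2 * V y s" unfolding W_def using xy s0 by (intro V_compare) auto
      also have "\<dots> \<le> Cd ^ 2 * (2 * Cd * b)" using bump_mass_ge[OF s0, of y] Cd_pos by (intro mult_left_mono) (auto simp: b_def)
      finally show ?thesis by (simp add: eval_nat_numeral)
    qed
    have 1: "1 / a \<le> 2 * Cd ^ 2 / W" using Wa W ab by (simp add: field_simps)
    have 2: "W / b \<le> 2 * Cd ^ 3" using Wb ab by (simp add: field_simps)
    have "ball x s \<union> ball y s \<subseteq> ball x (2 * s)"
    proof
      fix t assume "t \<in> ball x s \<union> ball y s"
      then show "t \<in> ball x (2 * s)" using xy s0 dist_triangle[of x t y] by auto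
    qed
    then have "\<bar>bump_ker s x z - bump_ker s y z\<bar> \<le> dist x y / s * (1 / a + W / (a * b)) * indicator (ball x (2 * s)) z"
      unfolding a_def b_def W_def V_def by (intro bump_ker_diff_le s0) auto
    also have "1 / a + W / (a * b) = 1 / a * (1 + W / b)" using ab by (simp add: field_simps)
    also have "dist x y / s * (1 / a * (1 + W / b)) * indicator (ball x (2 * s)) z
      \<le> (2 * (dist x y / r)) * (2 * Cd ^ 2 / W * (1 + 2 * Cd ^ 3)) * indicator (ball x (2 * s)) z"
    proof (intro mult_right_mono mult_mono 1 add_mono 2)
      show "dist x y / s \<le> 2 * (dist x y / r)" using s r s0 mult_left_mono[of r "2 * s" "dist x y"] by (simp add: field_simps)
    qed (use ab W Cd_pos r in \<open>auto simp: indicator_def intro!: mult_nonneg_nonneg add_nonneg_nonneg divide_nonneg_nonneg\<close>)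
    also have "\<dots> = (2 * (dist x y / r)) * (2 * Cd ^ 2 * (1 + 2 * Cd ^ 3)) * avg_ker (2 * s) x z"
      by (simp add: avg_ker_def indicator_def W_def)
    also have "\<dots> \<le> (2 * (dist x y / r)) * (2 * Cd ^ 2 * (1 + 2 * Cd ^ 3)) * (Cd ^ 1 * avg_ker (2 * r) x z)"
      using s r s0 Cd_pos by (intro mult_left_mono avg_ker_le) auto
    also have "\<dots> = (dist x y / r * near_const) * avg_ker (2 * r) x z" by (simp add: near_const_def)
    finally show ?thesis .
  qed
  then show ?thesis unfolding smooth_diff[OF s0 u, of x y "smooth r u x"]
    using r xy near_const_pos by (intro mean_osc_bound r u) auto
qed

definition step :: "('a \<Rightarrow> real) \<Rightarrow> real \<Rightarrow> 'a \<Rightarrow> real" where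
  "step u r x = smooth (r / 2) u x - smooth r u x"

text \<open>The first summand serves nearby points, the second distant ones, where
  \<open>4 powr p\<close> pays for splitting the power of a sum and for the lower bound
  \<open>(1 / 2) powr p\<close> of the minimum.\<close>

definition step_const :: real where
  "step_const = 2 powr p * (2 * (near_const * osc_const) powr p) + 4 powr p * (half_const * osc_const) powr p"

lemma step_const_pos: "0 < step_const"
  using near_const_pos osc_const_pos half_const_pos by (simp add: step_const_def add_pos_pos)

lemma step_bound:
  assumes r: "0 < r" and u: "integrable \<nu> u"
  shows "ennreal (\<bar>step u r x\<bar> powr p) \<le> ennreal step_const * mean_osc u r x"
proof -
  have "(half_const * osc_const) powr p \<le> 4 powr p * (half_const * osc_const) powr p"
    using p_ge_1 ge_one_powr_ge_zero[of 4 p] mult_right_mono[of 1 "4 powr p" "(half_const * osc_const) powr p"] by simp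
  also have "\<dots> \<le> step_const" by (simp add: step_const_def)
  finally show ?thesis
    unfolding step_def using smooth_half_bound[OF r u, of x]
    by (meson order_trans mult_right_mono ennreal_leI zero_le)
qed

text \<open>Nearby points use the Lipschitz bound for both averages, which requires
  \<open>dist x y < r / 2\<close>. Beyond that threshold the minimum is bounded below, and the sizes
  of the two steps suffice.\<close>

lemma step_diff_bound:
  assumes r: "0 < r" and u: "integrable \<nu> u" and xy: "x \<noteq> y"
  shows "ennreal (\<bar>step u r x - step u r y\<bar> powr p)
    \<le> ennreal (min 1 ((dist x y / r) powr p)) * (ennreal step_const * mean_osc u r x + ennreal step_const * mean_osc u r y)"
proof -
  define q where "q = dist x y / r"
  define X Y where "X = mean_osc u r x" and "Y = mean_osc u r y"
  have q: "0 < q" using xy r by (simp add: q_def)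
  have p0: "0 \<le> p" using p_ge_1 by simp
  show ?thesis
  proof (cases "q < 1 / 2")
    case True
    then have d: "dist x y < r / 2" using r by (simp add: q_def field_simps)
    define N where "N = (q * near_const * osc_const) powr p"
    have "ennreal (\<bar>step u r x - step u r y\<bar> powr p) \<le>
      ennreal ((\<bar>smooth (r / 2) u x - smooth (r / 2) u y\<bar> + \<bar>smooth r u x - smooth r u y\<bar>) powr p)"
      using p0 by (intro ennreal_leI powr_mono2) (auto simp: step_def)
    also have "\<dots> \<le> ennreal (2 powr p) * (ennreal (\<bar>smooth (r / 2) u x - smooth (r / 2) u y\<bar> powr p)
        + ennreal (\<bar>smooth r u x - smooth r u y\<bar> powr p))"
      using p0 by (intro ennreal_powr_add_le) auto
    also have "\<dots> \<le> ennreal (2 powr p) * (ennreal N * X + ennreal N * X)"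
      unfolding N_def q_def X_def using d r xy by (intro mult_left_mono add_mono smooth_near_bound r u) auto
    also have "\<dots> = ennreal (2 powr p * (2 * N)) * X"
      unfolding distrib_right[symmetric]
      by (subst ennreal_mult_assoc[symmetric]) (auto simp: N_def simp flip: ennreal_plus)
    also have "2 powr p * (2 * N) = q powr p * (2 powr p * (2 * (near_const * osc_const) powr p))"
      using q near_const_pos osc_const_pos by (simp add: N_def powr_mult)
    also have "ennreal \<dots> * X \<le> ennreal (q powr p * step_const) * (X + Y)"
      by (intro mult_mono ennreal_leI mult_left_mono) (auto simp: step_const_def)
    also have "\<dots> = ennreal (q powr p) * (ennreal step_const * X + ennreal step_const * Y)"
      using step_const_pos by (simp add: ennreal_mult distrib_left mult.assoc)
    also have "q powr p = min 1 (q powr p)" using True q p0 powr_le1[of p q] by simp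
    finally show ?thesis by (simp add: q_def X_def Y_def)
  next
    case False
    define N where "N = (half_const * osc_const) powr p"
    have "ennreal (\<bar>step u r x - step u r y\<bar> powr p) \<le> ennreal ((\<bar>step u r x\<bar> + \<bar>step u r y\<bar>) powr p)"
      using p0 by (intro ennreal_leI powr_mono2) auto
    also have "\<dots> \<le> ennreal (2 powr p) * (ennreal (\<bar>step u r x\<bar> powr p) + ennreal (\<bar>step u r y\<bar> powr p))"
      using p0 by (intro ennreal_powr_add_le) auto
    also have "\<dots> \<le> ennreal (2 powr p) * (ennreal N * X + ennreal N * Y)"
      unfolding N_def X_def Y_def step_def by (intro mult_left_mono add_mono smooth_half_bound r u) auto
    also have "\<dots> = ennreal (2 powr p * N) * (X + Y)"
      unfolding distrib_left[symmetric] by (subst ennreal_mult_assoc[symmetric]) (auto simp: N_def)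
    also have "\<dots> \<le> ennreal (min 1 (q powr p) * step_const) * (X + Y)"
    proof (intro mult_right_mono ennreal_leI)
      have "(1 / 2) powr p \<le> min 1 (q powr p)"
        using False p0 powr_mono2[of p "1 / 2" q] powr_le1[of p "1 / 2"] by simp
      then have "(1 / 2) powr p * (4 powr p * N) \<le> min 1 (q powr p) * step_const"
        using step_const_pos by (intro mult_mono) (auto simp: N_def step_const_def)
      moreover have "(1 / 2) powr p * 4 powr p = (2::real) powr p" by (simp flip: powr_mult)
      ultimately show "2 powr p * N \<le> min 1 (q powr p) * step_const" by (simp flip: mult.assoc)
    qed simp
    also have "\<dots> = ennreal (min 1 (q powr p)) * (ennreal step_const * X + ennreal step_const * Y)"
      using step_const_pos by (simp add: ennreal_mult distrib_left mult.assoc)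
    finally show ?thesis by (simp add: q_def X_def Y_def)
  qed
qed

lemma mean_osc_integral_le:
  assumes [measurable]: "u \<in> borel_measurable \<nu>" and r: "0 < r"
  shows "(\<integral>\<^sup>+ x. mean_osc u r x \<partial>\<nu>) \<le> ennreal Cd * (\<integral>\<^sup>+ x. osc u r x \<partial>\<nu>)"
  unfolding mean_osc_def using r by (intro nn_integral_avg_le) auto

text \<open>Integrals of \<open>tail_osc u n\<close> tend to zero with \<open>n\<close>; this takes the place of the absolute continuity of the
  energy measure.\<close>

definition tail_osc :: "('a \<Rightarrow> real) \<Rightarrow> nat \<Rightarrow> 'a \<Rightarrow> ennreal" where
  "tail_osc u n z = (\<Sum>j. ennreal ((R / 2 ^ (j + n)) powr (- (p * \<theta>))) * osc u (R / 2 ^ (j + n)) z)"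

lemma measurable_tail_osc[measurable]: "u \<in> borel_measurable \<nu> \<Longrightarrow> tail_osc u n \<in> borel_measurable \<nu>"
  unfolding tail_osc_def by measurable

lemma tail_osc_integral:
  assumes [measurable]: "u \<in> borel_measurable \<nu>"
  shows "(\<integral>\<^sup>+ z. tail_osc u n z \<partial>\<nu>) =
    (\<Sum>j. ennreal ((R / 2 ^ (j + n)) powr (- (p * \<theta>))) * (\<integral>\<^sup>+ z. osc u (R / 2 ^ (j + n)) z \<partial>\<nu>))"
  unfolding tail_osc_def by (simp add: nn_integral_suminf nn_integral_cmult)

text \<open>For a fixed pair at distance \<open>d\<close> only radii above \<open>d / 4\<close> see
  both points. The volumes of the balls are then at least \<open>V z d\<close>, and the negative
  powers of these radii sum geometrically to a multiple of \<open>d powr (- (p * \<theta>))\<close>;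
  this reproduces the kernel of the energy.\<close>

lemma tail_osc_0_le:
  assumes [measurable]: "u \<in> borel_measurable \<nu>"
  shows "(\<integral>\<^sup>+ z. tail_osc u 0 z \<partial>\<nu>) \<le> ennreal (4 powr (p * \<theta>) * geo_const (p * \<theta>)) * energy u"
proof -
  define c where "c j = (R / 2 ^ j) powr (- (p * \<theta>))" for j :: nat
  define a where "a = p * \<theta>"
  have a: "0 < a" using p_ge_1 theta by (simp add: a_def)
  define C where "C = 4 powr a * geo_const a"
  have C0: "0 \<le> C" using geo_const_ge_1[OF a] by (simp add: C_def)
  have sum: "(\<Sum>j. ennreal (c j) * ennreal (avg_ker (4 * (R / 2 ^ j)) z y))
     \<le> ennreal (C / (dist z y powr a * V z (dist z y)))" if zy: "z \<noteq> y" for z y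
  proof (rule suminf_le_const)
    fix n
    define d where "d = dist z y"
    have d: "0 < d" using zy by (simp add: d_def)
    define k where "k = 4 powr a / (d powr a * V z d)"
    have Vd: "0 < V z d" using d by (rule V_pos)
    have k0: "0 \<le> k" using Vd by (simp add: k_def)
    have "(\<Sum>j<n. c j * avg_ker (4 * (R / 2 ^ j)) z y)
        \<le> (\<Sum>j<n. k * (if d < 4 * R / 2 ^ j then (d / (4 * R / 2 ^ j)) powr a else 0))"
    proof (intro sum_mono)
      fix j
      show "c j * avg_ker (4 * (R / 2 ^ j)) z y \<le> k * (if d < 4 * R / 2 ^ j then (d / (4 * R / 2 ^ j)) powr a else 0)"
      proof (cases "d < 4 * R / 2 ^ j")
        case True
        define r where "r = R / 2 ^ j"
        have r: "0 < r" using R_pos by (simp add: r_def)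
        have "V z d \<le> V z (4 * r)" using True by (intro V_mono subset_ball) (simp add: r_def)
        then have "1 / V z (4 * r) \<le> 1 / V z d" using Vd by (simp add: frac_le)
        then have "c j * avg_ker (4 * r) z y \<le> c j * (1 / V z d)"
          using True by (intro mult_left_mono) (auto simp: avg_ker_def d_def r_def c_def)
        also have "\<dots> = k * (d / (4 * r)) powr a"
        proof -
          have "c j = 4 powr a / d powr a * (d / (4 * r)) powr a"
            using d r by (simp add: c_def a_def powr_divide powr_mult powr_minus r_def[symmetric] field_simps)
          then show ?thesis by (simp add: k_def)
        qed
        finally show ?thesis using True by (simp add: r_def)
      qed (simp add: avg_ker_def d_def)
    qed
    also have "\<dots> \<le> k * geo_const a"
      unfolding sum_distrib_left[symmetric] using R_pos d a k0 by (intro mult_left_mono dyadic_large_sum) auto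
    also have "\<dots> = C / (d powr a * V z d)" by (simp add: k_def C_def)
    finally show "(\<Sum>j<n. ennreal (c j) * ennreal (avg_ker (4 * (R / 2 ^ j)) z y)) \<le> ennreal (C / (dist z y powr a * V z (dist z y)))"
      by (simp add: c_def d_def ennreal_leI flip: ennreal_mult)
  qed simp
  have "(\<integral>\<^sup>+ z. tail_osc u 0 z \<partial>\<nu>) = (\<integral>\<^sup>+ z. \<integral>\<^sup>+ y. (\<Sum>j. ennreal (c j) * ennreal (avg_ker (4 * (R / 2 ^ j)) z y)) * ennreal (\<bar>u z - u y\<bar> powr p) \<partial>\<nu> \<partial>\<nu>)"
    unfolding tail_osc_def osc_def avg_def c_def
    by (simp add: ennreal_suminf_multc[symmetric] nn_integral_suminf mult.assoc nn_integral_cmult)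
  also have "\<dots> \<le> (\<integral>\<^sup>+ z. \<integral>\<^sup>+ y. ennreal C * ennreal (\<bar>u z - u y\<bar> powr p / (dist z y powr a * V z (dist z y))) \<partial>\<nu> \<partial>\<nu>)"
  proof (intro nn_integral_mono)
    fix z y
    show "(\<Sum>j. ennreal (c j) * ennreal (avg_ker (4 * (R / 2 ^ j)) z y)) * ennreal (\<bar>u z - u y\<bar> powr p)
      \<le> ennreal C * ennreal (\<bar>u z - u y\<bar> powr p / (dist z y powr a * V z (dist z y)))"
    proof (cases "z = y")
      case False
      have "(\<Sum>j. ennreal (c j) * ennreal (avg_ker (4 * (R / 2 ^ j)) z y)) * ennreal (\<bar>u z - u y\<bar> powr p)
        \<le> ennreal (C / (dist z y powr a * V z (dist z y))) * ennreal (\<bar>u z - u y\<bar> powr p)"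
        by (intro mult_right_mono sum False) simp
      also have "\<dots> = ennreal C * ennreal (\<bar>u z - u y\<bar> powr p / (dist z y powr a * V z (dist z y)))"
        using C0 by (simp flip: ennreal_mult)
      finally show ?thesis .
    qed simp
  qed
  also have "\<dots> = ennreal C * energy u"
    unfolding energy_eq a_def by (simp add: nn_integral_cmult)
  finally show ?thesis by (simp add: C_def a_def)
qed

section \<open>Capacity\<close>

definition besov_cost :: "('a \<Rightarrow> real) \<Rightarrow> ennreal" where
  "besov_cost u = energy u + (\<integral>\<^sup>+ x. ennreal (\<bar>u x\<bar> powr p) \<partial>\<nu>)"

lemma integrable_powr_iff:
  assumes [measurable]: "u \<in> borel_measurable \<nu>"
  shows "integrable \<nu> (\<lambda>x. \<bar>u x\<bar> powr q) \<longleftrightarrow> (\<integral>\<^sup>+ x. ennreal (\<bar>u x\<bar> powr q) \<partial>\<nu>) < \<infinity>"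
  by (simp add: integrable_iff_bounded)

lemma besov_space_iff: "u \<in> besov_space \<nu> \<theta> p \<longleftrightarrow> u \<in> borel_measurable \<nu> \<and> besov_cost u < \<infinity>"
  by (auto simp: besov_space_def Lp_space_def besov_cost_def integrable_powr_iff)

lemma integrable_of_Lp:
  assumes u: "u \<in> borel_measurable \<nu>" "(\<integral>\<^sup>+ x. ennreal (\<bar>u x\<bar> powr p) \<partial>\<nu>) < \<infinity>"
  shows "integrable \<nu> u"
proof (rule Bochner_Integration.integrable_bound)
  show "integrable \<nu> (\<lambda>x. 1 + \<bar>u x\<bar> powr p)"
    using integrable_powr_iff[OF u(1)] u(2) by simp
  have "\<bar>t\<bar> \<le> 1 + \<bar>t\<bar> powr p" for t :: real
  proof (cases "\<bar>t\<bar> \<le> 1")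
    case False
    then show ?thesis using powr_mono[of 1 p "\<bar>t\<bar>"] p_ge_1 by simp
  qed (simp add: add_increasing2)
  then show "AE x in \<nu>. norm (u x) \<le> norm (1 + \<bar>u x\<bar> powr p)"
    by (intro AE_I2) (metis abs_ge_self order_trans real_norm_def)
qed (rule u)

lemma integrable_besov: "u \<in> besov_space \<nu> \<theta> p \<Longrightarrow> integrable \<nu> u"
  by (rule integrable_of_Lp) (auto simp: besov_space_iff besov_cost_def)

text \<open>A test function of infinite cost gives a trivial bound, so applications only have to
  check measurability and the neighbourhood condition.\<close>

lemma cap_le:
  assumes u: "u \<in> borel_measurable \<nu>" and U: "open U" "E \<subseteq> U" "AE x in \<nu>. x \<in> U \<longrightarrow> 1 \<le> u x"
  shows "cap E \<le> besov_cost u"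
proof (cases "besov_cost u < \<infinity>")
  case True
  then have "u \<in> besov_space \<nu> \<theta> p" using u besov_space_iff by blast
  then show ?thesis unfolding besov_cap_def besov_cost_def using U by (intro INF_lower) blast
next
  case False
  then show ?thesis by (simp add: less_top[symmetric])
qed

lemma cap_mono: "E \<subseteq> F \<Longrightarrow> cap E \<le> cap F"
  unfolding besov_cap_def by (intro INF_superset_mono) auto

lemma powr_le_ennreal_imp:
  assumes "ennreal (\<bar>a\<bar> powr p) \<le> ennreal s" "0 \<le> s"
  shows "\<bar>a\<bar> \<le> s powr (1 / p)"
proof -
  have "(\<bar>a\<bar> powr p) powr (1 / p) \<le> s powr (1 / p)"
    using assms p_ge_1 by (intro powr_mono2) auto
  then show ?thesis using p_ge_1 by (simp add: powr_powr)
qed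

lemma powr_inverse_p: "0 \<le> s \<Longrightarrow> (s powr (1 / p)) powr p = s"
  using p_ge_1 by (simp add: powr_powr)

text \<open>The difference of two suprema is at most the supremum of the differences, so its
  \<open>p\<close>-th power is at most the sum of their \<open>p\<close>-th powers; the values are
  treated alike. The bounds 0 and 1 make the real suprema meaningful.\<close>

lemma besov_cost_sup_le:
  fixes u :: "nat \<Rightarrow> 'a \<Rightarrow> real"
  assumes [measurable]: "\<And>n. u n \<in> borel_measurable \<nu>" and bdd: "\<And>n x. 0 \<le> u n x" "\<And>n x. u n x \<le> 1"
  shows "besov_cost (\<lambda>x. SUP n. u n x) \<le> (\<Sum>n. besov_cost (u n))"
proof -
  define v where "v x = (SUP n. u n x)" for x
  have ba: "bdd_above (range (\<lambda>n. u n x))" for x using bdd by (intro bdd_aboveI[of _ 1]) auto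
  have uv: "u n x \<le> v x" for n x unfolding v_def by (intro cSUP_upper ba) auto
  have v0: "0 \<le> v x" for x using bdd(1) uv by (meson order_trans)
  have diff: "ennreal (\<bar>v x - v y\<bar> powr p) \<le> (\<Sum>n. ennreal (\<bar>u n x - u n y\<bar> powr p))" for x y
  proof (cases "(\<Sum>n. ennreal (\<bar>u n x - u n y\<bar> powr p))")
    case (real s)
    have n: "\<bar>u n x - u n y\<bar> \<le> s powr (1 / p)" for n
      using sum_le_suminf[of "\<lambda>n. ennreal (\<bar>u n x - u n y\<bar> powr p)" "{n}"] real
      by (intro powr_le_ennreal_imp) auto
    have "v x \<le> v y + s powr (1 / p)" unfolding v_def[of x]
    proof (intro cSUP_least)
      show "u i x \<le> v y + s powr (1 / p)" for i using n[of i] uv[of i y] by linarith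
    qed auto
    moreover have "v y \<le> v x + s powr (1 / p)" unfolding v_def[of y]
    proof (intro cSUP_least)
      show "u i y \<le> v x + s powr (1 / p)" for i using n[of i] uv[of i x] by linarith
    qed auto
    ultimately have "\<bar>v x - v y\<bar> powr p \<le> (s powr (1 / p)) powr p" using p_ge_1 by (intro powr_mono2) auto
    then show ?thesis using real by (simp add: powr_inverse_p ennreal_leI)
  qed simp
  have val: "ennreal (\<bar>v x\<bar> powr p) \<le> (\<Sum>n. ennreal (\<bar>u n x\<bar> powr p))" for x
  proof (cases "(\<Sum>n. ennreal (\<bar>u n x\<bar> powr p))")
    case (real s)
    have n: "\<bar>u n x\<bar> \<le> s powr (1 / p)" for n
      using sum_le_suminf[of "\<lambda>n. ennreal (\<bar>u n x\<bar> powr p)" "{n}"] real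
      by (intro powr_le_ennreal_imp) auto
    have "v x \<le> s powr (1 / p)" unfolding v_def[of x]
    proof (intro cSUP_least)
      show "u i x \<le> s powr (1 / p)" for i using n[of i] by linarith
    qed auto
    then have "\<bar>v x\<bar> powr p \<le> (s powr (1 / p)) powr p" using p_ge_1 v0 by (intro powr_mono2) auto
    then show ?thesis using real by (simp add: powr_inverse_p ennreal_leI)
  qed simp
  have "energy v \<le> (\<integral>\<^sup>+ x. \<integral>\<^sup>+ y. (\<Sum>n. ennreal (\<bar>u n x - u n y\<bar> powr p / (dist x y powr (p * \<theta>) * V x (dist x y)))) \<partial>\<nu> \<partial>\<nu>)"
    unfolding energy_eq
  proof (intro nn_integral_mono)
    fix x y
    define k where "k = 1 / (dist x y powr (p * \<theta>) * V x (dist x y))"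
    have "ennreal k * ennreal (\<bar>v x - v y\<bar> powr p) \<le> ennreal k * (\<Sum>n. ennreal (\<bar>u n x - u n y\<bar> powr p))"
      by (intro mult_left_mono diff) simp
    then show "ennreal (\<bar>v x - v y\<bar> powr p / (dist x y powr (p * \<theta>) * V x (dist x y)))
      \<le> (\<Sum>n. ennreal (\<bar>u n x - u n y\<bar> powr p / (dist x y powr (p * \<theta>) * V x (dist x y))))"
      by (simp add: k_def ennreal_suminf_cmult[symmetric] del: ennreal_suminf_cmult flip: ennreal_mult)
  qed
  also have "\<dots> = (\<Sum>n. energy (u n))"
    unfolding energy_eq by (simp add: nn_integral_suminf)
  finally have "energy v \<le> (\<Sum>n. energy (u n))" .
  moreover have "(\<integral>\<^sup>+ x. ennreal (\<bar>v x\<bar> powr p) \<partial>\<nu>) \<le> (\<Sum>n. \<integral>\<^sup>+ x. ennreal (\<bar>u n x\<bar> powr p) \<partial>\<nu>)"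
    by (subst nn_integral_suminf[symmetric]) (auto intro!: nn_integral_mono val)
  ultimately show ?thesis
    unfolding besov_cost_def v_def[abs_def] by (subst suminf_add[symmetric]) (auto intro: add_mono)
qed

lemma abs_clip_diff_le: "\<bar>max 0 (min 1 a) - max 0 (min 1 b)\<bar> \<le> \<bar>a - b\<bar>" for a b :: real
  by (auto simp: max_def min_def)

lemma besov_cost_clip_le: "besov_cost (\<lambda>x. max 0 (min 1 (u x))) \<le> besov_cost u"
  unfolding besov_cost_def energy_eq using p_ge_1
  by (intro add_mono nn_integral_mono ennreal_leI divide_right_mono powr_mono2 abs_clip_diff_le) (auto simp: max_def min_def)

text \<open>The supremum of near-optimal test functions is admissible for the union. Clipping them
  to the unit interval first does not raise the cost and keeps the supremum bounded; the errors
  \<open>e * (1 / 2) ^ Suc n\<close> add up to \<open>e\<close>.\<close>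

lemma cap_countable_subadditive:
  "cap (\<Union>n. E n) \<le> (\<Sum>n. cap (E n))" for E :: "nat \<Rightarrow> 'a set"
proof (rule ennreal_le_epsilon)
  fix e :: real assume fin: "(\<Sum>n. cap (E n)) < top" and e: "0 < e"
  have capn: "cap (E n) < top" for n
    using sum_le_suminf[of "\<lambda>n. cap (E n)" "{n}"] fin by (auto intro: le_less_trans)
  have "\<exists>u U. u \<in> borel_measurable \<nu> \<and> open U \<and> E n \<subseteq> U \<and> (AE x in \<nu>. x \<in> U \<longrightarrow> 1 \<le> u x) \<and>
      besov_cost u \<le> cap (E n) + ennreal (e * (1 / 2) ^ Suc n)" for n
  proof -
    have "\<exists>u\<in>{u \<in> besov_space \<nu> \<theta> p. \<exists>U. open U \<and> E n \<subseteq> U \<and> (AE x in \<nu>. x \<in> U \<longrightarrow> u x \<ge> 1)}.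
        energy u + (\<integral>\<^sup>+ x. ennreal (\<bar>u x\<bar> powr p) \<partial>\<nu>)
          < cap (E n) + ennreal (e * (1 / 2) ^ Suc n)"
    proof (rule INF_approx_ennreal)
      show "0 < e * (1 / 2) ^ Suc n" using e by simp
      show "cap (E n) \<noteq> \<infinity>" using capn[of n] by auto
    qed (simp add: besov_cap_def)
    then obtain u U where "u \<in> besov_space \<nu> \<theta> p" "open U" "E n \<subseteq> U" "AE x in \<nu>. x \<in> U \<longrightarrow> u x \<ge> 1"
      "besov_cost u < cap (E n) + ennreal (e * (1 / 2) ^ Suc n)"
      unfolding besov_cost_def by blast
    then show ?thesis unfolding besov_space_iff
      by (intro exI[of _ u] exI[of _ U]) (simp add: less_imp_le)
  qed
  then have "\<forall>n. \<exists>u U. u \<in> borel_measurable \<nu> \<and> open U \<and> E n \<subseteq> U \<and> (AE x in \<nu>. x \<in> U \<longrightarrow> 1 \<le> u x) \<and>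
      besov_cost u \<le> cap (E n) + ennreal (e * (1 / 2) ^ Suc n)" by blast
  from choice[OF this] obtain u where "\<forall>n. \<exists>U. u n \<in> borel_measurable \<nu> \<and> open U \<and> E n \<subseteq> U \<and>
      (AE x in \<nu>. x \<in> U \<longrightarrow> 1 \<le> u n x) \<and>
      besov_cost (u n) \<le> cap (E n) + ennreal (e * (1 / 2) ^ Suc n)" by blast
  from choice[OF this] obtain U where u[measurable]: "\<And>n. u n \<in> borel_measurable \<nu>" and U: "\<And>n. open (U n)" "\<And>n. E n \<subseteq> U n"
    and ae: "\<And>n. AE x in \<nu>. x \<in> U n \<longrightarrow> 1 \<le> u n x"
    and cost: "\<And>n. besov_cost (u n) \<le> cap (E n) + ennreal (e * (1 / 2) ^ Suc n)" by blast
  define w where "w n x = max 0 (min 1 (u n x))" for n x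
  have [measurable]: "w n \<in> borel_measurable \<nu>" for n unfolding w_def by measurable
  have w: "0 \<le> w n x" "w n x \<le> 1" for n x by (auto simp: w_def)
  have ba: "bdd_above (range (\<lambda>n. w n x))" for x using w by (intro bdd_aboveI[of _ 1]) auto
  have "cap (\<Union>n. E n) \<le> besov_cost (\<lambda>x. SUP n. w n x)"
  proof (rule cap_le[of _ "\<Union>n. U n"])
    show "(\<lambda>x. SUP n. w n x) \<in> borel_measurable \<nu>" using ba by (intro borel_measurable_cSUP) auto
    have "AE x in \<nu>. \<forall>n. x \<in> U n \<longrightarrow> 1 \<le> u n x" using ae by (simp add: AE_all_countable)
    then show "AE x in \<nu>. x \<in> (\<Union>n. U n) \<longrightarrow> 1 \<le> (SUP n. w n x)"
    proof (rule eventually_mono, intro impI)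
      fix x assume "\<forall>n. x \<in> U n \<longrightarrow> 1 \<le> u n x" "x \<in> (\<Union>n. U n)"
      then obtain n where "1 \<le> u n x" by blast
      then have "1 \<le> w n x" by (simp add: w_def)
      also have "w n x \<le> (SUP n. w n x)" by (intro cSUP_upper ba) auto
      finally show "1 \<le> (SUP n. w n x)" .
    qed
  qed (use U in auto)
  also have "\<dots> \<le> (\<Sum>n. besov_cost (w n))" by (intro besov_cost_sup_le w) auto
  also have "\<dots> \<le> (\<Sum>n. cap (E n) + ennreal (e * (1 / 2) ^ Suc n))"
    using besov_cost_clip_le cost unfolding w_def by (intro suminf_le) (auto intro: order_trans)
  also have "\<dots> = (\<Sum>n. cap (E n)) + (\<Sum>n. ennreal (e * (1 / 2) ^ Suc n))"
    by (subst suminf_add[symmetric]) auto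
  also have "(\<Sum>n. ennreal (e * (1 / 2) ^ Suc n)) = ennreal e"
    using e sums_mult[OF power_half_series, of e] by (intro suminf_ennreal_eq) auto
  finally show "cap (\<Union>n. E n) \<le> (\<Sum>n. cap (E n)) + ennreal e" .
qed

text \<open>The second summand absorbs the \<open>L^p\<close> part of the cost, which carries no
  negative power of the radius, and this is where \<open>r \<le> 16 * R\<close> is used. The bound
  \<open>16 * R\<close> leaves room for enlarged balls of radius \<open>8 * rad n\<close>.\<close>

definition cap_ball_const :: real where
  "cap_ball_const = Cd * (series_const + (16 * R) powr (p * \<theta>))"

lemma cap_ball_const_pos: "0 < cap_ball_const"
  using Cd_pos series_const_pos by (simp add: cap_ball_const_def add_pos_nonneg)

text \<open>The test function is a cutoff of slope \<open>1 / r\<close>, equal to 1 on the ball and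
  to 0 off its double; it lives at the single scale \<open>r\<close>.\<close>

lemma cap_ball_le:
  assumes r: "0 < r" "r \<le> 16 * R"
  shows "cap (ball x r) \<le> ennreal (cap_ball_const * V x r * r powr (- (p * \<theta>)))"
proof -
  define f where "f y = max 0 (min 1 (2 - dist x y / r))" for y
  define H :: "'a \<Rightarrow> ennreal" where "H = indicator (ball x (2 * r))"
  have [measurable]: "f \<in> borel_measurable \<nu>" unfolding f_def by measurable
  have [measurable]: "H \<in> borel_measurable \<nu>" unfolding H_def by measurable
  have f0: "f y = 0" if "y \<notin> ball x (2 * r)" for y using that r by (simp add: f_def field_simps)
  have fd: "\<bar>f y - f z\<bar> \<le> min 1 (dist y z / r)" for y z
  proof -
    have "\<bar>f y - f z\<bar> \<le> \<bar>(2 - dist x y / r) - (2 - dist x z / r)\<bar>" unfolding f_def by (rule abs_clip_diff_le)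
    also have "\<dots> = \<bar>dist x z - dist x y\<bar> / r" using r by (simp add: diff_divide_distrib[symmetric])
    also have "\<dots> \<le> dist y z / r"
      using r dist_triangle[of x z y] dist_triangle[of x y z] by (intro divide_right_mono) (auto simp: dist_commute abs_le_iff)
    finally have "\<bar>f y - f z\<bar> \<le> dist y z / r" .
    moreover have "0 \<le> f t \<and> f t \<le> 1" for t by (simp add: f_def)
    then have "\<bar>f y - f z\<bar> \<le> 1" by (smt (verit))
    ultimately show ?thesis by simp
  qed
  have intH: "(\<integral>\<^sup>+ y. H y \<partial>\<nu>) \<le> ennreal (Cd * V x r)"
    using V_double[of x r] by (simp add: H_def emeasure_ball ennreal_leI)
  have "energy f \<le> ennreal (series_const * r powr (- (p * \<theta>))) * (\<integral>\<^sup>+ y. H y \<partial>\<nu>)"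
  proof (rule energy_single_scale_le[OF r(1)])
    fix y z :: 'a assume "y \<noteq> z"
    show "ennreal (\<bar>f y - f z\<bar> powr p) \<le> ennreal (min 1 ((dist y z / r) powr p)) * (H y + H z)"
    proof (cases "y \<in> ball x (2 * r) \<or> z \<in> ball x (2 * r)")
      case True
      then have H1: "1 \<le> H y + H z" by (auto simp: H_def indicator_def)
      have "\<bar>f y - f z\<bar> powr p \<le> min 1 ((dist y z / r) powr p)"
        using fd[of y z] p_ge_1 r by (auto intro: powr_le1 powr_mono2)
      then have "ennreal (\<bar>f y - f z\<bar> powr p) \<le> ennreal (min 1 ((dist y z / r) powr p)) * 1" by (simp only: ennreal_leI mult_1_right)
      also have "\<dots> \<le> ennreal (min 1 ((dist y z / r) powr p)) * (H y + H z)" by (intro mult_left_mono H1) simp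
      finally show ?thesis .
    next
      case False
      then show ?thesis by (simp add: f0)
    qed
  qed measurable
  also have "\<dots> \<le> ennreal (series_const * r powr (- (p * \<theta>))) * ennreal (Cd * V x r)"
    by (intro mult_left_mono intH) simp
  also have "\<dots> = ennreal (Cd * series_const * V x r * r powr (- (p * \<theta>)))"
    using series_const_pos Cd_pos by (simp add: mult_ac flip: ennreal_mult)
  finally have 1: "energy f \<le> ennreal (Cd * series_const * V x r * r powr (- (p * \<theta>)))" .
  have "(\<integral>\<^sup>+ y. ennreal (\<bar>f y\<bar> powr p) \<partial>\<nu>) \<le> (\<integral>\<^sup>+ y. H y \<partial>\<nu>)"
  proof (intro nn_integral_mono)
    fix y show "ennreal (\<bar>f y\<bar> powr p) \<le> H y"
    proof (cases "y \<in> ball x (2 * r)")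
      case True
      have "\<bar>f y\<bar> powr p \<le> 1" using p_ge_1 by (intro powr_le1) (auto simp: f_def)
      then show ?thesis using True by (simp add: H_def)
    qed (simp add: f0)
  qed
  also have "\<dots> \<le> ennreal (Cd * V x r * ((16 * R) powr (p * \<theta>) * r powr (- (p * \<theta>))))"
  proof (rule order_trans[OF intH ennreal_leI])
    have "r powr (p * \<theta>) \<le> (16 * R) powr (p * \<theta>)" using r p_ge_1 theta by (intro powr_mono2) auto
    then have "1 \<le> (16 * R) powr (p * \<theta>) * r powr (- (p * \<theta>))" using r by (simp add: powr_minus field_simps)
    then show "Cd * V x r \<le> Cd * V x r * ((16 * R) powr (p * \<theta>) * r powr (- (p * \<theta>)))"
      using Cd_pos mult_left_mono[of 1 _ "Cd * V x r"] by simp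
  qed
  finally have 2: "(\<integral>\<^sup>+ y. ennreal (\<bar>f y\<bar> powr p) \<partial>\<nu>) \<le> ennreal (Cd * V x r * ((16 * R) powr (p * \<theta>) * r powr (- (p * \<theta>))))" .
  have "cap (ball x r) \<le> besov_cost f"
    using r by (intro cap_le[of f "ball x r"] AE_I2) (auto simp: f_def)
  also have "\<dots> \<le> ennreal (Cd * series_const * V x r * r powr (- (p * \<theta>))) + ennreal (Cd * V x r * ((16 * R) powr (p * \<theta>) * r powr (- (p * \<theta>))))"
    unfolding besov_cost_def by (intro add_mono 1 2)
  also have "\<dots> = ennreal (cap_ball_const * V x r * r powr (- (p * \<theta>)))"
    using Cd_pos series_const_pos by (simp add: cap_ball_const_def algebra_simps flip: ennreal_plus)
  finally show ?thesis .
qed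

text \<open>All distances are below \<open>R\<close>, so at the scale \<open>R\<close> the minimum
  in \<open>energy_single_scale_le\<close> is the power of the distance itself, and \<open>H\<close>
  may be a constant.\<close>

lemma lipschitz_in_besov_space:
  assumes v: "L-lipschitz_on UNIV v"
  shows "v \<in> besov_space \<nu> \<theta> p"
proof -
  have L: "0 \<le> L" using v by (rule lipschitz_on_nonneg)
  have lip: "\<bar>v x - v y\<bar> \<le> L * dist x y" for x y using lipschitz_onD[OF v, of x y] by (simp add: dist_real_def)
  have [measurable]: "v \<in> borel_measurable \<nu>"
    using v by (intro borel_measurable_borelI borel_measurable_continuous_onI lipschitz_on_continuous_on)
  have "energy v \<le> ennreal (series_const * R powr (- (p * \<theta>))) * (\<integral>\<^sup>+ x. ennreal ((L * R) powr p) \<partial>\<nu>)"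
  proof (rule energy_single_scale_le[OF R_pos])
    fix x y :: 'a assume "x \<noteq> y"
    have q: "dist x y / R \<le> 1" using dist_less_R[of x y] R_pos by simp
    have "\<bar>v x - v y\<bar> powr p \<le> (L * R * (dist x y / R)) powr p"
      using lip[of x y] R_pos p_ge_1 by (intro powr_mono2) auto
    also have "\<dots> = (L * R) powr p * (dist x y / R) powr p" using L R_pos by (intro powr_mult)
    also have "(dist x y / R) powr p = min 1 ((dist x y / R) powr p)"
      using q R_pos p_ge_1 by (simp add: powr_le1)
    finally have "\<bar>v x - v y\<bar> powr p \<le> min 1 ((dist x y / R) powr p) * (L * R) powr p" by (simp add: mult.commute)
    then have "ennreal (\<bar>v x - v y\<bar> powr p) \<le> ennreal (min 1 ((dist x y / R) powr p)) * ennreal ((L * R) powr p)"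
      by (simp add: ennreal_leI flip: ennreal_mult)
    also have "\<dots> \<le> ennreal (min 1 ((dist x y / R) powr p)) * (ennreal ((L * R) powr p) + ennreal ((L * R) powr p))"
      by (intro mult_left_mono) auto
    finally show "ennreal (\<bar>v x - v y\<bar> powr p) \<le> ennreal (min 1 ((dist x y / R) powr p)) * (ennreal ((L * R) powr p) + ennreal ((L * R) powr p))" .
  qed measurable
  also have "\<dots> < \<infinity>" by (simp add: ennreal_mult_less_top emeasure_eq_measure)
  finally have 1: "energy v < \<infinity>" .
  define B where "B = \<bar>v undefined\<bar> + L * R"
  have "\<bar>v x\<bar> \<le> B" for x
    using lip[of x undefined] mult_left_mono[OF less_imp_le[OF dist_less_R[of x undefined]] L] by (simp add: B_def)
  then have "(\<integral>\<^sup>+ x. ennreal (\<bar>v x\<bar> powr p) \<partial>\<nu>) \<le> (\<integral>\<^sup>+ x. ennreal (B powr p) \<partial>\<nu>)"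
    using p_ge_1 by (intro nn_integral_mono ennreal_leI powr_mono2) auto
  also have "\<dots> < \<infinity>" by (simp add: ennreal_mult_less_top emeasure_eq_measure)
  finally show ?thesis using 1 by (simp add: besov_space_iff besov_cost_def)
qed

end

section \<open>Convergence of the averages\<close>

lemma telescope_le_suminf:
  fixes X :: "nat \<Rightarrow> real"
  assumes "X \<longlonglongrightarrow> l"
  shows "ennreal \<bar>l - X n\<bar> \<le> (\<Sum>j. ennreal \<bar>X (Suc (j + n)) - X (j + n)\<bar>)"
proof (cases "(\<Sum>j. ennreal \<bar>X (Suc (j + n)) - X (j + n)\<bar>)")
  case (real s)
  have le: "\<bar>X (m + n) - X n\<bar> \<le> s" for m
  proof -
    have "X (m + n) - X n = (\<Sum>j<m. X (Suc (j + n)) - X (j + n))"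
      using sum_lessThan_telescope[of "\<lambda>j. X (j + n)" m] by simp
    also have "\<bar>\<dots>\<bar> \<le> (\<Sum>j<m. \<bar>X (Suc (j + n)) - X (j + n)\<bar>)" by (rule sum_abs)
    finally have "ennreal \<bar>X (m + n) - X n\<bar> \<le> (\<Sum>j<m. ennreal \<bar>X (Suc (j + n)) - X (j + n)\<bar>)"
      by (simp add: ennreal_leI)
    also have "\<dots> \<le> (\<Sum>j. ennreal \<bar>X (Suc (j + n)) - X (j + n)\<bar>)" by (intro sum_le_suminf) auto
    finally show ?thesis using real by simp
  qed
  have "(\<lambda>m. \<bar>X (m + n) - X n\<bar>) \<longlonglongrightarrow> \<bar>l - X n\<bar>"
    by (intro tendsto_intros LIMSEQ_ignore_initial_segment assms)
  then have "\<bar>l - X n\<bar> \<le> s" using le by (intro LIMSEQ_le_const2) auto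
  then show ?thesis using real by (simp add: ennreal_leI)
qed simp

lemma convergent_of_summable_increments:
  fixes X :: "nat \<Rightarrow> real"
  assumes "(\<Sum>j. ennreal \<bar>X (Suc (j + n)) - X (j + n)\<bar>) < \<infinity>"
  shows "convergent X"
proof -
  have "summable (\<lambda>j. \<bar>X (Suc (j + n)) - X (j + n)\<bar>)"
    using assms by (intro summable_suminf_not_top) auto
  then have "summable (\<lambda>j. X (Suc (j + n)) - X (j + n))" by (rule summable_rabs_cancel)
  then have "convergent (\<lambda>m. \<Sum>j<m. X (Suc (j + n)) - X (j + n))" by (simp add: summable_iff_convergent)
  then have "convergent (\<lambda>m. X (m + n) - X n)"
    using sum_lessThan_telescope[of "\<lambda>j. X (j + n)"] by simp
  then have "convergent (\<lambda>m. X (m + n))"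
    using convergent_add[OF _ convergent_const[of "X n"], of "\<lambda>m. X (m + n) - X n"] by simp
  then show ?thesis by (simp add: convergent_ignore_initial_segment)
qed

lemma suminf_ennreal_tail_tendsto_0:
  fixes f :: "nat \<Rightarrow> ennreal"
  assumes fin: "(\<Sum>j. f j) < \<infinity>"
  shows "(\<lambda>n. \<Sum>j. f (j + n)) \<longlonglongrightarrow> 0"
proof -
  have ftop: "f j \<noteq> top" for j
    using sum_le_suminf[of f "{j}"] fin by (auto simp: top_unique)
  define g where "g j = enn2real (f j)" for j
  have fg: "f j = ennreal (g j)" for j using ftop[of j] by (simp add: g_def less_top)
  have g0: "0 \<le> g j" for j by (simp add: g_def)
  have sg: "summable g" using fin fg g0 by (intro summable_suminf_not_top) auto
  have "(\<lambda>n. \<Sum>j. g (j + n)) \<longlonglongrightarrow> 0"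
    using suminf_exist_split[OF _ sg] by (intro LIMSEQ_I) simp
  then have "(\<lambda>n. ennreal (\<Sum>j. g (j + n))) \<longlonglongrightarrow> ennreal 0" by (rule tendsto_ennrealI)
  moreover have "(\<Sum>j. f (j + n)) = ennreal (\<Sum>j. g (j + n))" for n
    unfolding fg using g0 sg by (intro suminf_ennreal2 summable_ignore_initial_segment) auto
  ultimately show ?thesis by simp
qed

lemma suminf_ennreal_tail_mono:
  fixes f :: "nat \<Rightarrow> ennreal"
  assumes "n \<le> m"
  shows "(\<Sum>j. f (j + m)) \<le> (\<Sum>j. f (j + n))"
proof (rule suminf_le_const)
  fix k
  have "(\<Sum>j<k. f (j + m)) = (\<Sum>j\<in>(\<lambda>j. j + (m - n)) ` {..<k}. f (j + n))"
    using assms by (subst sum.reindex) (auto simp: inj_on_def)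
  also have "\<dots> \<le> (\<Sum>j. f (j + n))" by (intro sum_le_suminf) auto
  finally show "(\<Sum>j<k. f (j + m)) \<le> (\<Sum>j. f (j + n))" .
qed simp

lemma ennreal_enn2real_min_1: "ennreal (enn2real (min 1 X)) = min 1 X"
proof -
  have "min 1 X < top" by (rule le_less_trans[of _ 1]) auto
  then show ?thesis by simp
qed

text \<open>Truncation at 1 is 1-Lipschitz. The hypotheses are sums because \<open>A\<close> and
  \<open>B\<close> may both be infinite, where a difference says nothing.\<close>

lemma enn2real_min_1_diff_le:
  assumes "A \<le> B + S" "B \<le> A + S"
  shows "ennreal \<bar>enn2real (min 1 A) - enn2real (min 1 B)\<bar> \<le> S"
proof (cases S)
  case (real s)
  have *: "min 1 X \<le> min 1 Y + ennreal s" if "X \<le> Y + ennreal s" for X Y :: ennreal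
  proof (cases "Y \<le> 1")
    case True
    then have "min 1 Y = Y" by (rule min_absorb2)
    then show ?thesis using that by (metis min.coboundedI2)
  next
    case False
    then have "min 1 Y = 1" by (intro min_absorb1) simp
    then show ?thesis by (metis add_increasing2 min.cobounded1 order_trans zero_le order_refl)
  qed
  have "enn2real (min 1 X) \<le> enn2real (min 1 Y) + s" if "X \<le> Y + ennreal s" for X Y
  proof -
    have "ennreal (enn2real (min 1 X)) \<le> ennreal (enn2real (min 1 Y)) + ennreal s"
      unfolding ennreal_enn2real_min_1 using that by (rule *)
    then show ?thesis using real by (simp flip: ennreal_plus)
  qed
  from this[of A B] this[of B A]
  have "enn2real (min 1 A) \<le> enn2real (min 1 B) + s" "enn2real (min 1 B) \<le> enn2real (min 1 A) + s"
    using assms real by auto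
  then show ?thesis using real by (simp add: ennreal_leI abs_le_iff)
qed simp

locale besov_function = besov_setting \<nu> Cd p \<theta>
  for \<nu> :: "'a::metric_space measure" and Cd p \<theta> +
  fixes u :: "'a \<Rightarrow> real"
  assumes u_besov: "u \<in> besov_space \<nu> \<theta> p"
begin

lemma integrable_u: "integrable \<nu> u"
  using u_besov by (rule integrable_besov)

lemma measurable_u[measurable]: "u \<in> borel_measurable \<nu>"
  using integrable_u by simp

definition rad :: "nat \<Rightarrow> real" where "rad n = R / 2 ^ n"

lemma rad_pos: "0 < rad n" using R_pos by (simp add: rad_def)
lemma rad_0: "rad 0 = R" by (simp add: rad_def)
lemma rad_Suc: "rad (Suc n) = rad n / 2" by (simp add: rad_def)
lemma rad_add: "rad (j + n) = rad n / 2 ^ j" by (simp add: rad_def power_add)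
lemma rad_mono: "m \<le> n \<Longrightarrow> rad n \<le> rad m"
  using R_pos by (auto simp: rad_def intro!: divide_left_mono power_increasing)
lemma rad_le_R: "rad n \<le> R" using rad_mono[of 0 n] by (simp add: rad_0)

lemma rad_tendsto_0: "rad \<longlonglongrightarrow> 0"
proof -
  have "(\<lambda>n. R * (1 / 2) ^ n) \<longlonglongrightarrow> R * 0" by (intro tendsto_mult tendsto_const LIMSEQ_power_zero) simp
  then show ?thesis by (simp add: rad_def[abs_def] power_divide)
qed

definition approx :: "nat \<Rightarrow> 'a \<Rightarrow> real" where "approx n = smooth (rad n) u"

lemma lipschitz_approx: "\<exists>L. L-lipschitz_on UNIV (approx n)"
  unfolding approx_def by (intro lipschitz_smooth rad_pos integrable_u)

lemma continuous_approx: "continuous_on UNIV (approx n)"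
  unfolding approx_def by (intro continuous_smooth rad_pos integrable_u)

lemma measurable_approx[measurable]: "approx n \<in> borel_measurable \<nu>"
  unfolding approx_def by (intro measurable_smooth rad_pos integrable_u)

definition incr :: "nat \<Rightarrow> 'a \<Rightarrow> real" where "incr n x = approx (Suc n) x - approx n x"

lemma incr_eq_step: "incr n = step u (rad n)"
  by (simp add: incr_def step_def approx_def rad_Suc fun_eq_iff)

lemma measurable_incr[measurable]: "incr n \<in> borel_measurable \<nu>"
  unfolding incr_def by measurable

definition tail :: "nat \<Rightarrow> ennreal" where "tail n = (\<integral>\<^sup>+ z. tail_osc u n z \<partial>\<nu>)"

lemma tail_eq: "tail n = (\<Sum>j. ennreal (rad (j + n) powr (- (p * \<theta>))) * (\<integral>\<^sup>+ z. osc u (rad (j + n)) z \<partial>\<nu>))"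
  unfolding tail_def rad_def by (rule tail_osc_integral) measurable

lemma tail_0_finite: "tail 0 < \<infinity>"
proof -
  have "tail 0 \<le> ennreal (4 powr (p * \<theta>) * geo_const (p * \<theta>)) * energy u"
    unfolding tail_def by (rule tail_osc_0_le) measurable
  also have "\<dots> < \<infinity>" using u_besov by (simp add: ennreal_mult_less_top besov_space_def)
  finally show ?thesis .
qed

lemma tail_tendsto_0: "tail \<longlonglongrightarrow> 0"
  unfolding tail_eq[abs_def] using tail_0_finite[unfolded tail_eq]
    suminf_ennreal_tail_tendsto_0[of "\<lambda>j. ennreal (rad j powr (- (p * \<theta>))) * (\<integral>\<^sup>+ z. osc u (rad j) z \<partial>\<nu>)"]
  by simp

lemma tail_osc_mono: "n \<le> m \<Longrightarrow> tail_osc u m z \<le> tail_osc u n z"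
  unfolding tail_osc_def
  by (rule suminf_ennreal_tail_mono[of n m "\<lambda>j. ennreal ((R / 2 ^ j) powr (- (p * \<theta>))) * osc u (R / 2 ^ j) z"])

lemma osc_le_tail:
  assumes "n \<le> j"
  shows "osc u (rad j) z \<le> ennreal (rad j powr (p * \<theta>)) * tail_osc u n z"
proof -
  have "ennreal (rad j powr (- (p * \<theta>))) * osc u (rad j) z \<le> tail_osc u n z"
    unfolding tail_osc_def rad_def[symmetric] using assms
      sum_le_suminf[of "\<lambda>j. ennreal (rad (j + n) powr (- (p * \<theta>))) * osc u (rad (j + n)) z" "{j - n}"] by simp
  then have "ennreal (rad j powr (p * \<theta>)) * (ennreal (rad j powr (- (p * \<theta>))) * osc u (rad j) z)
      \<le> ennreal (rad j powr (p * \<theta>)) * tail_osc u n z" by (intro mult_left_mono) auto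
  moreover have "rad j powr (p * \<theta>) * rad j powr (- (p * \<theta>)) = 1" using rad_pos[of j] by (simp flip: powr_add)
  ultimately show ?thesis by (simp add: ennreal_mult_assoc)
qed

lemma approx_error:
  assumes "n \<le> j"
  shows "ennreal (\<bar>u z - approx j z\<bar> powr p) \<le> ennreal (osc_const powr p * rad j powr (p * \<theta>)) * tail_osc u n z"
proof -
  have "ennreal (\<bar>u z - approx j z\<bar> powr p) \<le> ennreal (osc_const powr p) * osc u (rad j) z"
    unfolding approx_def using rad_pos by (intro osc_bound integrable_u) auto
  also have "\<dots> \<le> ennreal (osc_const powr p) * (ennreal (rad j powr (p * \<theta>)) * tail_osc u n z)"
    by (intro mult_left_mono osc_le_tail assms) auto
  finally show ?thesis by (simp add: ennreal_mult_assoc)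
qed

text \<open>Where \<open>tail_osc u 0\<close> is finite, hence almost everywhere,
  \<open>approx_error\<close> gives convergence at the rate
  \<open>rad j powr \<theta>\<close>.\<close>

lemma approx_tendsto: "AE z in \<nu>. (\<lambda>j. approx j z) \<longlonglongrightarrow> u z"
proof -
  have "AE z in \<nu>. tail_osc u 0 z \<noteq> \<infinity>"
    using tail_0_finite by (intro nn_integral_PInf_AE) (auto simp: tail_def)
  then show ?thesis
  proof (rule eventually_mono)
    fix z assume "tail_osc u 0 z \<noteq> \<infinity>"
    then obtain t where t: "tail_osc u 0 z = ennreal t" "0 \<le> t" by (cases "tail_osc u 0 z") auto
    define b where "b j = (osc_const powr p * rad j powr (p * \<theta>) * t) powr (1 / p)" for j
    have le: "\<bar>u z - approx j z\<bar> \<le> b j" for j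
      unfolding b_def using approx_error[of 0 j z] t by (intro powr_le_ennreal_imp) (auto simp flip: ennreal_mult)
    have b: "b \<longlonglongrightarrow> 0"
    proof -
      have "(\<lambda>j. rad j powr (p * \<theta>)) \<longlonglongrightarrow> 0"
        using rad_tendsto_0 p_ge_1 theta less_imp_le[OF rad_pos]
        by (intro tendsto_zero_powrI[OF _ tendsto_const[of "p * \<theta>"]]) auto
      then have "(\<lambda>j. osc_const powr p * rad j powr (p * \<theta>) * t) \<longlonglongrightarrow> osc_const powr p * 0 * t"
        by (intro tendsto_intros)
      then show ?thesis unfolding b_def[abs_def] using p_ge_1 t by (intro tendsto_zero_powrI[OF _ tendsto_const[of "1 / p"]]) auto
    qed
    have "(\<lambda>j. u z - approx j z) \<longlonglongrightarrow> 0"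
    proof (rule Lim_null_comparison[OF always_eventually b], rule allI)
      show "norm (u z - approx j z) \<le> b j" for j using le[of j] by simp
    qed
    then have "(\<lambda>j. u z - (u z - approx j z)) \<longlonglongrightarrow> u z - 0" by (intro tendsto_intros)
    then show "(\<lambda>j. approx j z) \<longlonglongrightarrow> u z" by simp
  qed
qed

lemma mean_osc_tail_le:
  "(\<Sum>j. ennreal (rad (j + n) powr (- (p * \<theta>))) * (\<integral>\<^sup>+ z. mean_osc u (rad (j + n)) z \<partial>\<nu>)) \<le> ennreal Cd * tail n"
proof -
  have "(\<Sum>j. ennreal (rad (j + n) powr (- (p * \<theta>))) * (\<integral>\<^sup>+ z. mean_osc u (rad (j + n)) z \<partial>\<nu>))
    \<le> (\<Sum>j. ennreal Cd * (ennreal (rad (j + n) powr (- (p * \<theta>))) * (\<integral>\<^sup>+ z. osc u (rad (j + n)) z \<partial>\<nu>)))"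
    unfolding mult.left_commute[of "ennreal Cd"]
    using rad_pos by (intro suminf_le mult_left_mono mean_osc_integral_le) auto
  then show ?thesis by (simp add: tail_eq)
qed

text \<open>A pointwise majorant of the distance from \<open>approx n\<close> to the limit; as a
  series of nonnegative continuous functions it is lower semicontinuous.\<close>

definition Phi :: "nat \<Rightarrow> 'a \<Rightarrow> ennreal" where
  "Phi n x = (\<Sum>j. ennreal \<bar>incr (j + n) x\<bar>)"

lemma measurable_Phi[measurable]: "Phi n \<in> borel_measurable \<nu>"
  unfolding Phi_def by measurable

lemma Phi_mono: "n \<le> m \<Longrightarrow> Phi m x \<le> Phi n x"
  unfolding Phi_def by (rule suminf_ennreal_tail_mono[of n m "\<lambda>j. ennreal \<bar>incr j x\<bar>"])

text \<open>\<open>step_diff_bound\<close> inserted into \<open>energy_series_le\<close> with first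
  radius \<open>rad n\<close>. The factor \<open>c\<close> is 1 for the approximation error and
  \<open>1 / l\<close> for the test function in the capacity estimate.\<close>

lemma energy_tail_le:
  assumes c: "0 \<le> c"
    and f: "AE x in \<nu>. AE y in \<nu>. x \<noteq> y \<longrightarrow> ennreal \<bar>f x - f y\<bar> \<le> (\<Sum>j. ennreal (c * \<bar>incr (j + n) x - incr (j + n) y\<bar>))"
  shows "energy f \<le> ennreal (series_const * c powr p * step_const * Cd) * tail n"
proof -
  define H where "H j x = ennreal (c powr p * step_const) * mean_osc u (rad (j + n)) x" for j x
  have [measurable]: "H j \<in> borel_measurable \<nu>" for j unfolding H_def by measurable
  have "energy f \<le> ennreal series_const *
      (\<Sum>j. ennreal ((rad n / 2 ^ j) powr (- (p * \<theta>))) * (\<integral>\<^sup>+ x. H j x \<partial>\<nu>))"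
  proof (rule energy_series_le[OF rad_pos])
    fix j and x y :: 'a assume xy: "x \<noteq> y"
    define m where "m = min 1 ((dist x y / rad (j + n)) powr p)"
    define X Y where "X = mean_osc u (rad (j + n)) x" and "Y = mean_osc u (rad (j + n)) y"
    have "ennreal ((c * \<bar>incr (j + n) x - incr (j + n) y\<bar>) powr p)
        = ennreal (c powr p) * ennreal (\<bar>incr (j + n) x - incr (j + n) y\<bar> powr p)"
      using c by (simp add: powr_mult ennreal_mult)
    also have "\<dots> \<le> ennreal (c powr p) * (ennreal m * (ennreal step_const * X + ennreal step_const * Y))"
      unfolding incr_eq_step m_def X_def Y_def by (intro mult_left_mono step_diff_bound rad_pos integrable_u xy) auto
    also have "\<dots> = ennreal m * (H j x + H j y)"
      using step_const_pos by (simp add: H_def X_def Y_def ennreal_mult distrib_left mult_ac)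
    finally show "ennreal ((c * \<bar>incr (j + n) x - incr (j + n) y\<bar>) powr p)
      \<le> ennreal (min 1 ((dist x y / (rad n / 2 ^ j)) powr p)) * (H j x + H j y)"
      unfolding m_def rad_add[symmetric] .
  qed (use c f in auto)
  also have "\<dots> = ennreal series_const * (ennreal (c powr p * step_const) *
      (\<Sum>j. ennreal (rad (j + n) powr (- (p * \<theta>))) * (\<integral>\<^sup>+ x. mean_osc u (rad (j + n)) x \<partial>\<nu>)))"
    unfolding H_def rad_add[symmetric]
    by (simp add: nn_integral_cmult mult.left_commute[of _ "ennreal (c powr p * step_const)"])
  also have "\<dots> \<le> ennreal series_const * (ennreal (c powr p * step_const) * (ennreal Cd * tail n))"
    by (intro mult_left_mono mean_osc_tail_le) auto
  also have "\<dots> = ennreal (series_const * c powr p * step_const * Cd) * tail n"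
    using series_const_pos step_const_pos Cd_pos by (simp add: ennreal_mult mult_ac)
  finally show ?thesis .
qed

definition sum_const :: real where "sum_const = R powr \<theta> * geo_const \<theta>"

lemma sum_const_pos: "0 < sum_const"
  using R_pos geo_const_ge_1[OF theta(1)] by (simp add: sum_const_def)

lemma Lp_tail_le:
  assumes c: "0 \<le> c" and f0: "\<And>x. 0 \<le> f x" and f: "\<And>x. ennreal (f x) \<le> (\<Sum>j. ennreal (c * \<bar>incr (j + n) x\<bar>))"
  shows "(\<integral>\<^sup>+ x. ennreal (f x powr p) \<partial>\<nu>) \<le> ennreal (sum_const powr (p - 1) * R powr \<theta> * c powr p * step_const * Cd) * tail n"
proof -
  define K where "K = R powr \<theta> * c powr p * step_const"
  have K: "0 \<le> K" using step_const_pos by (simp add: K_def)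
  have "ennreal (f x powr p) \<le> ennreal (sum_const powr (p - 1)) *
      (\<Sum>j. ennreal K * (ennreal (rad (j + n) powr (- (p * \<theta>))) * mean_osc u (rad (j + n)) x))" for x
  proof -
    \<comment> \<open>With these weights the Jensen factor \<open>g j powr (1 - p)\<close> is at
      most a constant times \<open>rad (j + n) powr (- (p * \<theta>))\<close>, which is the power
      contained in \<open>tail\<close>.\<close>
    define g where "g j = rad (j + n) powr \<theta>" for j
    have g: "0 < g j" for j using rad_pos[of "j + n"] by (simp add: g_def)
    have "ennreal (f x powr p) \<le> ennreal (sum_const powr (p - 1)) * (\<Sum>j. ennreal (g j powr (1 - p) * (c * \<bar>incr (j + n) x\<bar>) powr p))"
    proof (rule suminf_powr_Jensen[OF p_ge_1 g _ sum_const_pos _ f0 f])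
      show "(\<Sum>j. ennreal (g j)) \<le> ennreal sum_const"
      proof (rule suminf_le_const)
        fix k
        have "(\<Sum>j<k. g j) \<le> (\<Sum>j<k. R powr \<theta> * (2 powr - \<theta>) ^ j)"
        proof (intro sum_mono)
          fix j
          have "g j \<le> (R * (1 / 2 ^ j)) powr \<theta>"
            unfolding g_def using rad_pos[of "j + n"] rad_le_R[of n] theta
            by (intro powr_mono2) (auto simp: rad_add divide_right_mono)
          then show "g j \<le> R powr \<theta> * (2 powr - \<theta>) ^ j"
            using R_pos by (subst (asm) powr_mult) (auto simp: two_power_powr)
        qed
        also have "\<dots> \<le> sum_const"
          unfolding sum_distrib_left[symmetric] sum_const_def by (intro mult_left_mono geo_sum_le theta) auto
        finally show "(\<Sum>j<k. ennreal (g j)) \<le> ennreal sum_const" using g by (simp add: less_imp_le ennreal_leI)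
      qed simp
    qed (use c in auto)
    also have "\<dots> \<le> ennreal (sum_const powr (p - 1)) *
        (\<Sum>j. ennreal K * (ennreal (rad (j + n) powr (- (p * \<theta>))) * mean_osc u (rad (j + n)) x))"
    proof (intro mult_left_mono suminf_le)
      fix j
      define r where "r = rad (j + n)"
      have r: "0 < r" "r \<le> R" by (auto simp: r_def rad_pos rad_le_R)
      have "g j powr (1 - p) = r powr \<theta> * r powr (- (p * \<theta>))"
        by (simp add: g_def r_def[symmetric] powr_powr algebra_simps flip: powr_add)
      also have "\<dots> \<le> R powr \<theta> * r powr (- (p * \<theta>))" using r theta by (intro mult_right_mono powr_mono2) auto
      finally have "g j powr (1 - p) * (c * \<bar>incr (j + n) x\<bar>) powr p \<le> (R powr \<theta> * r powr (- (p * \<theta>))) * (c powr p * \<bar>incr (j + n) x\<bar> powr p)"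
        using c by (simp add: powr_mult mult_right_mono)
      then have "ennreal (g j powr (1 - p) * (c * \<bar>incr (j + n) x\<bar>) powr p)
         \<le> ennreal (R powr \<theta> * r powr (- (p * \<theta>)) * c powr p) * ennreal (\<bar>incr (j + n) x\<bar> powr p)"
        by (simp add: ennreal_leI mult.assoc flip: ennreal_mult)
      also have "\<dots> \<le> ennreal (R powr \<theta> * r powr (- (p * \<theta>)) * c powr p) * (ennreal step_const * mean_osc u r x)"
        unfolding incr_eq_step r_def by (intro mult_left_mono step_bound rad_pos integrable_u) auto
      also have "\<dots> = ennreal K * (ennreal (r powr (- (p * \<theta>))) * mean_osc u r x)"
        using step_const_pos by (simp add: K_def ennreal_mult mult_ac)
      finally show "ennreal (g j powr (1 - p) * (c * \<bar>incr (j + n) x\<bar>) powr p)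
        \<le> ennreal K * (ennreal (rad (j + n) powr (- (p * \<theta>))) * mean_osc u (rad (j + n)) x)" by (simp add: r_def)
    qed auto
    finally show ?thesis .
  qed
  then have "(\<integral>\<^sup>+ x. ennreal (f x powr p) \<partial>\<nu>) \<le> (\<integral>\<^sup>+ x. ennreal (sum_const powr (p - 1)) *
      (\<Sum>j. ennreal K * (ennreal (rad (j + n) powr (- (p * \<theta>))) * mean_osc u (rad (j + n)) x)) \<partial>\<nu>)"
    by (intro nn_integral_mono)
  also have "\<dots> = ennreal (sum_const powr (p - 1)) * (ennreal K *
      (\<Sum>j. ennreal (rad (j + n) powr (- (p * \<theta>))) * (\<integral>\<^sup>+ x. mean_osc u (rad (j + n)) x \<partial>\<nu>)))"
    by (simp add: nn_integral_cmult nn_integral_suminf)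
  also have "\<dots> \<le> ennreal (sum_const powr (p - 1)) * (ennreal K * (ennreal Cd * tail n))"
    by (intro mult_left_mono mean_osc_tail_le) auto
  also have "\<dots> = ennreal (sum_const powr (p - 1) * R powr \<theta> * c powr p * step_const * Cd) * tail n"
    using K Cd_pos step_const_pos by (simp add: K_def ennreal_mult mult_ac)
  finally show ?thesis .
qed

definition weak_const :: real where
  "weak_const = (series_const + sum_const powr (p - 1) * R powr \<theta>) * step_const * Cd"

lemma weak_const_pos: "0 < weak_const"
  using series_const_pos step_const_pos Cd_pos by (simp add: weak_const_def add_pos_nonneg)

text \<open>A union over partial sums, which are continuous. Being open, the set serves as its own
  neighbourhood in the capacity.\<close>

lemma open_Phi_greater: "open {x. ennreal l < Phi n x}"
proof -
  have "{x. ennreal l < Phi n x} = (\<Union>N. {x. ennreal l < (\<Sum>j<N. ennreal \<bar>incr (j + n) x\<bar>)})"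
    unfolding Phi_def suminf_eq_SUP less_SUP_iff by auto
  also have "\<dots> = (\<Union>N. {x. ennreal l < ennreal (\<Sum>j<N. \<bar>incr (j + n) x\<bar>)})" by simp
  also have "open \<dots>"
  proof (intro open_UN ballI)
    fix N
    have "continuous_on UNIV (\<lambda>x. ennreal (\<Sum>j<N. \<bar>incr (j + n) x\<bar>))"
      unfolding incr_def by (intro continuous_on_ennreal continuous_intros continuous_approx)
    then show "open {x. ennreal l < ennreal (\<Sum>j<N. \<bar>incr (j + n) x\<bar>)}"
      by (intro open_Collect_less continuous_on_const)
  qed
  finally show ?thesis .
qed

text \<open>The test function is \<open>Phi n / l\<close> truncated at 1, which equals 1 on the
  whole open superlevel set. The increments dominate its values, for \<open>Lp_tail_le\<close>, and
  its differences, for \<open>energy_tail_le\<close>.\<close>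

lemma cap_Phi_le:
  assumes l: "0 < l"
  shows "cap {x. ennreal l < Phi n x} \<le> ennreal (weak_const * l powr (- p)) * tail n"
proof -
  define c where "c = 1 / l"
  have c: "0 < c" using l by (simp add: c_def)
  define f where "f x = enn2real (min 1 (ennreal c * Phi n x))" for x
  have [measurable]: "f \<in> borel_measurable \<nu>" unfolding f_def by measurable
  have f0: "0 \<le> f x" for x by (simp add: f_def)
  have cP: "ennreal c * Phi n x = (\<Sum>j. ennreal (c * \<bar>incr (j + n) x\<bar>))" for x
    using c by (simp add: Phi_def ennreal_mult)
  have "(\<integral>\<^sup>+ x. ennreal (f x powr p) \<partial>\<nu>) \<le> ennreal (sum_const powr (p - 1) * R powr \<theta> * c powr p * step_const * Cd) * tail n"
  proof (rule Lp_tail_le[OF less_imp_le[OF c] f0])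
    show "ennreal (f x) \<le> (\<Sum>j. ennreal (c * \<bar>incr (j + n) x\<bar>))" for x
      unfolding cP[symmetric] f_def ennreal_enn2real_min_1 by simp
  qed
  then have Lp: "(\<integral>\<^sup>+ x. ennreal (\<bar>f x\<bar> powr p) \<partial>\<nu>) \<le> ennreal (sum_const powr (p - 1) * R powr \<theta> * c powr p * step_const * Cd) * tail n"
    using f0 by (simp only: abs_of_nonneg)
  have "energy f \<le> ennreal (series_const * c powr p * step_const * Cd) * tail n"
  proof (rule energy_tail_le)
    have *: "ennreal c * Phi n x \<le> ennreal c * Phi n y + (\<Sum>j. ennreal (c * \<bar>incr (j + n) x - incr (j + n) y\<bar>))" for x y
    proof -
      have "(\<Sum>j. ennreal (c * \<bar>incr (j + n) y\<bar>)) + (\<Sum>j. ennreal (c * \<bar>incr (j + n) x - incr (j + n) y\<bar>))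
        = (\<Sum>j. ennreal (c * \<bar>incr (j + n) y\<bar>) + ennreal (c * \<bar>incr (j + n) x - incr (j + n) y\<bar>))"
        by (rule suminf_add) auto
      moreover have "(\<Sum>j. ennreal (c * \<bar>incr (j + n) x\<bar>)) \<le> \<dots>"
      proof (rule suminf_le)
        fix j
        have "\<bar>incr (j + n) x\<bar> \<le> \<bar>incr (j + n) y\<bar> + \<bar>incr (j + n) x - incr (j + n) y\<bar>" by simp
      then have "c * \<bar>incr (j + n) x\<bar> \<le> c * \<bar>incr (j + n) y\<bar> + c * \<bar>incr (j + n) x - incr (j + n) y\<bar>"
        using c by (simp flip: distrib_left)
      then show "ennreal (c * \<bar>incr (j + n) x\<bar>) \<le> ennreal (c * \<bar>incr (j + n) y\<bar>) + ennreal (c * \<bar>incr (j + n) x - incr (j + n) y\<bar>)"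
        using c by (simp add: ennreal_leI flip: ennreal_plus)
      qed auto
      ultimately show ?thesis by (simp only: cP)
    qed
    show "AE x in \<nu>. AE y in \<nu>. x \<noteq> y \<longrightarrow> ennreal \<bar>f x - f y\<bar> \<le> (\<Sum>j. ennreal (c * \<bar>incr (j + n) x - incr (j + n) y\<bar>))"
    proof (intro AE_I2 impI)
      fix x y
      show "ennreal \<bar>f x - f y\<bar> \<le> (\<Sum>j. ennreal (c * \<bar>incr (j + n) x - incr (j + n) y\<bar>))"
        unfolding f_def
      proof (rule enn2real_min_1_diff_le)
        show "ennreal c * Phi n y \<le> ennreal c * Phi n x + (\<Sum>j. ennreal (c * \<bar>incr (j + n) x - incr (j + n) y\<bar>))"
          using *[of y x] by (simp only: abs_minus_commute)
      qed (rule *)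
    qed
  qed (use c in simp)
  then have "besov_cost f \<le> ennreal (series_const * c powr p * step_const * Cd) * tail n
      + ennreal (sum_const powr (p - 1) * R powr \<theta> * c powr p * step_const * Cd) * tail n"
    unfolding besov_cost_def using Lp by (rule add_mono)
  also have "\<dots> = ennreal (weak_const * l powr (- p)) * tail n"
  proof -
    have "l powr (- p) = c powr p" using l by (simp add: c_def powr_divide powr_minus_divide)
    then show ?thesis unfolding distrib_right[symmetric] using series_const_pos step_const_pos Cd_pos
      by (simp add: weak_const_def algebra_simps flip: ennreal_plus)
  qed
  finally have *: "besov_cost f \<le> ennreal (weak_const * l powr (- p)) * tail n" .
  have "1 \<le> f x" if "ennreal l < Phi n x" for x
  proof -
    have "1 = ennreal c * ennreal l" using l by (simp add: c_def flip: ennreal_mult)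
    also have "\<dots> \<le> ennreal c * Phi n x" using that by (intro mult_left_mono) auto
    finally show ?thesis by (simp add: f_def)
  qed
  then have "cap {x. ennreal l < Phi n x} \<le> besov_cost f"
    by (intro cap_le[OF _ open_Phi_greater order_refl] AE_I2) auto
  with * show ?thesis by (rule order_trans[rotated])
qed

lemma eventually_tail_small:
  assumes "0 \<le> a" "0 < \<delta>"
  shows "\<forall>\<^sub>F n in sequentially. ennreal a * tail n \<le> ennreal \<delta>"
proof -
  have "\<forall>\<^sub>F n in sequentially. tail n < ennreal (\<delta> / (a + 1))"
    using assms by (intro order_tendstoD(2)[OF tail_tendsto_0]) simp
  then show ?thesis
  proof (rule eventually_mono)
    fix n assume "tail n < ennreal (\<delta> / (a + 1))"
    then have "ennreal a * tail n \<le> ennreal a * ennreal (\<delta> / (a + 1))" by (intro mult_left_mono) auto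
    also have "\<dots> = ennreal (a * (\<delta> / (a + 1)))" using assms by (simp flip: ennreal_mult)
    also have "\<dots> \<le> ennreal \<delta>" using assms by (intro ennreal_leI) (simp add: field_simps)
    finally show "ennreal a * tail n \<le> ennreal \<delta>" .
  qed
qed

text \<open>Telescoping from \<open>approx n\<close> to \<open>u\<close> is available at points of
  convergence, hence for almost every \<open>x\<close> and then almost every
  \<open>y\<close>.\<close>

lemma energy_approx_error:
  "energy (\<lambda>x. u x - approx n x) \<le> ennreal (series_const * step_const * Cd) * tail n"
proof -
  have "energy (\<lambda>x. u x - approx n x) \<le> ennreal (series_const * 1 powr p * step_const * Cd) * tail n"
  proof (rule energy_tail_le)
    show "AE x in \<nu>. AE y in \<nu>. x \<noteq> y \<longrightarrow>
      ennreal \<bar>(u x - approx n x) - (u y - approx n y)\<bar> \<le> (\<Sum>j. ennreal (1 * \<bar>incr (j + n) x - incr (j + n) y\<bar>))"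
      using approx_tendsto
    proof (rule eventually_mono)
      fix x assume x: "(\<lambda>j. approx j x) \<longlonglongrightarrow> u x"
      show "AE y in \<nu>. x \<noteq> y \<longrightarrow>
        ennreal \<bar>(u x - approx n x) - (u y - approx n y)\<bar> \<le> (\<Sum>j. ennreal (1 * \<bar>incr (j + n) x - incr (j + n) y\<bar>))"
        using approx_tendsto
      proof (rule eventually_mono, intro impI)
        fix y assume y: "(\<lambda>j. approx j y) \<longlonglongrightarrow> u y"
        have "(\<lambda>j. approx j x - approx j y) \<longlonglongrightarrow> u x - u y" by (intro tendsto_diff x y)
        from telescope_le_suminf[OF this, of n]
        show "ennreal \<bar>(u x - approx n x) - (u y - approx n y)\<bar> \<le> (\<Sum>j. ennreal (1 * \<bar>incr (j + n) x - incr (j + n) y\<bar>))"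
          by (simp add: incr_def algebra_simps)
      qed
    qed
  qed simp
  then show ?thesis by simp
qed

lemma Lp_approx_error:
  "(\<integral>\<^sup>+ x. ennreal (\<bar>u x - approx n x\<bar> powr p) \<partial>\<nu>) \<le> ennreal (osc_const powr p * R powr (p * \<theta>)) * tail n"
proof -
  have "(\<integral>\<^sup>+ x. ennreal (\<bar>u x - approx n x\<bar> powr p) \<partial>\<nu>) \<le> (\<integral>\<^sup>+ x. ennreal (osc_const powr p * rad n powr (p * \<theta>)) * tail_osc u n x \<partial>\<nu>)"
    by (intro nn_integral_mono approx_error) simp
  also have "\<dots> = ennreal (osc_const powr p * rad n powr (p * \<theta>)) * tail n"
    unfolding tail_def by (rule nn_integral_cmult) measurable
  also have "\<dots> \<le> ennreal (osc_const powr p * R powr (p * \<theta>)) * tail n"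
    using rad_pos[of n] rad_le_R[of n] p_ge_1 theta
    by (intro mult_right_mono ennreal_leI mult_left_mono powr_mono2) auto
  finally show ?thesis .
qed

lemma lipschitz_dense:
  assumes e: "0 < \<epsilon>"
  shows "\<exists>n. besov_norm \<nu> \<theta> p (\<lambda>x. u x - approx n x) < \<epsilon>"
proof -
  \<comment> \<open>Each part of the norm becomes at most \<open>\<epsilon> / 3\<close>, which
    leaves a strict inequality.\<close>
  define \<delta> where "\<delta> = (\<epsilon> / 3) powr p"
  have d: "0 < \<delta>" using e by (simp add: \<delta>_def)
  have dp: "\<delta> powr (1 / p) = \<epsilon> / 3" using e p_ge_1 by (simp add: \<delta>_def powr_powr)
  have "\<forall>\<^sub>F n in sequentially. ennreal (series_const * step_const * Cd) * tail n \<le> ennreal \<delta>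
     \<and> ennreal (osc_const powr p * R powr (p * \<theta>)) * tail n \<le> ennreal \<delta>"
    using series_const_pos step_const_pos Cd_pos d
    by (intro eventually_conj eventually_tail_small) auto
  then obtain n where n: "ennreal (series_const * step_const * Cd) * tail n \<le> ennreal \<delta>"
     "ennreal (osc_const powr p * R powr (p * \<theta>)) * tail n \<le> ennreal \<delta>"
    using eventually_happens'[OF sequentially_bot] by blast
  have 1: "enn2real (energy (\<lambda>x. u x - approx n x)) \<le> \<delta>"
    using order_trans[OF energy_approx_error n(1)] d by (intro enn2real_leI) auto
  have "(\<integral>x. \<bar>u x - approx n x\<bar> powr p \<partial>\<nu>) = enn2real (\<integral>\<^sup>+ x. ennreal (\<bar>u x - approx n x\<bar> powr p) \<partial>\<nu>)"
    by (rule integral_eq_nn_integral) auto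
  also have "\<dots> \<le> \<delta>" using order_trans[OF Lp_approx_error n(2)] d by (intro enn2real_leI) auto
  finally have 2: "(\<integral>x. \<bar>u x - approx n x\<bar> powr p \<partial>\<nu>) \<le> \<delta>" .
  have "besov_norm \<nu> \<theta> p (\<lambda>x. u x - approx n x) \<le> \<delta> powr (1 / p) + \<delta> powr (1 / p)"
    unfolding besov_norm_def Lp_norm_def using 1 2 p_ge_1
    by (intro add_mono powr_mono2) (auto intro: integral_nonneg)
  also have "\<dots> < \<epsilon>" using e by (simp add: dp)
  finally show ?thesis by blast
qed

text \<open>Where the averages diverge the value is arbitrary; there \<open>Phi n x\<close> is
  infinite for every \<open>n\<close>, so these points lie in a set of capacity zero.\<close>

definition precise :: "'a \<Rightarrow> real" where "precise x = lim (\<lambda>j. approx j x)"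

lemma measurable_precise[measurable]: "precise \<in> borel_measurable \<nu>"
  unfolding precise_def[abs_def] by (intro borel_measurable_lim_metric measurable_approx)

lemma precise_AE: "AE x in \<nu>. precise x = u x"
  using approx_tendsto by (rule eventually_mono) (simp add: precise_def limI)

lemma approx_tendsto_precise: "Phi n x < \<infinity> \<Longrightarrow> (\<lambda>j. approx j x) \<longlonglongrightarrow> precise x"
  unfolding Phi_def incr_def precise_def convergent_LIMSEQ_iff[symmetric]
  by (rule convergent_of_summable_increments)

lemma precise_error:
  assumes "Phi n x < \<infinity>"
  shows "ennreal \<bar>precise x - approx m x\<bar> \<le> Phi m x"
  using telescope_le_suminf[OF approx_tendsto_precise[OF assms], of m] by (simp add: Phi_def incr_def)

text \<open>The index \<open>n k\<close> makes the set where \<open>Phi (n k)\<close> exceeds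
  \<open>(1 / 2) ^ k\<close> so small in capacity that these sets together contribute at most
  \<open>\<eta> / 2\<close>. Off their union \<open>Phi (n k)\<close> bounds the error of all later
  averages uniformly.\<close>

lemma quasicontinuous_precise: "besov_quasicontinuous \<nu> \<theta> p precise"
  unfolding besov_quasicontinuous_def
proof (intro allI impI)
  fix \<eta> :: real assume eta: "0 < \<eta>"
  have "\<forall>k. \<exists>n. ennreal (weak_const * ((1 / 2) ^ k) powr (- p)) * tail n \<le> ennreal (\<eta> / 2 * (1 / 2) ^ Suc k)"
  proof
    fix k
    have "\<forall>\<^sub>F n in sequentially. ennreal (weak_const * ((1 / 2) ^ k) powr (- p)) * tail n \<le> ennreal (\<eta> / 2 * (1 / 2) ^ Suc k)"
      using weak_const_pos eta by (intro eventually_tail_small) auto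
    then show "\<exists>n. ennreal (weak_const * ((1 / 2) ^ k) powr (- p)) * tail n \<le> ennreal (\<eta> / 2 * (1 / 2) ^ Suc k)"
      using eventually_happens'[OF sequentially_bot] by blast
  qed
  from choice[OF this] obtain n where n: "\<And>k. ennreal (weak_const * ((1 / 2) ^ k) powr (- p)) * tail (n k) \<le> ennreal (\<eta> / 2 * (1 / 2) ^ Suc k)" by blast
  define U where "U k = {x. ennreal ((1 / 2) ^ k) < Phi (n k) x}" for k
  define G where "G = (\<Union>k. U k)"
  have "open G" unfolding G_def U_def by (intro open_UN ballI open_Phi_greater)
  moreover have "cap G < ennreal \<eta>"
  proof -
    have "cap G \<le> (\<Sum>k. cap (U k))" unfolding G_def by (rule cap_countable_subadditive)
    also have "\<dots> \<le> (\<Sum>k. ennreal (\<eta> / 2 * (1 / 2) ^ Suc k))"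
    proof (intro suminf_le)
      fix k
      have "cap (U k) \<le> ennreal (weak_const * ((1 / 2) ^ k) powr (- p)) * tail (n k)"
        unfolding U_def by (rule cap_Phi_le) simp
      then show "cap (U k) \<le> ennreal (\<eta> / 2 * (1 / 2) ^ Suc k)" using n by (rule order_trans)
    qed auto
    also have "\<dots> = ennreal (\<eta> / 2)"
      using eta sums_mult[OF power_half_series, of "\<eta> / 2"] by (intro suminf_ennreal_eq) auto
    also have "\<dots> < ennreal \<eta>" using eta by (simp add: ennreal_less_iff)
    finally show ?thesis .
  qed
  moreover have "continuous_on (- G) precise"
  proof (rule uniform_limit_theorem)
    show "\<forall>\<^sub>F m in sequentially. continuous_on (- G) (approx m)"
      by (intro always_eventually allI continuous_on_subset[OF continuous_approx]) auto
    show "uniform_limit (- G) approx precise sequentially"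
    proof (rule uniform_limitI)
      fix e :: real assume "0 < e"
      then obtain k where k: "(1 / 2 :: real) ^ k < e" using real_arch_pow_inv[of e "1 / 2"] by auto
      show "\<forall>\<^sub>F m in sequentially. \<forall>x\<in>- G. dist (approx m x) (precise x) < e"
      proof (rule eventually_sequentiallyI[of "n k"], intro ballI)
        fix m x assume m: "n k \<le> m" and x: "x \<in> - G"
        have P: "Phi (n k) x \<le> ennreal ((1 / 2) ^ k)" using x by (auto simp: G_def U_def not_less)
        also have "\<dots> < \<infinity>" by simp
        finally have "ennreal \<bar>precise x - approx m x\<bar> \<le> Phi m x" by (rule precise_error)
        also have "\<dots> \<le> ennreal ((1 / 2) ^ k)" using Phi_mono[OF m] P by (rule order_trans)
        finally have "\<bar>precise x - approx m x\<bar> \<le> (1 / 2) ^ k" by simp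
        then show "dist (approx m x) (precise x) < e" using k by (simp add: dist_real_def abs_minus_commute)
      qed
    qed
  qed simp
  ultimately show "\<exists>G. open G \<and> cap G < ennreal \<eta> \<and> continuous_on (- G) precise" by blast
qed

text \<open>The set lies in every superlevel set of \<open>Phi 0\<close>, and the bound for their
  capacity decays like \<open>l powr (- p)\<close>.\<close>

lemma cap_Phi_infinite: "cap {x. Phi 0 x = \<infinity>} = 0"
proof -
  have *: "cap {x. Phi 0 x = \<infinity>} \<le> ennreal \<delta>" if d: "0 < \<delta>" for \<delta>
  proof -
    obtain t where t: "tail 0 = ennreal t" "0 \<le> t" using tail_0_finite by (cases "tail 0") auto
    define l where "l = (weak_const * (t + 1) / \<delta>) powr (1 / p)"
    have l: "0 < l" using weak_const_pos t d by (simp add: l_def)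
    have lp: "l powr p = weak_const * (t + 1) / \<delta>" using weak_const_pos t d by (simp add: l_def powr_inverse_p)
    have "cap {x. Phi 0 x = \<infinity>} \<le> cap {x. ennreal l < Phi 0 x}"
      by (intro cap_mono) auto
    also have "\<dots> \<le> ennreal (weak_const * l powr (- p)) * tail 0" by (rule cap_Phi_le[OF l])
    also have "\<dots> = ennreal (weak_const * l powr (- p) * t)" using t weak_const_pos by (simp flip: ennreal_mult)
    also have "\<dots> \<le> ennreal \<delta>"
    proof (rule ennreal_leI)
      have "weak_const * l powr (- p) * t = \<delta> * (t / (t + 1))"
        using weak_const_pos by (simp add: powr_minus_divide lp)
      also have "\<dots> \<le> \<delta> * 1" using d t by (intro mult_left_mono) auto
      finally show "weak_const * l powr (- p) * t \<le> \<delta>" by simp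
    qed
    finally show ?thesis .
  qed
  have "cap {x. Phi 0 x = \<infinity>} \<le> 0"
  proof (rule ennreal_le_epsilon)
    fix e :: real assume "0 < e"
    from *[OF this] show "cap {x. Phi 0 x = \<infinity>} \<le> 0 + ennreal e" by simp
  qed
  then show ?thesis by simp
qed

end

section \<open>Lower mass bound and Hoelder continuity\<close>

locale besov_lower = besov_function \<nu> Cd p \<theta> u
  for \<nu> :: "'a::metric_space measure" and Cd p \<theta> u +
  fixes s c :: real
  assumes s_pos: "0 < s" and c_pos: "0 < c"
    and lower_mass: "\<And>x r r'. 0 < r' \<Longrightarrow> r' \<le> r \<Longrightarrow> r \<le> R \<Longrightarrow> c * (r' / r) powr s \<le> V x r' / V x r"
begin

lemma V_lower: "0 < r' \<Longrightarrow> r' \<le> r \<Longrightarrow> r \<le> R \<Longrightarrow> c * (r' / r) powr s * V x r \<le> V x r'"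
  using lower_mass[of r' r x] V_pos[of r x] by (simp add: field_simps)

text \<open>A mean is bounded by the mass of \<open>tail_osc\<close> on a larger set divided by the
  volume. \<open>S\<close> is the whole space for Hoelder continuity and a ball of radius
  \<open>3 * rad n\<close> in Hedberg's argument.\<close>

lemma mean_osc_le_local:
  assumes nj: "n \<le> j" and S: "S \<in> sets \<nu>" "ball z (2 * rad j) \<subseteq> S"
  shows "mean_osc u (rad j) z \<le> ennreal (rad j powr (p * \<theta>) / V z (2 * rad j)) * (\<integral>\<^sup>+ y. tail_osc u n y * indicator S y \<partial>\<nu>)"
proof -
  have "mean_osc u (rad j) z \<le> (\<integral>\<^sup>+ y. ennreal (rad j powr (p * \<theta>) / V z (2 * rad j)) * (tail_osc u n y * indicator S y) \<partial>\<nu>)"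
    unfolding mean_osc_def avg_def
  proof (intro nn_integral_mono)
    fix y
    show "ennreal (avg_ker (2 * rad j) z y) * osc u (rad j) y
      \<le> ennreal (rad j powr (p * \<theta>) / V z (2 * rad j)) * (tail_osc u n y * indicator S y)"
    proof (cases "dist z y < 2 * rad j")
      case True
      then have "y \<in> S" using S by auto
      have "ennreal (1 / V z (2 * rad j)) * osc u (rad j) y
        \<le> ennreal (1 / V z (2 * rad j)) * (ennreal (rad j powr (p * \<theta>)) * tail_osc u n y)"
        by (intro mult_left_mono osc_le_tail nj) auto
      then show ?thesis using True \<open>y \<in> S\<close> by (simp add: avg_ker_def ennreal_mult_assoc)
    qed (simp add: avg_ker_def)
  qed
  also have "\<dots> = ennreal (rad j powr (p * \<theta>) / V z (2 * rad j)) * (\<integral>\<^sup>+ y. tail_osc u n y * indicator S y \<partial>\<nu>)"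
    using S(1) by (intro nn_integral_cmult borel_measurable_times_ennreal measurable_tail_osc measurable_u borel_measurable_indicator)
  finally show ?thesis .
qed

text \<open>The volume is at least a multiple of \<open>r powr s\<close>, so \<open>mean_osc\<close>
  is at most a multiple of \<open>r powr (p * \<theta> - s)\<close>, and its \<open>p\<close>-th
  root has the exponent \<open>\<alpha> = \<theta> - s / p\<close>. With increments of size
  \<open>r powr \<alpha>\<close> and the gain \<open>min 1 (d / r)\<close>, the series of
  differences is again a sum of \<open>scale_wt\<close>, now with exponents \<open>\<alpha>\<close>
  and \<open>1 - \<alpha>\<close>.\<close>

lemma holder_precise:
  assumes ps: "s < p * \<theta>"
  shows "holder_continuous precise"
proof -
  define \<alpha> where "\<alpha> = \<theta> - s / p"
  have "s / p < \<theta>" "0 < s / p" using ps p_ge_1 s_pos by (auto simp: field_simps)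
  then have a: "0 < \<alpha>" "\<alpha> < 1" using theta by (auto simp: \<alpha>_def)
  obtain A where A: "tail 0 = ennreal A" "0 \<le> A" using tail_0_finite by (cases "tail 0") auto
  define M where "M = measure \<nu> UNIV"
  have MV: "V x R = M" for x by (simp add: M_def V_def)
  have M: "0 < M" using V_pos[OF R_pos] MV by metis
  define D where "D = A * R powr s / (c * M)"
  have D: "0 \<le> D" using A c_pos M by (simp add: D_def)
  have mo: "mean_osc u (rad j) z \<le> ennreal (D * rad j powr (p * \<alpha>))" for j z
  proof -
    define r where "r = rad j"
    have r: "0 < r" "r \<le> R" by (auto simp: r_def rad_pos rad_le_R)
    have "c * (r / R) powr s * M \<le> V z r" using V_lower[OF r order_refl, of z] by (simp add: MV)
    also have "\<dots> \<le> V z (2 * r)" using r by (intro V_mono subset_ball) auto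
    finally have V2: "c * (r / R) powr s * M \<le> V z (2 * r)" .
    have low: "0 < c * (r / R) powr s * M" using r c_pos M R_pos by simp
    have "mean_osc u r z \<le> ennreal (r powr (p * \<theta>) / V z (2 * r)) * (\<integral>\<^sup>+ y. tail_osc u 0 y * indicator UNIV y \<partial>\<nu>)"
      unfolding r_def using sets.top[of \<nu>] by (intro mean_osc_le_local) auto
    also have "\<dots> = ennreal (r powr (p * \<theta>) / V z (2 * r) * A)"
      using A by (simp add: tail_def flip: ennreal_mult)
    also have "\<dots> \<le> ennreal (D * r powr (p * \<alpha>))"
    proof (rule ennreal_leI)
      have "r powr (p * \<theta>) / V z (2 * r) * A \<le> r powr (p * \<theta>) / (c * (r / R) powr s * M) * A"
      proof (intro mult_right_mono divide_left_mono V2)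
        show "0 < V z (2 * r) * (c * (r / R) powr s * M)" by (rule mult_pos_pos[OF less_le_trans[OF low V2] low])
      qed (use A in auto)
      also have "\<dots> = D * (r powr (p * \<theta>) / r powr s)"
        using r R_pos by (simp add: D_def powr_divide mult_ac)
      also have "r powr (p * \<theta>) / r powr s = r powr (p * \<alpha>)"
        using p_ge_1 by (simp add: \<alpha>_def algebra_simps flip: powr_diff)
      finally show "r powr (p * \<theta>) / V z (2 * r) * A \<le> D * r powr (p * \<alpha>)" .
    qed
    finally show ?thesis by (simp add: r_def)
  qed
  \<comment> \<open>The factor 2 accommodates the two oscillation terms of
    \<open>step_diff_bound\<close>, so that one constant serves \<open>incr_le\<close> and
    \<open>incr_diff\<close>.\<close>
  define B where "B = (2 * step_const * D) powr (1 / p)"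
  have B: "0 \<le> B" by (simp add: B_def)
  have root: "(m powr p * (2 * step_const * D * rad j powr (p * \<alpha>))) powr (1 / p) = m * (B * rad j powr \<alpha>)" if "0 \<le> m" for m j
    using that D step_const_pos p_ge_1 by (simp add: B_def powr_mult powr_powr)
  have incr_le: "\<bar>incr j x\<bar> \<le> B * rad j powr \<alpha>" for j x
  proof -
    have "ennreal (\<bar>incr j x\<bar> powr p) \<le> ennreal step_const * mean_osc u (rad j) x"
      unfolding incr_eq_step by (intro step_bound rad_pos integrable_u)
    also have "\<dots> \<le> ennreal step_const * ennreal (D * rad j powr (p * \<alpha>))" by (intro mult_left_mono mo) simp
    also have "\<dots> \<le> ennreal (1 powr p * (2 * step_const * D * rad j powr (p * \<alpha>)))"
      using D step_const_pos by (simp add: ennreal_leI flip: ennreal_mult)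
    finally have "\<bar>incr j x\<bar> \<le> (1 powr p * (2 * step_const * D * rad j powr (p * \<alpha>))) powr (1 / p)"
      by (rule powr_le_ennreal_imp) (use D step_const_pos in auto)
    then show ?thesis by (subst (asm) root) auto
  qed
  have incr_diff: "\<bar>incr j x - incr j y\<bar> \<le> min 1 (dist x y / rad j) * (B * rad j powr \<alpha>)" if "x \<noteq> y" for j x y
  proof -
    define m where "m = min 1 (dist x y / rad j)"
    have m: "0 \<le> m" using rad_pos[of j] by (simp add: m_def)
    have mp: "min 1 ((dist x y / rad j) powr p) = m powr p"
    proof (cases "dist x y / rad j \<le> 1")
      case True
      then show ?thesis using rad_pos[of j] p_ge_1 by (simp add: m_def powr_le1 min_absorb2)
    next
      case False
      then have "1 \<le> (dist x y / rad j) powr p" using p_ge_1 by (intro ge_one_powr_ge_zero) auto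
      then show ?thesis using False by (simp add: m_def min_absorb1)
    qed
    have "ennreal (\<bar>incr j x - incr j y\<bar> powr p) \<le> ennreal (m powr p) * (ennreal step_const * mean_osc u (rad j) x + ennreal step_const * mean_osc u (rad j) y)"
      unfolding incr_eq_step mp[symmetric] by (intro step_diff_bound rad_pos integrable_u that)
    also have "\<dots> \<le> ennreal (m powr p) * (ennreal step_const * ennreal (D * rad j powr (p * \<alpha>)) + ennreal step_const * ennreal (D * rad j powr (p * \<alpha>)))"
      by (intro mult_left_mono add_mono mo) auto
    also have "\<dots> = ennreal (m powr p * (2 * step_const * D * rad j powr (p * \<alpha>)))"
      using D step_const_pos by (simp flip: ennreal_mult ennreal_plus)
    finally have "\<bar>incr j x - incr j y\<bar> \<le> (m powr p * (2 * step_const * D * rad j powr (p * \<alpha>))) powr (1 / p)"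
      by (rule powr_le_ennreal_imp) (use D step_const_pos in auto)
    then show ?thesis using m by (simp add: root m_def)
  qed
  have fin: "Phi 0 x < \<infinity>" for x
  proof -
    have "Phi 0 x \<le> ennreal (B * R powr \<alpha> * geo_const \<alpha>)"
      unfolding Phi_def
    proof (rule suminf_le_const)
      fix k
      have "(\<Sum>j<k. \<bar>incr (j + 0) x\<bar>) \<le> (\<Sum>j<k. B * R powr \<alpha> * (2 powr - \<alpha>) ^ j)"
      proof (intro sum_mono)
        fix j
        have "rad j powr \<alpha> = R powr \<alpha> * (2 powr - \<alpha>) ^ j"
          using R_pos powr_mult[of R "1 / 2 ^ j" \<alpha>] by (simp add: rad_def two_power_powr)
        then show "\<bar>incr (j + 0) x\<bar> \<le> B * R powr \<alpha> * (2 powr - \<alpha>) ^ j" using incr_le[of j x] by simp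
      qed
      also have "\<dots> \<le> B * R powr \<alpha> * geo_const \<alpha>"
        unfolding sum_distrib_left[symmetric] using B by (intro mult_left_mono geo_sum_le a) auto
      finally show "(\<Sum>j<k. ennreal \<bar>incr (j + 0) x\<bar>) \<le> ennreal (B * R powr \<alpha> * geo_const \<alpha>)"
        by (simp add: ennreal_leI)
    qed simp
    then show ?thesis by (rule le_less_trans) simp
  qed
  obtain L where L: "L-lipschitz_on UNIV (approx 0)" using lipschitz_approx by blast
  define G where "G = geo_const \<alpha> + geo_const (1 - \<alpha>)"
  have G: "0 \<le> G" using geo_const_ge_1[of \<alpha>] geo_const_ge_1[of "1 - \<alpha>"] a by (simp add: G_def)
  define C where "C = B * G + L * R powr (1 - \<alpha>)"
  have L0: "0 \<le> L" using L by (rule lipschitz_on_nonneg)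
  have "\<bar>precise x - precise y\<bar> \<le> C * dist x y powr \<alpha>" for x y
  proof (cases "x = y")
    case False
    define d where "d = dist x y"
    have d: "0 < d" "d \<le> R" using False dist_less_R[of x y] by (auto simp: d_def)
    have "(\<lambda>j. approx j x - approx j y) \<longlonglongrightarrow> precise x - precise y"
      by (intro tendsto_diff approx_tendsto_precise[OF fin])
    from telescope_le_suminf[OF this, of 0]
    have "ennreal \<bar>(precise x - precise y) - (approx 0 x - approx 0 y)\<bar> \<le> (\<Sum>j. ennreal \<bar>incr j x - incr j y\<bar>)"
      by (simp add: incr_def algebra_simps)
    also have "\<dots> \<le> (\<Sum>j. ennreal (B * d powr \<alpha>) * ennreal (scale_wt \<alpha> (1 - \<alpha>) (R / 2 ^ j) d))"
    proof (intro suminf_le)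
      fix j
      \<comment> \<open>The identity \<open>scale_wt_powr\<close> is taken with 1 in the role of
        \<open>p\<close>.\<close>
      have "scale_wt \<alpha> (1 - \<alpha>) (rad j) d powr 1 = min 1 ((d / rad j) powr 1) * (rad j / d) powr (1 * \<alpha>)"
        by (rule scale_wt_powr) (use rad_pos d a in auto)
      then have eq: "scale_wt \<alpha> (1 - \<alpha>) (rad j) d * d powr \<alpha> = min 1 (d / rad j) * rad j powr \<alpha>"
        using rad_pos[of j] d scale_wt_nonneg[of \<alpha> "1 - \<alpha>" "rad j" d] by (simp add: powr_divide)
      have "\<bar>incr j x - incr j y\<bar> \<le> B * (min 1 (d / rad j) * rad j powr \<alpha>)"
        using incr_diff[OF False, of j] by (simp add: d_def mult.left_commute)
      also have "\<dots> = (B * d powr \<alpha>) * scale_wt \<alpha> (1 - \<alpha>) (rad j) d"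
        unfolding eq[symmetric] by (simp only: mult_ac)
      finally have "\<bar>incr j x - incr j y\<bar> \<le> (B * d powr \<alpha>) * scale_wt \<alpha> (1 - \<alpha>) (rad j) d" .
      then show "ennreal \<bar>incr j x - incr j y\<bar> \<le> ennreal (B * d powr \<alpha>) * ennreal (scale_wt \<alpha> (1 - \<alpha>) (R / 2 ^ j) d)"
        using B by (simp add: rad_def ennreal_leI scale_wt_nonneg flip: ennreal_mult)
    qed auto
    also have "\<dots> \<le> ennreal (B * d powr \<alpha>) * ennreal G"
      unfolding ennreal_suminf_cmult G_def using a R_pos d by (intro mult_left_mono scale_wt_sum) auto
    also have "\<dots> = ennreal (B * G * d powr \<alpha>)" using B G by (simp add: mult_ac flip: ennreal_mult)
    finally have 1: "\<bar>(precise x - precise y) - (approx 0 x - approx 0 y)\<bar> \<le> B * G * d powr \<alpha>" using B G by simp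
    \<comment> \<open>The coarsest average is Lipschitz, which on a bounded space is a Hoelder
      bound; its constant is the second part of \<open>C\<close>.\<close>
    have "\<bar>approx 0 x - approx 0 y\<bar> \<le> L * d" using lipschitz_onD[OF L, of x y] by (simp add: dist_real_def d_def)
    also have "d = d powr (1 - \<alpha>) * d powr \<alpha>" using d by (simp flip: powr_add)
    also have "L * (d powr (1 - \<alpha>) * d powr \<alpha>) \<le> L * (R powr (1 - \<alpha>) * d powr \<alpha>)"
      using d a L0 by (intro mult_left_mono mult_right_mono powr_mono2) auto
    finally have "\<bar>approx 0 x - approx 0 y\<bar> \<le> L * R powr (1 - \<alpha>) * d powr \<alpha>" by simp
    with 1 show ?thesis by (simp add: C_def d_def distrib_right)
  qed (use B G L0 in \<open>simp add: C_def\<close>)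
  moreover have "0 \<le> C" using B G L0 by (simp add: C_def)
  ultimately show ?thesis unfolding holder_continuous_def using a by (intro exI[of _ \<alpha>] exI[of _ C]) auto
qed

end

section \<open>Sobolev-Poincare inequality and Lebesgue points\<close>

lemma dyadic_below:
  assumes "1 \<le> (y::real)"
  obtains k where "2 ^ k \<le> y" "y < 2 ^ Suc k"
proof -
  define m where "m = (LEAST m. y < 2 ^ m)"
  have "\<exists>m. y < 2 ^ m" using real_arch_pow[of 2 y] by auto
  then have m: "y < 2 ^ m" unfolding m_def by (rule LeastI_ex)
  have lt: "\<not> y < 2 ^ j" if "j < m" for j using that not_less_Least unfolding m_def by blast
  have "m \<noteq> 0" using m assms by (intro notI) simp
  then obtain k where "m = Suc k" using not0_implies_Suc by blast
  then show ?thesis using that[of k] m lt[of k] by simp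
qed

text \<open>Hedberg's trick: the two terms of the hypothesis balance for \<open>2 ^ k\<close> close to \<open>(t / a) powr (1 / s)\<close>.\<close>

lemma hedberg_optimise:
  fixes p \<theta> s q t a w K :: real
  assumes p: "1 \<le> p" and th: "0 < \<theta>" and ps: "p * \<theta> < s" and q: "q = s * p / (s - p * \<theta>)"
    and t: "0 \<le> t" and a: "0 < a" and w: "0 \<le> w" and K: "0 \<le> K"
    and le: "\<And>k::nat. w \<le> K * (t powr (1 / p) * (2 ^ k) powr (- \<theta>) + a powr (1 / p) * (2 ^ k) powr (s / p - \<theta>))"
  shows "w powr q \<le> (K * (2 powr \<theta> + 1)) powr q * (t * a powr (q / p - 1) + a powr (q / p))"
proof -
  have s: "0 < s" using p th ps by (smt (verit) mult_pos_pos)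
  have q0: "0 < q" using q s p ps by (auto intro!: divide_pos_pos mult_pos_pos)
  have "1 / q = (s - p * \<theta>) / (s * p)" by (simp add: q)
  \<comment> \<open>The Sobolev relation of the exponents, which lets both terms take the same form
    at the optimum.\<close>
  then have q1: "1 / q = 1 / p - \<theta> / s" using s p by (simp add: diff_divide_distrib)
  have q2: "q * (\<theta> / s) = q / p - 1"
  proof -
    have "q * (1 / q) = q * (1 / p - \<theta> / s)" by (simp only: q1)
    then show ?thesis using q0 by (simp add: right_diff_distrib)
  qed
  define L where "L = K * (2 powr \<theta> + 1)"
  have L: "0 \<le> L" using K by (simp add: L_def)
  show ?thesis
  proof (cases "t \<le> a")
    case True
    \<comment> \<open>For \<open>t \<le> a\<close> the choice \<open>k = 0\<close> is good
      enough.\<close>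
    have "w \<le> K * (t powr (1 / p) + a powr (1 / p))" using le[of 0] by simp
    also have "\<dots> \<le> K * (2 powr \<theta> * a powr (1 / p) + a powr (1 / p))"
    proof (intro mult_left_mono add_right_mono K)
      have "t powr (1 / p) \<le> 1 * a powr (1 / p)" using True t p by (simp add: powr_mono2)
      also have "\<dots> \<le> 2 powr \<theta> * a powr (1 / p)" using th by (intro mult_right_mono) (auto intro: ge_one_powr_ge_zero)
      finally show "t powr (1 / p) \<le> 2 powr \<theta> * a powr (1 / p)" .
    qed
    also have "\<dots> = L * a powr (1 / p)" by (simp add: L_def algebra_simps)
    finally have "w powr q \<le> (L * a powr (1 / p)) powr q" using w q0 by (intro powr_mono2) auto
    also have "\<dots> = L powr q * a powr (q / p)" using L by (simp add: powr_mult powr_powr)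
    also have "\<dots> \<le> L powr q * (t * a powr (q / p - 1) + a powr (q / p))" using t by (intro mult_left_mono) auto
    finally show ?thesis by (simp add: L_def)
  next
    case False
    then have ta: "1 < t / a" "0 < t" using a by auto
    \<comment> \<open>The value of \<open>2 ^ k\<close> that would balance the two terms. Rounding
      it down to a power of 2 costs \<open>2 powr \<theta>\<close> in the first term and nothing in
      the second.\<close>
    define y where "y = (t / a) powr (1 / s)"
    have y1: "1 \<le> y" unfolding y_def using ta s by (intro ge_one_powr_ge_zero) auto
    obtain k where k: "2 ^ k \<le> y" "y < 2 ^ Suc k" using dyadic_below[OF y1] .
    have M1: "(2 ^ k) powr (s / p - \<theta>) \<le> y powr (s / p - \<theta>)"
      using k ps p by (intro powr_mono2) (auto simp: field_simps)
    have "(2 ^ k) powr (- \<theta>) \<le> (y / 2) powr (- \<theta>)"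
      using k y1 th by (intro powr_mono2') auto
    also have "\<dots> = 2 powr \<theta> * y powr (- \<theta>)" using y1 by (simp add: powr_divide powr_minus field_simps)
    finally have M2: "(2 ^ k) powr (- \<theta>) \<le> 2 powr \<theta> * y powr (- \<theta>)" .
    have e1: "t powr (1 / p) * y powr (- \<theta>) = t powr (1 / q) * a powr (\<theta> / s)"
      using ta a by (simp add: y_def powr_powr powr_divide q1 powr_diff powr_minus field_simps)
    have e2: "a powr (1 / p) * y powr (s / p - \<theta>) = t powr (1 / q) * a powr (\<theta> / s)"
    proof -
      have "(1 / s) * (s / p - \<theta>) = 1 / q" using s p unfolding q1 by (simp add: field_simps)
      then have "y powr (s / p - \<theta>) = t powr (1 / q) / a powr (1 / q)"
        using ta a by (simp only: y_def powr_powr) (simp add: powr_divide)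
      moreover have "a powr (1 / p) / a powr (1 / q) = a powr (\<theta> / s)"
        using a by (simp add: q1 flip: powr_diff)
      ultimately show ?thesis by (metis times_divide_eq_left times_divide_eq_right mult.commute)
    qed
    have "w \<le> K * (t powr (1 / p) * (2 powr \<theta> * y powr (- \<theta>)) + a powr (1 / p) * y powr (s / p - \<theta>))"
      using le[of k] by (rule order_trans) (intro mult_left_mono add_mono K M1 M2, auto)
    also have "\<dots> = K * (2 powr \<theta> * (t powr (1 / p) * y powr (- \<theta>)) + a powr (1 / p) * y powr (s / p - \<theta>))" by simp
    also have "\<dots> = L * (t powr (1 / q) * a powr (\<theta> / s))" unfolding e1 e2 by (simp add: L_def algebra_simps)
    \<comment> \<open>After raising to the power \<open>q\<close>, the quantity \<open>t\<close>
      occurs to the first power; this is what can be integrated when \<open>t\<close> is a value of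
      \<open>tail_osc\<close>.\<close>
    finally have "w powr q \<le> (L * (t powr (1 / q) * a powr (\<theta> / s))) powr q" using w q0 by (intro powr_mono2) auto
    also have "\<dots> = L powr q * (t * a powr (q / p - 1))"
      using L ta q0 q2 by (simp add: powr_mult powr_powr mult.commute)
    also have "\<dots> \<le> L powr q * (t * a powr (q / p - 1) + a powr (q / p))" by (intro mult_left_mono) auto
    finally show ?thesis by (simp add: L_def)
  qed
qed

lemma geo_increasing_sum_le:
  assumes "0 < \<tau>"
  shows "(\<Sum>i<k. (2 ^ i) powr \<tau>) \<le> geo_const \<tau> * (2 ^ k) powr \<tau>"
proof -
  have pw: "(2 ^ i) powr \<tau> = ((2::real) powr \<tau>) ^ i" for i
    by (simp add: powr_powr powr_realpow[symmetric] mult.commute)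
  have "(\<Sum>i<k. (2 ^ i) powr \<tau>) \<le> (\<Sum>i<k. (2 ^ k) powr \<tau> * (2 powr - \<tau>) ^ (k - Suc i))"
  proof (intro sum_mono)
    fix i assume "i \<in> {..<k}"
    then have "(2::real) ^ k = 2 ^ Suc i * 2 ^ (k - Suc i)" by (subst power_add[symmetric]) simp
    then have "(2::real) ^ i \<le> 2 ^ k * (1 / 2 ^ (k - Suc i))" by simp
    then have "(2 ^ i) powr \<tau> \<le> (2 ^ k * (1 / 2 ^ (k - Suc i))) powr \<tau>"
      using assms by (intro powr_mono2) auto
    also have "\<dots> = (2 ^ k) powr \<tau> * (2 powr - \<tau>) ^ (k - Suc i)"
      by (subst powr_mult) (auto simp: two_power_powr)
    finally show "(2 ^ i) powr \<tau> \<le> (2 ^ k) powr \<tau> * (2 powr - \<tau>) ^ (k - Suc i)" .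
  qed
  also have "\<dots> = (2 ^ k) powr \<tau> * (\<Sum>i<k. (2 powr - \<tau>) ^ i)"
    unfolding sum_distrib_left[symmetric] by (subst sum.nat_diff_reindex) simp
  also have "\<dots> \<le> (2 ^ k) powr \<tau> * geo_const \<tau>" by (intro mult_left_mono geo_sum_le assms) auto
  finally show ?thesis by (simp add: mult.commute)
qed

context besov_lower
begin

text \<open>Three times the radius, because \<open>ball z (2 * rad j)\<close> stays inside for every
  \<open>z\<close> in \<open>ball x (rad n)\<close> and \<open>j \<ge> n\<close>.\<close>

definition local_tail :: "nat \<Rightarrow> 'a \<Rightarrow> ennreal" where
  "local_tail n x = (\<integral>\<^sup>+ y. tail_osc u n y * indicator (ball x (3 * rad n)) y \<partial>\<nu>)"

text \<open>One summand for each error in \<open>pointwise_hedberg\<close>: from \<open>u\<close> to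
  a fine average at \<open>z\<close>, between the averages at \<open>z\<close>, and from
  \<open>z\<close> to \<open>x\<close> at the scale \<open>rad n\<close>.\<close>

definition hedberg_const :: real where
  "hedberg_const = osc_const + (step_const * (Cd / c)) powr (1 / p) * geo_const (s / p - \<theta>) + near_const * osc_const"

text \<open>Split at the scale \<open>rad (k + n)\<close>. Below it the error is controlled by the
  value \<open>t\<close> of \<open>tail_osc\<close> at \<open>z\<close>. Above it each increment is
  controlled by \<open>local_tail\<close>, where the lower mass bound costs
  \<open>(2 ^ i) powr (s / p)\<close> at level \<open>i\<close>, so that the second term grows with
  \<open>k\<close>.\<close>

lemma pointwise_hedberg:
  assumes ps: "p * \<theta> < s" and a: "0 < a" and A: "local_tail n x \<le> ennreal (a * V x (rad n))"
    and z: "z \<in> ball x (rad n)" and t: "tail_osc u n z = ennreal t" "0 \<le> t"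
  shows "\<bar>u z - approx n x\<bar> \<le> hedberg_const * rad n powr \<theta> *
    (t powr (1 / p) * (2 ^ k) powr (- \<theta>) + a powr (1 / p) * (2 ^ k) powr (s / p - \<theta>))"
proof -
  define r where "r = rad n"
  define \<tau> where "\<tau> = s / p - \<theta>"
  have r: "0 < r" "r \<le> R" by (auto simp: r_def rad_pos rad_le_R)
  have p0: "0 < p" using p_ge_1 by simp
  have tau: "0 < \<tau>" using ps p0 by (simp add: \<tau>_def field_simps)
  have dz: "dist x z < r" using z by (simp add: r_def)
  define B where "B = (step_const * (Cd / c)) powr (1 / p)"
  have M1: "1 \<le> ((2::real) ^ k) powr \<tau>" using tau by (intro ge_one_powr_ge_zero) auto
  have rk: "rad (k + n) = r * (1 / 2 ^ k)" for k by (simp add: r_def rad_add)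
  have 1: "\<bar>u z - approx (k + n) z\<bar> \<le> osc_const * r powr \<theta> * (t powr (1 / p) * (2 ^ k) powr (- \<theta>))"
  proof -
    have "ennreal (\<bar>u z - approx (k + n) z\<bar> powr p) \<le> ennreal (osc_const powr p * rad (k + n) powr (p * \<theta>) * t)"
      using approx_error[of n "k + n" z] t by (simp flip: ennreal_mult)
    then have "\<bar>u z - approx (k + n) z\<bar> \<le> (osc_const powr p * rad (k + n) powr (p * \<theta>) * t) powr (1 / p)"
      by (rule powr_le_ennreal_imp) (use t in simp)
    also have "\<dots> = osc_const * rad (k + n) powr \<theta> * t powr (1 / p)"
      using t osc_const_pos p0 by (simp add: powr_mult powr_powr)
    also have "rad (k + n) powr \<theta> = r powr \<theta> * (2 ^ k) powr (- \<theta>)"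
      unfolding rk using r by (subst powr_mult) (auto simp: powr_divide powr_minus_divide)
    finally show ?thesis by (simp add: mult_ac)
  qed
  have 2: "\<bar>incr (i + n) z\<bar> \<le> B * (r powr \<theta> * a powr (1 / p)) * (2 ^ i) powr \<tau>" for i
  proof -
    define \<rho> where "\<rho> = rad (i + n)"
    have rho: "0 < \<rho>" "\<rho> \<le> r" "\<rho> = r * (1 / 2 ^ i)" using rad_mono[of n "i + n"] by (auto simp: \<rho>_def r_def rad_pos rad_add)
    have S: "ball z (2 * \<rho>) \<subseteq> ball x (3 * r)"
    proof
      fix y assume "y \<in> ball z (2 * \<rho>)"
      then show "y \<in> ball x (3 * r)" using dz rho dist_triangle[of x y z] by simp
    qed
    \<comment> \<open>Doubling moves the centre from \<open>x\<close> to \<open>z\<close> at the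
      radius \<open>r\<close>; the lower mass bound then descends from \<open>r\<close> to
      \<open>\<rho>\<close> at \<open>z\<close>.\<close>
    have Vz: "c * (\<rho> / r) powr s * V x r \<le> Cd * V z (2 * \<rho>)"
    proof -
      have "V x r \<le> Cd ^ 1 * V z r" using dz by (intro V_compare) auto
      then have "c * (\<rho> / r) powr s * V x r \<le> c * (\<rho> / r) powr s * (Cd * V z r)"
        using c_pos by (intro mult_left_mono) auto
      also have "\<dots> = Cd * (c * (\<rho> / r) powr s * V z r)" by simp
      also have "\<dots> \<le> Cd * V z \<rho>" using Cd_pos rho r by (intro mult_left_mono V_lower) auto
      also have "\<dots> \<le> Cd * V z (2 * \<rho>)" using Cd_pos rho by (intro mult_left_mono V_mono subset_ball) auto
      finally show ?thesis .
    qed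
    have "mean_osc u \<rho> z \<le> ennreal (\<rho> powr (p * \<theta>) / V z (2 * \<rho>)) * local_tail n x"
      unfolding \<rho>_def local_tail_def using S by (intro mean_osc_le_local) (auto simp: r_def \<rho>_def)
    also have "\<dots> \<le> ennreal (\<rho> powr (p * \<theta>) / V z (2 * \<rho>)) * ennreal (a * V x r)"
      using A by (intro mult_left_mono) (auto simp: r_def)
    also have "\<dots> = ennreal (\<rho> powr (p * \<theta>) / V z (2 * \<rho>) * (a * V x r))"
      using a by (simp flip: ennreal_mult)
    also have "\<dots> \<le> ennreal (Cd / c * (\<rho> powr (p * \<theta>) / (\<rho> / r) powr s * a))"
    proof (rule ennreal_leI)
      have pos: "0 < V z (2 * \<rho>)" "0 < (\<rho> / r) powr s" using rho r by (auto simp: V_pos)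
      have "V x r / V z (2 * \<rho>) \<le> Cd / (c * (\<rho> / r) powr s)"
        using Vz pos c_pos by (simp add: field_simps)
      then have "\<rho> powr (p * \<theta>) * a * (V x r / V z (2 * \<rho>)) \<le> \<rho> powr (p * \<theta>) * a * (Cd / (c * (\<rho> / r) powr s))"
        using a by (intro mult_left_mono) auto
      then show "\<rho> powr (p * \<theta>) / V z (2 * \<rho>) * (a * V x r) \<le> Cd / c * (\<rho> powr (p * \<theta>) / (\<rho> / r) powr s * a)"
        by (simp add: mult_ac)
    qed
    finally have "ennreal (\<bar>incr (i + n) z\<bar> powr p) \<le> ennreal step_const * ennreal (Cd / c * (\<rho> powr (p * \<theta>) / (\<rho> / r) powr s * a))"
      using step_bound[OF rad_pos integrable_u, of "i + n" z] unfolding incr_eq_step \<rho>_def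
      by (meson mult_left_mono order_trans zero_le)
    also have "\<dots> = ennreal (step_const * (Cd / c) * (\<rho> powr (p * \<theta>) / (\<rho> / r) powr s) * a)"
      using step_const_pos Cd_pos c_pos a by (simp add: mult_ac flip: ennreal_mult)
    finally have "\<bar>incr (i + n) z\<bar> \<le> (step_const * (Cd / c) * (\<rho> powr (p * \<theta>) / (\<rho> / r) powr s) * a) powr (1 / p)"
      by (rule powr_le_ennreal_imp) (use step_const_pos Cd_pos c_pos a in simp)
    also have "\<dots> = B * (\<rho> powr (p * \<theta>) / (\<rho> / r) powr s) powr (1 / p) * a powr (1 / p)"
      by (simp only: B_def powr_mult)
    also have "(\<rho> powr (p * \<theta>) / (\<rho> / r) powr s) powr (1 / p) = \<rho> powr \<theta> / (\<rho> / r) powr (s / p)"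
      using p0 by (simp add: powr_divide powr_powr powr_mult)
    also have "\<dots> = r powr \<theta> * (2 ^ i) powr \<tau>"
    proof -
      have "\<rho> / r = 1 / 2 ^ i" using rho r by simp
      moreover have "\<rho> powr \<theta> = r powr \<theta> * (1 / 2 ^ i) powr \<theta>" unfolding rho(3) by (rule powr_mult)
      ultimately show ?thesis by (simp add: \<tau>_def powr_divide powr_diff)
    qed
    finally show ?thesis by (simp add: mult_ac)
  qed
  have 3: "\<bar>approx n x - approx n z\<bar> \<le> near_const * osc_const * (r powr \<theta> * a powr (1 / p))"
  proof (cases "x = z")
    case True
    then show ?thesis using near_const_pos osc_const_pos by simp
  next
    case False
    have "ennreal (\<bar>approx n x - approx n z\<bar> powr p) \<le> ennreal ((dist x z / r * near_const * osc_const) powr p) * mean_osc u r x"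
      unfolding approx_def r_def[symmetric] using r False dz by (intro smooth_near_bound integrable_u) auto
    also have "\<dots> \<le> ennreal ((near_const * osc_const) powr p) * (ennreal (r powr (p * \<theta>) / V x (2 * r)) * local_tail n x)"
    proof (rule mult_mono)
      have "dist x z / r * (near_const * osc_const) \<le> 1 * (near_const * osc_const)"
        using dz r near_const_pos osc_const_pos by (intro mult_right_mono) auto
      then have "(dist x z / r * near_const * osc_const) powr p \<le> (near_const * osc_const) powr p"
        using near_const_pos osc_const_pos r p0 by (intro powr_mono2) auto
      then show "ennreal ((dist x z / r * near_const * osc_const) powr p) \<le> ennreal ((near_const * osc_const) powr p)"
        by (rule ennreal_leI)
      show "mean_osc u r x \<le> ennreal (r powr (p * \<theta>) / V x (2 * r)) * local_tail n x"
        unfolding local_tail_def r_def using r by (intro mean_osc_le_local subset_ball) (auto simp: r_def)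
    qed auto
    also have "\<dots> \<le> ennreal ((near_const * osc_const) powr p) * (ennreal (r powr (p * \<theta>) / V x (2 * r)) * ennreal (a * V x r))"
      using A by (intro mult_left_mono) (auto simp: r_def)
    also have "\<dots> = ennreal ((near_const * osc_const) powr p * (r powr (p * \<theta>) / V x (2 * r) * (a * V x r)))"
      using a by (simp flip: ennreal_mult)
    also have "\<dots> \<le> ennreal ((near_const * osc_const) powr p * (r powr (p * \<theta>) * a))"
    proof (intro ennreal_leI mult_left_mono)
      have "V x r \<le> V x (2 * r)" using r by (intro V_mono subset_ball) auto
      then have "V x r / V x (2 * r) \<le> 1" using V_pos[of "2 * r" x] r by simp
      then have "r powr (p * \<theta>) * a * (V x r / V x (2 * r)) \<le> r powr (p * \<theta>) * a * 1"
        using a by (intro mult_left_mono) auto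
      then show "r powr (p * \<theta>) / V x (2 * r) * (a * V x r) \<le> r powr (p * \<theta>) * a" by (simp add: mult_ac)
    qed simp
    finally have "\<bar>approx n x - approx n z\<bar> \<le> ((near_const * osc_const) powr p * (r powr (p * \<theta>) * a)) powr (1 / p)"
      by (rule powr_le_ennreal_imp) (use a in simp)
    also have "\<dots> = near_const * osc_const * (r powr \<theta> * a powr (1 / p))"
      using near_const_pos osc_const_pos p0 by (simp add: powr_mult powr_powr)
    finally show ?thesis .
  qed
  have "approx (k + n) z - approx n z = (\<Sum>i<k. incr (i + n) z)"
    using sum_lessThan_telescope[of "\<lambda>i. approx (i + n) z" k] by (simp add: incr_def)
  then have "\<bar>approx (k + n) z - approx n z\<bar> \<le> (\<Sum>i<k. \<bar>incr (i + n) z\<bar>)" by (simp add: sum_abs)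
  also have "\<dots> \<le> (\<Sum>i<k. B * (r powr \<theta> * a powr (1 / p)) * (2 ^ i) powr \<tau>)" by (intro sum_mono 2)
  also have "\<dots> = B * (r powr \<theta> * a powr (1 / p)) * (\<Sum>i<k. (2 ^ i) powr \<tau>)" by (simp add: sum_distrib_left)
  also have "\<dots> \<le> B * (r powr \<theta> * a powr (1 / p)) * (geo_const \<tau> * (2 ^ k) powr \<tau>)"
    by (intro mult_left_mono geo_increasing_sum_le tau) (auto simp: B_def)
  finally have H2: "\<bar>approx (k + n) z - approx n z\<bar> \<le> B * geo_const \<tau> * (r powr \<theta> * (a powr (1 / p) * (2 ^ k) powr \<tau>))"
    by (simp add: mult_ac)
  \<comment> \<open>This error does not depend on \<open>k\<close>; the power of
    \<open>2 ^ k\<close> is at least 1, so it is absorbed into the second term.\<close>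
  have "near_const * osc_const * (r powr \<theta> * a powr (1 / p)) * 1 \<le> near_const * osc_const * (r powr \<theta> * a powr (1 / p)) * (2 ^ k) powr \<tau>"
    using near_const_pos osc_const_pos by (intro mult_left_mono M1) auto
  with 3 have H3: "\<bar>approx n x - approx n z\<bar> \<le> near_const * osc_const * (r powr \<theta> * (a powr (1 / p) * (2 ^ k) powr \<tau>))"
    by (simp add: mult_ac)
  define T where "T = r powr \<theta> * (t powr (1 / p) * (2 ^ k) powr (- \<theta>))"
  define Y where "Y = r powr \<theta> * (a powr (1 / p) * (2 ^ k) powr \<tau>)"
  have TY: "0 \<le> T" "0 \<le> Y" by (auto simp: T_def Y_def)
  have geo: "0 \<le> B * geo_const \<tau>" using geo_const_ge_1[OF tau] by (simp add: B_def)
  have "\<bar>u z - approx n x\<bar> \<le> \<bar>u z - approx (k + n) z\<bar> + \<bar>approx (k + n) z - approx n z\<bar> + \<bar>approx n x - approx n z\<bar>" by simp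
  also have "\<dots> \<le> osc_const * T + B * geo_const \<tau> * Y + near_const * osc_const * Y"
    using 1 H2 H3 by (simp add: T_def Y_def mult.assoc)
  also have "\<dots> \<le> hedberg_const * T + hedberg_const * Y"
  proof -
    have "osc_const * T \<le> hedberg_const * T"
      using TY geo near_const_pos osc_const_pos by (intro mult_right_mono) (auto simp: hedberg_const_def B_def \<tau>_def)
    moreover have "(B * geo_const \<tau> + near_const * osc_const) * Y \<le> hedberg_const * Y"
      using TY osc_const_pos by (intro mult_right_mono) (auto simp: hedberg_const_def B_def \<tau>_def)
    ultimately show ?thesis by (simp add: distrib_right)
  qed
  finally show ?thesis by (simp add: T_def Y_def r_def \<tau>_def algebra_simps)
qed

lemma hedberg_const_pos:
  assumes "p * \<theta> < s"
  shows "0 < hedberg_const"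
proof -
  have "0 < s / p - \<theta>" using assms p_ge_1 by (simp add: field_simps)
  then have "0 \<le> geo_const (s / p - \<theta>)" using geo_const_ge_1[of "s / p - \<theta>"] by simp
  then show ?thesis using osc_const_pos near_const_pos
    by (simp add: hedberg_const_def add_pos_nonneg)
qed

end

section \<open>Vitali covering and the exceptional set\<close>

context doubling_space
begin

text \<open>The index \<open>n x\<close> stands for the size of a ball, a smaller index meaning a
  larger ball in the application. Well-foundedness of the natural numbers then supplies a largest
  candidate, with no need for almost maximal radii.\<close>

lemma vitali_covering:
  fixes K :: "'a set" and n :: "'a \<Rightarrow> nat" and r :: "nat \<Rightarrow> real"
  assumes r: "\<And>i. 0 < r i"
  obtains C where "C \<subseteq> K" "countable C" "disjoint_family_on (\<lambda>x. ball x (r (n x))) C"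
    "\<And>x. x \<in> K \<Longrightarrow> \<exists>y\<in>C. ball x (r (n x)) \<inter> ball y (r (n y)) \<noteq> {} \<and> n y \<le> n x"
proof -
  define meets where "meets x y \<longleftrightarrow> ball x (r (n x)) \<inter> ball y (r (n y)) \<noteq> {}" for x y
  \<comment> \<open>The last condition, that a ball meeting the family meets a member of no larger
    index, encodes the greedy selection and survives unions of chains.\<close>
  define \<A> where "\<A> = {C. C \<subseteq> K \<and> (\<forall>x\<in>C. \<forall>y\<in>C. x \<noteq> y \<longrightarrow> \<not> meets x y) \<and>
     (\<forall>x\<in>K. (\<exists>y\<in>C. meets x y) \<longrightarrow> (\<exists>y\<in>C. meets x y \<and> n y \<le> n x))}"
  have meets_sym: "meets x y \<longleftrightarrow> meets y x" for x y by (auto simp: meets_def)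
  have meets_refl: "meets x x" for x using r[of "n x"] by (auto simp: meets_def)
  have "\<exists>M\<in>\<A>. \<forall>X\<in>\<A>. M \<subseteq> X \<longrightarrow> X = M"
  proof (rule subset_Zorn')
    fix \<C> assume ch: "subset.chain \<A> \<C>"
    then have sub: "\<C> \<subseteq> \<A>" and tot: "\<And>X Y. X \<in> \<C> \<Longrightarrow> Y \<in> \<C> \<Longrightarrow> X \<subseteq> Y \<or> Y \<subseteq> X"
      by (auto simp: subset_chain_def)
    have "\<Union>\<C> \<subseteq> K" using sub by (auto simp: \<A>_def)
    moreover have "\<not> meets x y" if xy: "x \<in> \<Union>\<C>" "y \<in> \<Union>\<C>" "x \<noteq> y" for x y
    proof -
      obtain X Y where XY: "X \<in> \<C>" "Y \<in> \<C>" "x \<in> X" "y \<in> Y" using xy by blast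
      then obtain Z where "Z \<in> \<C>" "x \<in> Z" "y \<in> Z" using tot[of X Y] by blast
      then show ?thesis using sub xy(3) by (auto simp: \<A>_def)
    qed
    moreover have "\<exists>y\<in>\<Union>\<C>. meets x y \<and> n y \<le> n x" if x: "x \<in> K" "\<exists>y\<in>\<Union>\<C>. meets x y" for x
    proof -
      obtain X y where "X \<in> \<C>" "y \<in> X" "meets x y" using x by blast
      moreover from this have "X \<in> \<A>" using sub by blast
      ultimately have "\<exists>y\<in>X. meets x y \<and> n y \<le> n x" using x(1) by (auto simp: \<A>_def)
      then show ?thesis using \<open>X \<in> \<C>\<close> by blast
    qed
    ultimately show "\<Union>\<C> \<in> \<A>" by (auto simp: \<A>_def)
  qed
  then obtain M where M: "M \<in> \<A>" and max: "\<And>X. X \<in> \<A> \<Longrightarrow> M \<subseteq> X \<Longrightarrow> X = M" by blast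
  have MK: "M \<subseteq> K" and Md: "\<And>x y. x \<in> M \<Longrightarrow> y \<in> M \<Longrightarrow> x \<noteq> y \<Longrightarrow> \<not> meets x y"
    and Mn: "\<And>x. x \<in> K \<Longrightarrow> \<exists>y\<in>M. meets x y \<Longrightarrow> \<exists>y\<in>M. meets x y \<and> n y \<le> n x"
    using M by (auto simp: \<A>_def)
  have all: "\<exists>y\<in>M. meets x y" if x: "x \<in> K" for x
  proof (rule ccontr)
    assume no: "\<not> (\<exists>y\<in>M. meets x y)"
    define P where "P z \<longleftrightarrow> z \<in> K \<and> \<not> (\<exists>y\<in>M. meets z y)" for z
    have "P x" using x no by (simp add: P_def)
    \<comment> \<open>A ball of least index among those missing the family could be added to it,
      against maximality.\<close>
    then obtain z where z: "P z" "\<And>y. P y \<Longrightarrow> n z \<le> n y" using ex_has_least_nat[of P x n] by blast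
    have "insert z M \<in> \<A>"
      unfolding \<A>_def
    proof (intro CollectI conjI ballI impI)
      show "insert z M \<subseteq> K" using z MK by (auto simp: P_def)
    next
      fix a b assume "a \<in> insert z M" "b \<in> insert z M" "a \<noteq> b"
      then show "\<not> meets a b" using z(1) Md meets_sym by (auto simp: P_def)
    next
      fix a assume a: "a \<in> K" "\<exists>y\<in>insert z M. meets a y"
      show "\<exists>y\<in>insert z M. meets a y \<and> n y \<le> n a"
      proof (cases "\<exists>y\<in>M. meets a y")
        case True
        then show ?thesis using Mn[OF a(1)] by blast
      next
        case False
        then have "P a" using a(1) by (simp add: P_def)
        then have "n z \<le> n a" by (rule z(2))
        then show ?thesis using a(2) False by blast
      qed
    qed
    then have "z \<in> M" using max[of "insert z M"] by blast
    then show False using z(1) meets_refl[of z] by (auto simp: P_def)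
  qed
  obtain D :: "'a set" where D: "countable D" "\<And>x e. 0 < e \<Longrightarrow> \<exists>d\<in>D. dist x d < e" using countable_dense by blast
  \<comment> \<open>Disjoint balls contain different points of a countable dense set.\<close>
  have "\<forall>x. \<exists>d. d \<in> D \<and> d \<in> ball x (r (n x))" using D(2)[OF r] by (metis mem_ball)
  from choice[OF this] obtain g where g: "\<And>x. g x \<in> D" "\<And>x. g x \<in> ball x (r (n x))" by blast
  have "inj_on g M"
  proof (rule inj_onI, rule ccontr)
    fix x y assume xy: "x \<in> M" "y \<in> M" "g x = g y" "x \<noteq> y"
    have "g x \<in> ball x (r (n x)) \<inter> ball y (r (n y))" using g(2)[of x] g(2)[of y] xy(3) by simp
    then show False using Md[OF xy(1,2,4)] by (auto simp only: meets_def)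
  qed
  moreover have "countable (g ` M)" using D(1) g(1) by (auto intro: countable_subset)
  ultimately have "countable M" by (rule countable_image_inj_on[rotated])
  moreover have "disjoint_family_on (\<lambda>x. ball x (r (n x))) M"
    using Md by (auto simp: disjoint_family_on_def meets_def)
  ultimately show ?thesis using that[of M] MK all Mn by (simp add: meets_def)
qed

end

context besov_lower
begin

lemma cap_empty: "cap {} = 0"
proof -
  have "cap {} \<le> besov_cost (\<lambda>_. 0)" by (rule cap_le[of _ "{}"]) auto
  also have "\<dots> = 0" by (simp add: besov_cost_def energy_eq)
  finally show ?thesis by simp
qed

text \<open>Up to \<open>\<delta>\<close> and constants the threshold is the bound of
  \<open>cap_ball_le\<close> for the capacity of a ball: the points are centres of balls whose
  capacity is paid for by the local mass of \<open>tail_osc\<close>.\<close>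

definition concentration_set :: "real \<Rightarrow> nat \<Rightarrow> 'a set" where
  "concentration_set \<delta> m = {x. \<exists>n\<ge>m. ennreal (\<delta> * rad n powr (- (p * \<theta>)) * V x (rad n)) < local_tail n x}"

text \<open>Select disjoint balls of radius \<open>3 * rad (n x)\<close>; those of radius
  \<open>8 * rad (n x)\<close> about the same centres cover the set. The capacity of each large ball
  is at most a multiple of the mass of \<open>tail_osc\<close> on the small one, and by disjointness
  these masses sum to at most \<open>tail m\<close>.\<close>

lemma cap_concentration_set_le:
  assumes d: "0 < \<delta>"
  shows "cap (concentration_set \<delta> m) \<le> ennreal (cap_ball_const * Cd ^ 3 / \<delta>) * tail m"
proof -
  define K where "K = concentration_set \<delta> m"
  have "\<forall>x. \<exists>n. x \<in> K \<longrightarrow> m \<le> n \<and> ennreal (\<delta> * rad n powr (- (p * \<theta>)) * V x (rad n)) < local_tail n x"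
    by (auto simp: K_def concentration_set_def)
  from choice[OF this] obtain n where n: "\<And>x. x \<in> K \<Longrightarrow> m \<le> n x"
    "\<And>x. x \<in> K \<Longrightarrow> ennreal (\<delta> * rad (n x) powr (- (p * \<theta>)) * V x (rad (n x))) < local_tail (n x) x" by blast
  define r where "r i = 3 * rad i" for i
  have r: "0 < r i" for i by (simp add: r_def rad_pos)
  obtain C where C: "C \<subseteq> K" "countable C" "disjoint_family_on (\<lambda>x. ball x (r (n x))) C"
    and meet: "\<And>x. x \<in> K \<Longrightarrow> \<exists>y\<in>C. ball x (r (n x)) \<inter> ball y (r (n y)) \<noteq> {} \<and> n y \<le> n x"
    by (rule vitali_covering[where K = K and n = n and r = r, OF r]) (rule that; blast)
  define I where "I = to_nat_on C ` C"
  \<comment> \<open>Two selected-radius balls that meet have centres less than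
    \<open>6 * rad (n y)\<close> apart for the larger one at \<open>y\<close>; 8 rounds this up to
    three doublings.\<close>
  define E where "E i = (if i \<in> I then ball (from_nat_into C i) (8 * rad (n (from_nat_into C i))) else {})" for i
  define B where "B i = (if i \<in> I then ball (from_nat_into C i) (r (n (from_nat_into C i))) else {})" for i
  have fI: "from_nat_into C i \<in> C" if "i \<in> I" for i
    using that C(2) unfolding I_def by (metis from_nat_into_to_nat_on imageE)
  have cover: "K \<subseteq> (\<Union>i. E i)"
  proof
    fix x assume x: "x \<in> K"
    obtain y w where y: "y \<in> C" "w \<in> ball x (r (n x))" "w \<in> ball y (r (n y))" "n y \<le> n x" using meet[OF x] by blast
    have "dist y x \<le> dist y w + dist w x" by (rule dist_triangle)
    also have "\<dots> < r (n y) + r (n x)" using y by (simp add: dist_commute)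
    also have "\<dots> \<le> 6 * rad (n y)" using rad_mono[OF y(4)] by (simp add: r_def)
    finally have "x \<in> ball y (8 * rad (n y))" using rad_pos[of "n y"] by simp
    moreover have "to_nat_on C y \<in> I" using y(1) unfolding I_def by (rule imageI)
    moreover have "from_nat_into C (to_nat_on C y) = y" by (rule from_nat_into_to_nat_on[OF C(2) y(1)])
    ultimately show "x \<in> (\<Union>i. E i)" by (intro UN_I[of "to_nat_on C y"]) (auto simp: E_def)
  qed
  have disj: "disjoint_family B"
  proof (unfold disjoint_family_on_def, intro ballI impI)
    fix i j :: nat assume ij: "i \<noteq> j"
    show "B i \<inter> B j = {}"
    proof (cases "i \<in> I \<and> j \<in> I")
      case True
      then have "from_nat_into C i \<noteq> from_nat_into C j" using ij C(2) unfolding I_def by (metis from_nat_into_to_nat_on imageE)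
      then show ?thesis using True fI C(3) by (auto simp: B_def disjoint_family_on_def)
    qed (auto simp: B_def)
  qed
  define L where "L = ennreal (cap_ball_const * Cd ^ 3 / \<delta>)"
  have capE: "cap (E i) \<le> L * (\<integral>\<^sup>+ y. tail_osc u m y * indicator (B i) y \<partial>\<nu>)" for i
  proof (cases "i \<in> I")
    case True
    define x where "x = from_nat_into C i"
    define \<rho> where "\<rho> = rad (n x)"
    have x: "x \<in> K" using fI[OF True] C(1) by (auto simp: x_def)
    have rho: "0 < \<rho>" "\<rho> \<le> R" by (auto simp: \<rho>_def rad_pos rad_le_R)
    have "cap (ball x (8 * \<rho>)) \<le> ennreal (cap_ball_const * V x (8 * \<rho>) * (8 * \<rho>) powr (- (p * \<theta>)))"
      using rho by (intro cap_ball_le) auto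
    also have "\<dots> \<le> ennreal (cap_ball_const * Cd ^ 3 / \<delta> * (\<delta> * \<rho> powr (- (p * \<theta>)) * V x \<rho>))"
    proof (rule ennreal_leI)
      have 1: "V x (8 * \<rho>) \<le> Cd ^ 3 * V x \<rho>" using V_double_pow[of x 3 \<rho>] by simp
      have 2: "(8 * \<rho>) powr (- (p * \<theta>)) \<le> \<rho> powr (- (p * \<theta>))"
        using rho p_ge_1 theta by (intro powr_mono2') auto
      have "cap_ball_const * V x (8 * \<rho>) * (8 * \<rho>) powr (- (p * \<theta>)) \<le> cap_ball_const * (Cd ^ 3 * V x \<rho>) * \<rho> powr (- (p * \<theta>))"
        using cap_ball_const_pos Cd_pos by (intro mult_mono mult_left_mono 1 2) auto
      then show "cap_ball_const * V x (8 * \<rho>) * (8 * \<rho>) powr (- (p * \<theta>)) \<le> cap_ball_const * Cd ^ 3 / \<delta> * (\<delta> * \<rho> powr (- (p * \<theta>)) * V x \<rho>)"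
        using d by (simp add: mult_ac)
    qed
    also have "\<dots> = L * ennreal (\<delta> * \<rho> powr (- (p * \<theta>)) * V x \<rho>)"
      unfolding L_def using d cap_ball_const_pos Cd_pos by (intro ennreal_mult) auto
    also have "\<dots> \<le> L * local_tail (n x) x" using n(2)[OF x] by (intro mult_left_mono) (auto simp: \<rho>_def)
    also have "\<dots> \<le> L * (\<integral>\<^sup>+ y. tail_osc u m y * indicator (B i) y \<partial>\<nu>)"
      unfolding local_tail_def using True n(1)[OF x]
      by (intro mult_left_mono nn_integral_mono mult_mono tail_osc_mono) (auto simp: B_def x_def r_def)
    finally show ?thesis using True by (simp add: E_def x_def \<rho>_def)
  qed (simp add: E_def cap_empty)
  have Bm: "B i \<in> sets \<nu>" for i by (auto simp: B_def)
  have "cap K \<le> cap (\<Union>i. E i)" by (rule cap_mono[OF cover])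
  also have "\<dots> \<le> (\<Sum>i. cap (E i))" by (rule cap_countable_subadditive)
  also have "\<dots> \<le> (\<Sum>i. L * (\<integral>\<^sup>+ y. tail_osc u m y * indicator (B i) y \<partial>\<nu>))" by (intro suminf_le capE) auto
  \<comment> \<open>The masses are values of the measure with density \<open>tail_osc u m\<close>,
    so countable additivity applies.\<close>
  also have "\<dots> = L * (\<Sum>i. emeasure (density \<nu> (tail_osc u m)) (B i))"
    using Bm by (simp add: emeasure_density)
  also have "\<dots> = L * emeasure (density \<nu> (tail_osc u m)) (\<Union>i. B i)"
    using Bm disj by (subst suminf_emeasure) auto
  also have "\<dots> \<le> L * emeasure (density \<nu> (tail_osc u m)) (space (density \<nu> (tail_osc u m)))"
    by (intro mult_left_mono emeasure_space) auto
  also have "\<dots> = L * tail m"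
    using sets.top[of \<nu>] by (simp add: emeasure_density tail_def)
  finally show ?thesis by (simp add: K_def L_def)
qed

text \<open>Two reasons to exclude a point: the averages may fail to converge, or the local mass of
  \<open>tail_osc\<close>, rescaled by radius and volume, fails to tend to 0. The second means lying
  in the concentration sets of some level \<open>1 / Suc k\<close> for every
  \<open>m\<close>.\<close>

definition exceptional_set :: "'a set" where
  "exceptional_set = {x. Phi 0 x = \<infinity>} \<union> (\<Union>k. \<Inter>m. concentration_set (1 / Suc k) m)"

lemma cap_null_Un:
  assumes "cap A = 0" "cap B = 0"
  shows "cap (A \<union> B) = 0"
proof -
  define E where "E i = (if i = 0 then A else B)" for i :: nat
  have "cap (A \<union> B) \<le> cap (\<Union>i. E i)"
    by (intro cap_mono) (auto simp: E_def intro: exI[of _ 0] exI[of _ "Suc 0"])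
  also have "\<dots> \<le> (\<Sum>i. cap (E i))" by (rule cap_countable_subadditive)
  also have "\<dots> = 0"
  proof -
    have "cap (E i) = 0" for i using assms by (simp add: E_def)
    then show ?thesis by simp
  qed
  finally show ?thesis by simp
qed

text \<open>At a fixed level \<open>1 / Suc k\<close> the capacity of the concentration set is at
  most a multiple of \<open>tail m\<close>, which tends to 0.\<close>

lemma cap_exceptional_set: "cap exceptional_set = 0"
  unfolding exceptional_set_def
proof (rule cap_null_Un[OF cap_Phi_infinite])
  have zero: "cap (\<Inter>m. concentration_set (1 / Suc k) m) = 0" for k
  proof -
    have "cap (\<Inter>m. concentration_set (1 / Suc k) m) \<le> 0"
    proof (rule ennreal_le_epsilon)
      fix e :: real assume e: "0 < e"
      define L where "L = cap_ball_const * Cd ^ 3 / (1 / Suc k)"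
      have "\<forall>\<^sub>F m in sequentially. ennreal L * tail m \<le> ennreal e"
        using cap_ball_const_pos Cd_pos e by (intro eventually_tail_small) (auto simp: L_def)
      then obtain m where m: "ennreal L * tail m \<le> ennreal e"
        using eventually_happens'[OF sequentially_bot] by blast
      have "cap (\<Inter>m. concentration_set (1 / Suc k) m) \<le> cap (concentration_set (1 / Suc k) m)"
        by (intro cap_mono) auto
      also have "\<dots> \<le> ennreal L * tail m" unfolding L_def by (rule cap_concentration_set_le) simp
      finally show "cap (\<Inter>m. concentration_set (1 / Suc k) m) \<le> 0 + ennreal e" using m by simp
    qed
    then show ?thesis by simp
  qed
  have "cap (\<Union>k. \<Inter>m. concentration_set (1 / Suc k) m) \<le> (\<Sum>k. cap (\<Inter>m. concentration_set (1 / Suc k) m))"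
    by (rule cap_countable_subadditive)
  also have "\<dots> = 0" unfolding zero by simp
  finally show "cap (\<Union>k. \<Inter>m. concentration_set (1 / Suc k) m) = 0" by simp
qed

definition poincare_const :: "real \<Rightarrow> real" where
  "poincare_const q = 2 * (hedberg_const * (2 powr \<theta> + 1)) powr q"

lemma poincare_const_nonneg: "0 \<le> poincare_const q" by (simp add: poincare_const_def)

text \<open>Hedberg's bound is linear in \<open>tail_osc\<close>, so its integral over the ball is
  at most a multiple of \<open>local_tail\<close>, which is again at most \<open>a\<close> times the
  volume. Both terms then carry the same power of \<open>a\<close>; hence the factor 2 in
  \<open>poincare_const\<close>.\<close>

lemma sobolev_poincare:
  assumes ps: "p * \<theta> < s" and q: "q = s * p / (s - p * \<theta>)" and b: "0 < b"
    and A: "local_tail n x \<le> ennreal (b * rad n powr (- (p * \<theta>)) * V x (rad n))"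
  shows "(\<integral>\<^sup>+ z. ennreal (\<bar>u z - approx n x\<bar> powr q) * indicator (ball x (rad n)) z \<partial>\<nu>)
    \<le> ennreal (poincare_const q * b powr (q / p) * V x (rad n))"
proof -
  define r where "r = rad n"
  define a where "a = b * r powr (- (p * \<theta>))"
  have r: "0 < r" by (simp add: r_def rad_pos)
  have a: "0 < a" using b r by (simp add: a_def)
  have A': "local_tail n x \<le> ennreal (a * V x (rad n))" using A by (simp add: a_def r_def)
  define W where "W = (hedberg_const * r powr \<theta> * (2 powr \<theta> + 1)) powr q"
  have H: "0 \<le> hedberg_const" using hedberg_const_pos[OF ps] by simp
  have W: "0 \<le> W" by (simp add: W_def)
  have pw: "ennreal (\<bar>u z - approx n x\<bar> powr q) * indicator (ball x r) z
     \<le> ennreal (W * a powr (q / p - 1)) * (tail_osc u n z * indicator (ball x (3 * r)) z)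
       + ennreal (W * a powr (q / p)) * indicator (ball x r) z" for z
  proof (cases "z \<in> ball x r")
    case True
    have z3: "z \<in> ball x (3 * r)" using True r by auto
    show ?thesis
    proof (cases "tail_osc u n z")
      case (real t)
      have "\<bar>u z - approx n x\<bar> powr q \<le> W * (t * a powr (q / p - 1) + a powr (q / p))"
        unfolding W_def
      proof (rule hedberg_optimise[OF p_ge_1 theta(1) ps q real(1) a])
        show "\<bar>u z - approx n x\<bar> \<le> hedberg_const * r powr \<theta> *
          (t powr (1 / p) * (2 ^ k) powr (- \<theta>) + a powr (1 / p) * (2 ^ k) powr (s / p - \<theta>))" for k
          unfolding r_def using True real by (intro pointwise_hedberg[OF ps a A']) (auto simp: r_def)
      qed (use H in auto)
      then have "ennreal (\<bar>u z - approx n x\<bar> powr q) \<le> ennreal (W * a powr (q / p - 1) * t + W * a powr (q / p))"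
        by (intro ennreal_leI) (simp add: algebra_simps)
      also have "\<dots> = ennreal (W * a powr (q / p - 1)) * ennreal t + ennreal (W * a powr (q / p))"
        using W real by (simp add: ennreal_mult)
      finally show ?thesis using True z3 real by simp
    next
      case top
      show ?thesis
      proof (cases "W = 0")
        case True
        then have "hedberg_const * r powr \<theta> * (2 powr \<theta> + 1) = 0" by (simp add: W_def)
        then show ?thesis using hedberg_const_pos[OF ps] r by (simp add: add_pos_pos less_imp_neq[symmetric])
      next
        case False
        then have "ennreal (W * a powr (q / p - 1)) * (tail_osc u n z * indicator (ball x (3 * r)) z) = top"
          using W a z3 top by (simp add: ennreal_mult_top)
        then show ?thesis by simp
      qed
    qed
  qed simp
  have "(\<integral>\<^sup>+ z. ennreal (\<bar>u z - approx n x\<bar> powr q) * indicator (ball x r) z \<partial>\<nu>)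
    \<le> (\<integral>\<^sup>+ z. ennreal (W * a powr (q / p - 1)) * (tail_osc u n z * indicator (ball x (3 * r)) z)
       + ennreal (W * a powr (q / p)) * indicator (ball x r) z \<partial>\<nu>)"
    by (intro nn_integral_mono pw)
  also have "\<dots> = ennreal (W * a powr (q / p - 1)) * local_tail n x + ennreal (W * a powr (q / p)) * ennreal (V x r)"
    unfolding local_tail_def r_def[symmetric]
    by (subst nn_integral_add) (auto simp: nn_integral_cmult emeasure_ball)
  also have "\<dots> \<le> ennreal (W * a powr (q / p - 1)) * ennreal (a * V x r) + ennreal (W * a powr (q / p)) * ennreal (V x r)"
    using A' by (intro add_right_mono mult_left_mono) (auto simp: r_def)
  also have "\<dots> = ennreal (W * a powr (q / p - 1) * (a * V x r) + W * a powr (q / p) * V x r)"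
    using W a by (simp flip: ennreal_mult ennreal_plus)
  also have "W * a powr (q / p - 1) * (a * V x r) + W * a powr (q / p) * V x r = 2 * W * a powr (q / p) * V x r"
    using a by (simp add: powr_diff)
  \<comment> \<open>The powers of the radius cancel: \<open>W\<close> contains
    \<open>(r powr \<theta>) powr q\<close>, and \<open>a powr (q / p)\<close> its inverse.\<close>
  also have "2 * W * a powr (q / p) = poincare_const q * b powr (q / p)"
  proof -
    have "(r powr (- (p * \<theta>))) powr (q / p) = 1 / (r powr \<theta>) powr q"
    proof -
      have "- (p * \<theta>) * (q / p) = - (\<theta> * q)" using p_ge_1 by simp
      then have "(r powr (- (p * \<theta>))) powr (q / p) = r powr (- (\<theta> * q))" by (simp only: powr_powr)
      then show ?thesis by (simp only: powr_powr powr_minus_divide)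
    qed
    then show ?thesis using r
      by (simp add: W_def a_def poincare_const_def powr_mult)
  qed
  finally show ?thesis by (simp add: r_def)
qed

text \<open>At \<open>n = 0\<close> the ball is the whole space, so the Sobolev-Poincare inequality
  is global. There \<open>b\<close> only has to be large, and \<open>t + 1\<close> keeps it
  positive.\<close>

lemma Lq_besov:
  assumes ps: "p * \<theta> < s" and q: "q = s * p / (s - p * \<theta>)"
  shows "u \<in> Lp_space \<nu> q"
proof -
  have q0: "0 < q" using q s_pos p_ge_1 ps by (auto intro!: divide_pos_pos mult_pos_pos)
  define x0 :: 'a where "x0 = undefined"
  obtain t where t: "tail 0 = ennreal t" "0 \<le> t" using tail_0_finite by (cases "tail 0") auto
  define v where "v = R powr (- (p * \<theta>)) * V x0 R"
  have v: "0 < v" using R_pos V_pos[OF R_pos] by (simp add: v_def)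
  define b where "b = (t + 1) / v"
  have b: "0 < b" using t v by (simp add: b_def)
  have "local_tail 0 x0 \<le> tail 0" unfolding local_tail_def tail_def
    by (intro nn_integral_mono) (auto simp: indicator_def)
  also have "\<dots> \<le> ennreal (b * rad 0 powr (- (p * \<theta>)) * V x0 (rad 0))"
    using t v by (simp add: b_def rad_0 v_def[symmetric] mult.assoc ennreal_leI)
  finally have "(\<integral>\<^sup>+ z. ennreal (\<bar>u z - approx 0 x0\<bar> powr q) * indicator (ball x0 (rad 0)) z \<partial>\<nu>)
    \<le> ennreal (poincare_const q * b powr (q / p) * V x0 (rad 0))"
    by (rule sobolev_poincare[OF ps q b])
  then have fin: "(\<integral>\<^sup>+ z. ennreal (\<bar>u z - approx 0 x0\<bar> powr q) \<partial>\<nu>) < \<infinity>"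
    by (auto simp: rad_0 intro: le_less_trans)
  define e where "e = approx 0 x0"
  have "(\<integral>\<^sup>+ z. ennreal (\<bar>u z\<bar> powr q) \<partial>\<nu>) \<le>
     (\<integral>\<^sup>+ z. ennreal (2 powr q) * (ennreal (\<bar>u z - e\<bar> powr q) + ennreal (\<bar>e\<bar> powr q)) \<partial>\<nu>)"
  proof (intro nn_integral_mono)
    fix z
    have "ennreal (\<bar>u z\<bar> powr q) \<le> ennreal ((\<bar>u z - e\<bar> + \<bar>e\<bar>) powr q)"
      using q0 by (intro ennreal_leI powr_mono2) auto
    also have "\<dots> \<le> ennreal (2 powr q) * (ennreal (\<bar>u z - e\<bar> powr q) + ennreal (\<bar>e\<bar> powr q))"
      using q0 by (intro ennreal_powr_add_le) auto
    finally show "ennreal (\<bar>u z\<bar> powr q) \<le> \<dots>" .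
  qed
  also have "\<dots> = ennreal (2 powr q) * ((\<integral>\<^sup>+ z. ennreal (\<bar>u z - e\<bar> powr q) \<partial>\<nu>) + ennreal (\<bar>e\<bar> powr q) * emeasure \<nu> UNIV)"
    by (simp add: nn_integral_cmult nn_integral_add)
  also have "\<dots> < \<infinity>" using fin by (simp add: e_def ennreal_mult_less_top emeasure_eq_measure)
  finally show ?thesis by (simp add: Lp_space_def integrable_powr_iff)
qed

lemma Lq_precise:
  assumes ps: "p * \<theta> < s" and q: "q = s * p / (s - p * \<theta>)"
  shows "precise \<in> Lp_space \<nu> q"
proof -
  have "(\<integral>\<^sup>+ z. ennreal (\<bar>precise z\<bar> powr q) \<partial>\<nu>) = (\<integral>\<^sup>+ z. ennreal (\<bar>u z\<bar> powr q) \<partial>\<nu>)"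
    using precise_AE by (intro nn_integral_cong_AE) auto
  then show ?thesis using Lq_besov[OF assms] by (simp add: Lp_space_def integrable_powr_iff)
qed

text \<open>An arbitrary radius is compared with the next larger dyadic one at the cost of a factor
  \<open>Cd\<close> in the volume; \<open>approx n x\<close> is the intermediate value between
  \<open>u y\<close> and \<open>precise x\<close>.\<close>

lemma mean_power_le:
  assumes ps: "p * \<theta> < s" and q: "q = s * p / (s - p * \<theta>)" and b: "0 < b"
    and A: "local_tail n x \<le> ennreal (b * rad n powr (- (p * \<theta>)) * V x (rad n))"
    and r: "rad (Suc n) \<le> r" "r < rad n"
  shows "(LINT y:ball x r|\<nu>. \<bar>precise y - precise x\<bar> powr q) / measure \<nu> (ball x r)
    \<le> Cd * 2 powr q * (poincare_const q * b powr (q / p) + \<bar>approx n x - precise x\<bar> powr q)"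
proof -
  have q0: "0 < q" using q s_pos p_ge_1 ps by (auto intro!: divide_pos_pos mult_pos_pos)
  define N where "N = rad n"
  define e where "e = \<bar>approx n x - precise x\<bar> powr q"
  define P where "P = poincare_const q * b powr (q / p)"
  have P: "0 \<le> P" "0 \<le> e" using poincare_const_nonneg by (auto simp: P_def e_def)
  have r0: "0 < r" using rad_pos[of "Suc n"] r by linarith
  have VN: "V x N \<le> Cd * V x r"
  proof -
    have "V x N \<le> V x (2 * r)" using r by (intro V_mono subset_ball) (simp add: N_def rad_Suc)
    also have "\<dots> \<le> Cd * V x r" by (rule V_double)
    finally show ?thesis .
  qed
  have "(\<integral>\<^sup>+ y. ennreal (\<bar>precise y - precise x\<bar> powr q) * indicator (ball x r) y \<partial>\<nu>)
     \<le> (\<integral>\<^sup>+ y. ennreal (2 powr q) * (ennreal (\<bar>u y - approx n x\<bar> powr q) * indicator (ball x N) y + ennreal e * indicator (ball x N) y) \<partial>\<nu>)"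
  proof (intro nn_integral_mono_AE eventually_mono[OF precise_AE])
    fix y assume y: "precise y = u y"
    show "ennreal (\<bar>precise y - precise x\<bar> powr q) * indicator (ball x r) y
      \<le> ennreal (2 powr q) * (ennreal (\<bar>u y - approx n x\<bar> powr q) * indicator (ball x N) y + ennreal e * indicator (ball x N) y)"
    proof (cases "y \<in> ball x r")
      case True
      then have "y \<in> ball x N" using r by (simp add: N_def)
      have "ennreal (\<bar>precise y - precise x\<bar> powr q) \<le> ennreal ((\<bar>u y - approx n x\<bar> + \<bar>approx n x - precise x\<bar>) powr q)"
        unfolding y using q0 by (intro ennreal_leI powr_mono2) auto
      also have "\<dots> \<le> ennreal (2 powr q) * (ennreal (\<bar>u y - approx n x\<bar> powr q) + ennreal e)"
        unfolding e_def using q0 by (intro ennreal_powr_add_le) auto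
      finally show ?thesis using True \<open>y \<in> ball x N\<close> by simp
    qed simp
  qed
  also have "\<dots> = ennreal (2 powr q) * ((\<integral>\<^sup>+ y. ennreal (\<bar>u y - approx n x\<bar> powr q) * indicator (ball x N) y \<partial>\<nu>) + ennreal e * ennreal (V x N))"
    by (simp add: nn_integral_cmult nn_integral_add emeasure_ball)
  also have "\<dots> \<le> ennreal (2 powr q) * (ennreal (P * V x N) + ennreal e * ennreal (V x N))"
    unfolding N_def P_def by (intro mult_left_mono add_right_mono sobolev_poincare[OF ps q b A]) auto
  also have "\<dots> = ennreal (2 powr q * (P + e) * V x N)"
    using P by (simp add: distrib_right mult.assoc flip: ennreal_mult ennreal_plus)
  also have "\<dots> \<le> ennreal (2 powr q * (P + e) * (Cd * V x r))"
    using P by (intro ennreal_leI mult_left_mono VN) auto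
  finally have le: "(\<integral>\<^sup>+ y. ennreal (\<bar>precise y - precise x\<bar> powr q) * indicator (ball x r) y \<partial>\<nu>)
    \<le> ennreal (2 powr q * (P + e) * (Cd * V x r))" .
  have "(LINT y:ball x r|\<nu>. \<bar>precise y - precise x\<bar> powr q)
    = enn2real (\<integral>\<^sup>+ y. ennreal (indicator (ball x r) y * \<bar>precise y - precise x\<bar> powr q) \<partial>\<nu>)"
    unfolding set_lebesgue_integral_def by (subst integral_eq_nn_integral) auto
  also have "(\<integral>\<^sup>+ y. ennreal (indicator (ball x r) y * \<bar>precise y - precise x\<bar> powr q) \<partial>\<nu>)
    = (\<integral>\<^sup>+ y. ennreal (\<bar>precise y - precise x\<bar> powr q) * indicator (ball x r) y \<partial>\<nu>)"
    by (intro nn_integral_cong) (auto simp: indicator_def)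
  also have "enn2real \<dots> \<le> 2 powr q * (P + e) * (Cd * V x r)"
    using le P Cd_pos by (intro enn2real_leI) auto
  finally show ?thesis using V_pos[OF r0, of x]
    by (simp add: V_def[symmetric] P_def e_def divide_le_eq mult_ac)
qed

text \<open>Off the exceptional set \<open>b\<close> may be taken arbitrarily small once the dyadic
  radii are small, which handles the first term of \<open>mean_power_le\<close>; convergence of the
  averages at \<open>x\<close> handles the second.\<close>

lemma lebesgue_point_precise:
  assumes ps: "p * \<theta> < s" and q: "q = s * p / (s - p * \<theta>)" and x: "x \<notin> exceptional_set"
  shows "((\<lambda>r. (LINT y:ball x r|\<nu>. \<bar>precise y - precise x\<bar> powr q) / measure \<nu> (ball x r)) \<longlongrightarrow> 0) (at_right 0)"
proof (rule tendstoI)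
  fix \<epsilon> :: real assume eps: "0 < \<epsilon>"
  have q0: "0 < q" using q s_pos p_ge_1 ps by (auto intro!: divide_pos_pos mult_pos_pos)
  define M where "M = Cd * 2 powr q"
  have M: "0 < M" using Cd_pos by (simp add: M_def)
  have "(\<lambda>k. M * (poincare_const q * (1 / real (Suc k)) powr (q / p))) \<longlonglongrightarrow> M * (poincare_const q * 0)"
    using p_ge_1 q0 LIMSEQ_inverse_real_of_nat
    by (intro tendsto_mult tendsto_const tendsto_zero_powrI[OF _ tendsto_const[of "q / p"]]) (auto simp: inverse_eq_divide)
  then have "\<forall>\<^sub>F k in sequentially. M * (poincare_const q * (1 / real (Suc k)) powr (q / p)) < \<epsilon> / 2"
    using eps by (intro order_tendstoD(2)) auto
  then obtain k where k: "M * (poincare_const q * (1 / real (Suc k)) powr (q / p)) < \<epsilon> / 2"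
    using eventually_happens'[OF sequentially_bot] by blast
  define b where "b = 1 / real (Suc k)"
  have "Phi 0 x < \<infinity>" using x by (auto simp: exceptional_set_def less_top)
  then have conv: "(\<lambda>n. approx n x) \<longlonglongrightarrow> precise x" by (rule approx_tendsto_precise)
  have "(\<lambda>n. \<bar>approx n x - precise x\<bar>) \<longlonglongrightarrow> \<bar>precise x - precise x\<bar>" by (intro tendsto_intros conv)
  then have "(\<lambda>n. M * \<bar>approx n x - precise x\<bar> powr q) \<longlonglongrightarrow> M * 0"
    using q0 by (intro tendsto_mult tendsto_const tendsto_zero_powrI[OF _ tendsto_const[of q]]) auto
  then have "\<forall>\<^sub>F n in sequentially. M * \<bar>approx n x - precise x\<bar> powr q < \<epsilon> / 2"
    using eps by (intro order_tendstoD(2)) auto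
  then obtain N1 where N1: "\<And>n. N1 \<le> n \<Longrightarrow> M * \<bar>approx n x - precise x\<bar> powr q < \<epsilon> / 2"
    by (auto simp: eventually_sequentially)
  obtain N2 where "x \<notin> concentration_set b N2" using x by (auto simp: exceptional_set_def b_def)
  then have N2: "local_tail n x \<le> ennreal (b * rad n powr (- (p * \<theta>)) * V x (rad n))" if "N2 \<le> n" for n
    using that by (auto simp: concentration_set_def not_less)
  define N where "N = max N1 N2"
  show "\<forall>\<^sub>F r in at_right 0. dist ((LINT y:ball x r|\<nu>. \<bar>precise y - precise x\<bar> powr q) / measure \<nu> (ball x r)) 0 < \<epsilon>"
    unfolding eventually_at_right_field
  proof (intro exI[of _ "rad N"] conjI allI impI rad_pos)
    fix r :: real assume r: "0 < r" "r < rad N"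
    have "r < R" using r(2) rad_le_R[of N] by linarith
    from dyadic_scale[OF r(1) this] obtain n where n: "rad (Suc n) \<le> r" "r < rad n" by (auto simp: rad_def)
    have "N \<le> n"
    proof (rule ccontr)
      assume "\<not> N \<le> n"
      then have "rad N \<le> rad (Suc n)" by (intro rad_mono) simp
      then show False using n r by simp
    qed
    have "(LINT y:ball x r|\<nu>. \<bar>precise y - precise x\<bar> powr q) / measure \<nu> (ball x r)
      \<le> M * (poincare_const q * b powr (q / p) + \<bar>approx n x - precise x\<bar> powr q)"
      unfolding M_def using \<open>N \<le> n\<close> by (intro mean_power_le[OF ps q _ N2 n]) (auto simp: b_def N_def)
    also have "\<dots> < \<epsilon>" using k N1[of n] \<open>N \<le> n\<close> by (simp add: b_def N_def distrib_left)
    finally have "(LINT y:ball x r|\<nu>. \<bar>precise y - precise x\<bar> powr q) / measure \<nu> (ball x r) < \<epsilon>" .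
    moreover have "0 \<le> (LINT y:ball x r|\<nu>. \<bar>precise y - precise x\<bar> powr q) / measure \<nu> (ball x r)"
      unfolding set_lebesgue_integral_def by (intro divide_nonneg_nonneg integral_nonneg) auto
    ultimately show "dist ((LINT y:ball x r|\<nu>. \<bar>precise y - precise x\<bar> powr q) / measure \<nu> (ball x r)) 0 < \<epsilon>"
      by (simp add: dist_real_def)
  qed
qed

end

theorem corollary1p2:
  fixes \<nu> :: "'a::metric_space measure" and p \<theta> s c :: real
  assumes "compact (UNIV :: 'a set)"
    and "\<exists>x y :: 'a. x \<noteq> y"
    and "doubling_measure \<nu>"
    and "1 \<le> p"
    and "0 < \<theta>" and "\<theta> < 1"
    and "0 < s" and "0 < c"
    and "\<And>\<zeta> r r'. 0 < r' \<Longrightarrow> r' \<le> r \<Longrightarrow> r \<le> 2 * diameter (UNIV :: 'a set) \<Longrightarrow>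
           measure \<nu> (ball \<zeta> r') / measure \<nu> (ball \<zeta> r) \<ge> c * (r' / r) powr s"
  shows
    "((\<forall>v. (\<exists>L. L-lipschitz_on UNIV v) \<longrightarrow> v \<in> besov_space \<nu> \<theta> p) \<and>
      (\<forall>u \<in> besov_space \<nu> \<theta> p. \<forall>\<epsilon>>0. \<exists>v. (\<exists>L. L-lipschitz_on UNIV v) \<and>
         besov_norm \<nu> \<theta> p (\<lambda>x. u x - v x) < \<epsilon>) \<and>
      (\<forall>u \<in> besov_space \<nu> \<theta> p. \<exists>v. (AE x in \<nu>. v x = u x) \<and> besov_quasicontinuous \<nu> \<theta> p v))
     \<and>
     (p > s / \<theta> \<longrightarrow>
      (\<forall>u \<in> besov_space \<nu> \<theta> p. \<exists>v. (AE x in \<nu>. v x = u x) \<and> holder_continuous v))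
     \<and>
     (p * \<theta> < s \<and> reverse_doubling_measure \<nu> \<longrightarrow>
      (let q = s * p / (s - p * \<theta>) in
        besov_space \<nu> \<theta> p \<subseteq> Lp_space \<nu> q \<and>
        (\<forall>w \<in> besov_space \<nu> \<theta> p. \<exists>u. (AE x in \<nu>. u x = w x) \<and> u \<in> Lp_space \<nu> q \<and>
           (\<exists>F. besov_cap \<nu> \<theta> p F = 0 \<and>
              (\<forall>\<zeta>. \<zeta> \<notin> F \<longrightarrow>
                 ((\<lambda>r. (LINT x:ball \<zeta> r|\<nu>. \<bar>u x - u \<zeta>\<bar> powr q) / measure \<nu> (ball \<zeta> r))
                    \<longlongrightarrow> 0) (at_right 0))))))"
  proof -
  obtain C where C: "0 < C" "\<And>x r. 0 < r \<Longrightarrow> 0 < emeasure \<nu> (ball x (2 * r)) \<and>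
      emeasure \<nu> (ball x (2 * r)) \<le> ennreal C * emeasure \<nu> (ball x r) \<and> emeasure \<nu> (ball x r) < \<infinity>"
    and reg: "borel_regular \<nu>"
    using assms(3) unfolding doubling_measure_def by blast
  interpret besov_setting \<nu> C p \<theta>
  proof
    show "space \<nu> = UNIV" "sets borel \<subseteq> sets \<nu>" using reg by (auto simp: borel_regular_def)
  qed (use assms(1,2,4,5,6) C in auto)
  \<comment> \<open>As \<open>R\<close> is twice the diameter, the assumed bound on volume ratios is
    \<open>lower_mass\<close> itself.\<close>
  have lower: "besov_lower \<nu> C p \<theta> u s c" if "u \<in> besov_space \<nu> \<theta> p" for u
  proof
    show "u \<in> besov_space \<nu> \<theta> p" "0 < s" "0 < c" using that assms(7,8) by auto
    show "c * (r' / r) powr s \<le> V x r' / V x r" if "0 < r'" "r' \<le> r" "r \<le> R" for x r r'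
      using assms(9)[of r' r x] that by (simp add: V_def R_def)
  qed
  have lip: "v \<in> besov_space \<nu> \<theta> p" if "\<exists>L. L-lipschitz_on UNIV v" for v
    using that lipschitz_in_besov_space by blast
  have dense: "\<exists>v. (\<exists>L. L-lipschitz_on UNIV v) \<and> besov_norm \<nu> \<theta> p (\<lambda>x. u x - v x) < \<epsilon>"
    if "u \<in> besov_space \<nu> \<theta> p" "0 < \<epsilon>" for u \<epsilon>
  proof -
    interpret B: besov_lower \<nu> C p \<theta> u s c by (rule lower[OF that(1)])
    show ?thesis using B.lipschitz_dense[OF that(2)] B.lipschitz_approx by blast
  qed
  have quasi: "\<exists>v. (AE x in \<nu>. v x = u x) \<and> besov_quasicontinuous \<nu> \<theta> p v" if "u \<in> besov_space \<nu> \<theta> p" for u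
  proof -
    interpret B: besov_lower \<nu> C p \<theta> u s c by (rule lower[OF that])
    show ?thesis using B.precise_AE B.quasicontinuous_precise by blast
  qed
  have holder: "\<exists>v. (AE x in \<nu>. v x = u x) \<and> holder_continuous v"
    if "s / \<theta> < p" "u \<in> besov_space \<nu> \<theta> p" for u
  proof -
    interpret B: besov_lower \<nu> C p \<theta> u s c by (rule lower[OF that(2)])
    have "s < p * \<theta>" using that(1) theta by (simp add: field_simps)
    then show ?thesis using B.precise_AE B.holder_precise by blast
  qed
  have Lq: "u \<in> Lp_space \<nu> (s * p / (s - p * \<theta>))" if "p * \<theta> < s" "u \<in> besov_space \<nu> \<theta> p" for u
    using besov_lower.Lq_besov[OF lower[OF that(2)] that(1) refl] .
  have points: "\<exists>u. (AE x in \<nu>. u x = w x) \<and> u \<in> Lp_space \<nu> q \<and>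
      (\<exists>F. besov_cap \<nu> \<theta> p F = 0 \<and> (\<forall>\<zeta>. \<zeta> \<notin> F \<longrightarrow>
        ((\<lambda>r. (LINT x:ball \<zeta> r|\<nu>. \<bar>u x - u \<zeta>\<bar> powr q) / measure \<nu> (ball \<zeta> r)) \<longlongrightarrow> 0) (at_right 0)))"
    if "p * \<theta> < s" "q = s * p / (s - p * \<theta>)" "w \<in> besov_space \<nu> \<theta> p" for w q
  proof -
    interpret B: besov_lower \<nu> C p \<theta> w s c by (rule lower[OF that(3)])
    show ?thesis
      using B.precise_AE B.Lq_precise[OF that(1,2)] B.cap_exceptional_set B.lebesgue_point_precise[OF that(1,2)] by blast
  qed
  show ?thesis
    unfolding Let_def using lip dense quasi holder Lq points[OF _ refl] by (intro conjI allI ballI impI subsetI) auto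
qed

end
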